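(* There exist $\epsilon>0$ and a function $\Phi(s,w)$, holomorphic on the region $\{(s,w)\in\mathbb{C}^2 : \Re(s)>2-\epsilon,\ \Re(s+w)>2\}$, such that the height zeta function $\mathsf Z(s,w)$ (defined by its series for $\Re s,\Re w$ large, and by meromorphic continuation in this region) satisfies $$\mathsf Z(s,w)=\frac{\Lambda(s+w-2)}{\Lambda(s+w)}E(s-3/2,e)-\frac{\Lambda(s+w-1)}{\Lambda(s+w)}E(s-1/2,e)+\Phi(s,w).$$
   Context: Let $G=\mathrm{PGL}_2$ over $\mathbb{Q}$, with $e\in G(\mathbb{A})$ the identity. For a place $v$ of $\mathbb{Q}$ and $g=\begin{pmatrix} a&b\\c&d\end{pmatrix}\in G(\mathbb{Q}_v)$ put, for $v$ finite, $$\mathsf H_{E,v}(g)=\frac{\max\{|a|_v,|b|_v,|c|_v,|d|_v\}}{\max\{|c|_v,|d|_v\}},\qquad \mathsf H_{\tilde D,v}(g)=\frac{\max\{|a|_v,|b|_v,|c|_v,|d|_v\}\max\{|c|_v,|d|_v\}}{|ad-bc|_v},$$ and for $v=\infty$ use the same formulas with the maxima replaced by the Euclidean norms $\sqrt{a^2+b^2+c^2+d^2}$ and $\sqrt{c^2+d^2}$. Set $\mathsf H(g,s,w)=\prod_v\mathsf H_{\tilde D,v}(g_v)^s\,\mathsf H_{E,v}(g_v)^w$. The height zeta function is $$\mathsf Z(s,w)=\sum_{\gamma\in G(\mathbb{Q})}\mathsf H(\gamma,s,w)^{-1},$$ convergent for $\Re s,\Re w$ large. $\Lambda(s)=\pi^{-s/2}\Gamma(s/2)\zeta(s)$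 is the completed Riemann zeta function. Eisenstein series: let $P\subset G$ be the upper triangular Borel subgroup, and let $K=\prod_vK_v$ with $K_p=\mathrm{PGL}_2(\mathbb{Z}_p)$ and $K_\infty$ the image of $\mathrm{SO}_2(\mathbb{R})$. By the Iwasawa decomposition write $g_v=\begin{pmatrix}1&x_v\\&1\end{pmatrix}\begin{pmatrix}a_v\\&1\end{pmatrix}k_v$, and set $\chi_P(g)=\prod_v|a_v|_v$. Then $$E(s,g)=\sum_{\gamma\in P(\mathbb{Q})\backslash G(\mathbb{Q})}\chi_P(\gamma g)^{s+1/2}$$ for $\Re(s)>1/2$, extended meromorphically to $s\in\mathbb{C}$. (Thus $E(s,e)=\sum_{(c:d)\in\mathbb{P}^1(\mathbb{Q})}(c^2+d^2)^{-(s+1/2)}$, where $c,d$ are coprime integer representatives.) *)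

theory Defs
  imports "HOL-Complex_Analysis.Complex_Analysis"
begin

section \<open>Places of the rationals\<close>

datatype place = Infinite | Finite nat

definition places :: "place set" where
  "places = insert Infinite (Finite ` {p. prime p})"

definition padic_abs :: "nat \<Rightarrow> rat \<Rightarrow> real" where
  "padic_abs p x = (if x = 0 then 0 else
     (case quotient_of x of (m, n) \<Rightarrow>
       real p powi (int (multiplicity (int p) n) - int (multiplicity (int p) m))))"

fun place_abs :: "place \<Rightarrow> rat \<Rightarrow> real" where
  "place_abs Infinite x = \<bar>real_of_rat x\<bar>"
| "place_abs (Finite p) x = padic_abs p x"

fun local_norm :: "place \<Rightarrow> rat list \<Rightarrow> real" where
  "local_norm Infinite xs = sqrt (\<Sum>x\<leftarrow>xs. (real_of_rat x)\<^sup>2)"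
| "local_norm (Finite p) xs = Max (padic_abs p ` set xs)"

text \<open>
  Product over all places of a family of local factors, almost all of which are 1 (as is the
  case for every product formed below).
\<close>
definition prod_places :: "(place \<Rightarrow> 'a::comm_monoid_mult) \<Rightarrow> 'a" where
  "prod_places f = (\<Prod>v \<in> {v \<in> places. f v \<noteq> 1}. f v)"


section \<open>The height zeta function of PGL(2)\<close>

definition mat2 :: "'a::zero \<Rightarrow> 'a \<Rightarrow> 'a \<Rightarrow> 'a \<Rightarrow> 'a^2^2" where
  "mat2 a b c d = vector [vector [a, b], vector [c, d]]"

definition GL2_Q :: "(rat^2^2) set" where
  "GL2_Q = {A. det A \<noteq> 0}"

definition PGL2_Q :: "(rat^2^2) set set" where
  "PGL2_Q = GL2_Q // {(A, B). \<exists>t. t \<noteq> 0 \<and> B = mat t ** A}"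

definition height_E :: "place \<Rightarrow> rat^2^2 \<Rightarrow> real" where
  "height_E v A =
     local_norm v [A$1$1, A$1$2, A$2$1, A$2$2] / local_norm v [A$2$1, A$2$2]"

definition height_D :: "place \<Rightarrow> rat^2^2 \<Rightarrow> real" where
  "height_D v A =
     local_norm v [A$1$1, A$1$2, A$2$1, A$2$2] * local_norm v [A$2$1, A$2$2]
       / place_abs v (det A)"

definition height :: "rat^2^2 \<Rightarrow> complex \<Rightarrow> complex \<Rightarrow> complex" where
  "height A s w =
     prod_places (\<lambda>v. of_real (height_D v A) powr s * of_real (height_E v A) powr w)"

text \<open>
  The local heights, hence \<^const>\<open>height\<close>, are invariant under scaling of the matrix;
  \<^const>\<open>the_elem\<close> extracts the common value on a class in \<^const>\<open>PGL2_Q\<close>.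
\<close>
definition height_zeta_term :: "complex \<Rightarrow> complex \<Rightarrow> (rat^2^2) set \<Rightarrow> complex" where
  "height_zeta_term s w X = inverse (the_elem ((\<lambda>A. height A s w) ` X))"


section \<open>Meromorphic continuation in one variable\<close>

text \<open>
  The meromorphic continuation to the complex plane of a function given on \<open>U\<close>;
  it takes the value 0 at its poles.
\<close>
definition mero_cont :: "complex set \<Rightarrow> (complex \<Rightarrow> complex) \<Rightarrow> complex \<Rightarrow> complex" where
  "mero_cont U f = (THE F. F nicely_meromorphic_on UNIV \<and> (\<forall>s\<in>U. F s = f s))"

definition zeta :: "complex \<Rightarrow> complex" where
  "zeta = mero_cont {s. Re s > 1} (\<lambda>s. \<Sum>n. 1 / of_nat (Suc n) powr s)"

text \<open>
  \<^const>\<open>remove_sings\<close> only matters at the negative even integers, where a pole of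
  \<^const>\<open>Gamma\<close> cancels a zero of \<^const>\<open>zeta\<close>.
\<close>
definition Lambda :: "complex \<Rightarrow> complex" where
  "Lambda = remove_sings (\<lambda>s. of_real pi powr (- s / 2) * Gamma (s / 2) * zeta s)"


section \<open>The Eisenstein series at the identity\<close>

definition GL2_Z_loc :: "nat \<Rightarrow> (rat^2^2) set" where
  "GL2_Z_loc p = {k. (\<forall>i j. padic_abs p (k$i$j) \<le> 1) \<and> padic_abs p (det k) = 1}"

text \<open>
  \<open>iwasawa_abs v A r\<close>: the class of \<open>A\<close> in \<open>PGL(2)\<close> over the completion at \<open>v\<close> has an
  Iwasawa decomposition \<open>n(x) diag(a,1) k\<close> with \<open>|a| = r\<close>. The factor \<open>t\<close> accounts
  for scalars. As \<open>A\<close> is rational, at a finite place the decomposition exists with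
  rational \<open>t, x, a, k\<close>, and \<open>|a|\<close> does not depend on the decomposition; so there is no need
  for the \<open>p\<close>-adic completion, and \<open>GL(2)\<close> of the localization of the integers at \<open>p\<close> stands
  for \<open>GL(2)\<close> of the \<open>p\<close>-adic integers.
\<close>
fun iwasawa_abs :: "place \<Rightarrow> rat^2^2 \<Rightarrow> real \<Rightarrow> bool" where
  "iwasawa_abs Infinite A r \<longleftrightarrow>
     (\<exists>(t::real) x a k. t \<noteq> 0 \<and> a \<noteq> 0 \<and> rotation_matrix k \<and>
        map_matrix real_of_rat A = mat t ** mat2 1 x 0 1 ** mat2 a 0 0 1 ** k \<and> r = \<bar>a\<bar>)"
| "iwasawa_abs (Finite p) A r \<longleftrightarrow>
     (\<exists>t x a k. t \<noteq> 0 \<and> a \<noteq> 0 \<and> k \<in> GL2_Z_loc p \<and>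
        A = mat t ** mat2 1 x 0 1 ** mat2 a 0 0 1 ** k \<and> r = padic_abs p a)"

definition chi_P :: "rat^2^2 \<Rightarrow> real" where
  "chi_P A = prod_places (\<lambda>v. THE r. iwasawa_abs v A r)"

text \<open>
  \<open>P(\<rat>)\G(\<rat>)\<close>, with scalars absorbed: the cosets \<open>B A\<close> of the invertible upper triangular
  matrices \<open>B\<close> in \<open>GL(2)\<close>. By the product formula \<^const>\<open>chi_P\<close> is constant on each of them.
\<close>
definition P_cosets :: "(rat^2^2) set set" where
  "P_cosets = GL2_Q // {(A, B). \<exists>x y z. x \<noteq> 0 \<and> z \<noteq> 0 \<and> B = mat2 x y 0 z ** A}"

definition eisenstein_e :: "complex \<Rightarrow> complex" where
  "eisenstein_e = mero_cont {s. Re s > 1 / 2}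
     (\<lambda>s. \<Sum>\<^sub>\<infinity>X\<in>P_cosets. of_real (the_elem (chi_P ` X)) powr (s + 1 / 2))"


section \<open>Functions of two complex variables\<close>

definition holomorphic2_on :: "(complex \<times> complex \<Rightarrow> complex) \<Rightarrow> (complex \<times> complex) set \<Rightarrow> bool" where
  "holomorphic2_on f U \<longleftrightarrow>
     (\<forall>z\<in>U. \<exists>D. (f has_derivative D) (at z) \<and> (\<forall>c x y. D (c * x, c * y) = c * D (x, y)))"

text \<open>
  Locally a quotient \<open>g / h\<close> of holomorphic functions, where \<open>h\<close> does not vanish identically on
  any nonempty open set. The values at the zeros of \<open>h\<close> are irrelevant.
\<close>
definition meromorphic2_on :: "(complex \<times> complex \<Rightarrow> complex) \<Rightarrow> (complex \<times> complex) set \<Rightarrow> bool" where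
  "meromorphic2_on F U \<longleftrightarrow>
     (\<forall>z\<in>U. \<exists>V g h. open V \<and> z \<in> V \<and> holomorphic2_on g V \<and> holomorphic2_on h V \<and>
        (\<forall>W. open W \<and> W \<noteq> {} \<and> W \<subseteq> V \<longrightarrow> (\<exists>y\<in>W. h y \<noteq> 0)) \<and>
        (\<forall>y\<in>V. h y \<noteq> 0 \<longrightarrow> F y = g y / h y))"

definition region :: "real \<Rightarrow> (complex \<times> complex) set" where
  "region \<epsilon> = {(s, w). Re s > 2 - \<epsilon> \<and> Re (s + w) > 2}"

text \<open>
  \<open>Z\<close> is the height zeta function on the connected region \<open>U\<close>: the series converges
  (absolutely, as always for \<^const>\<open>summable_on\<close> in \<open>\<complex>\<close>) to \<open>Z\<close> for large real parts, and
  \<open>Z\<close> is meromorphic on \<open>U\<close>.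
\<close>
definition height_zeta_on :: "(complex \<times> complex \<Rightarrow> complex) \<Rightarrow> (complex \<times> complex) set \<Rightarrow> bool" where
  "height_zeta_on Z U \<longleftrightarrow> meromorphic2_on Z U \<and>
     (\<exists>M. \<forall>s w. Re s > M \<and> Re w > M \<longrightarrow> (height_zeta_term s w has_sum Z (s, w)) PGL2_Q)"

end

theory Submission
  imports Defs
begin

text \<open>
  Write $u = s + w$. A class in PGL(2) over the rationals has a primitive integer representative with rows
  $(a,b)$ and $(c,d)$; with $N = a^2+b^2+c^2+d^2$ and $n = (c^2+d^2)/\gcd(c,d)^2$ its term in the height
  zeta function is $N^{-u/2} n^{u/2-s}$. Multiplication by $\zeta(u)$ removes the primitivity condition.
  For a bottom row $g (c_0,d_0)$ with $(c_0,d_0)$ primitive, the top row runs over all lattice points off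
  the line through $(c_0,d_0)$. The sum over the whole lattice is compared with the integral
  over the plane, $\sum_v (|v|^2+R)^{-u/2} = \frac{2\pi}{u-2} R^{1-u/2} + O(R^{(1-\Re u)/2})$ at $R = g^2 n$.
  The main term sums to the first summand of the theorem. The error is small enough for its sum to be
  holomorphic for $\Re s > 3/2$, $\Re u > 2$. The sum over the line factors as $E(s-1/2,e)$ times a
  function of $u$, and both it and the second summand of the theorem are holomorphic in the region.

  The continuation of $\zeta(2s)$ and of $\sum_v |v|^{-2s}$ to the plane needs no theta functions: twisting by the
  sign $(-1)^{x+y}$ multiplies these series by the elementary factors $2 \cdot 4^{-s} - 1$ and $2 \cdot 2^{-s} - 1$, and repeated
  summation by parts makes the twisted series converge everywhere.
\<close>


section \<open>Holomorphic and meromorphic functions of two variables\<close>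

text \<open>The region is dictated by the error term. With R = g^2 n, the error R^((1 - Re u)/2)
  times the weight n^(Re u/2 - Re s) is g^(1 - Re u) n^(1/2 - Re s): the sum over g asks for Re u >
  2, the sum over primitive vectors for Re s > 3/2. The choice \<epsilon> = 1/4 leaves the fixed
  exponent 5/4 in the latter. There \<zeta>(u) is inverted only for Re u > 2, where the term 1 of
  its series dominates the others.

  The values at u - 2 and at s - 3/2 lie beyond the defining series. The sums over the line y = 0
  and over the plane differ only in the range of y, so a single argument with differences in x
  continues both; their quotient is the Eisenstein series up to a shift of the variable.

  The continued height zeta function is defined by the right-hand side of the theorem, so that its
  meromorphy and its agreement with the series for large real parts are what has to be
  proved.\<close>

lemma holomorphic_on_infsum:
  fixes f :: "'i \<Rightarrow> complex \<Rightarrow> complex"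
  assumes U: "open U"
    and hol: "\<And>i. i \<in> I \<Longrightarrow> f i holomorphic_on U"
    and bound: "\<And>z0. z0 \<in> U \<Longrightarrow> \<exists>V M. open V \<and> z0 \<in> V \<and> M summable_on I \<and> (\<forall>i\<in>I. \<forall>z\<in>V. norm (f i z) \<le> M i)"
  shows "(\<lambda>z. \<Sum>\<^sub>\<infinity>i\<in>I. f i z) holomorphic_on U"
proof -
  have "(\<lambda>z. \<Sum>\<^sub>\<infinity>i\<in>I. f i z) field_differentiable (at z0)" if z0: "z0 \<in> U" for z0
  proof -
    obtain V M where V: "open V" "z0 \<in> V" "M summable_on I"
      "\<And>i z. i \<in> I \<Longrightarrow> z \<in> V \<Longrightarrow> norm (f i z) \<le> M i"
      using bound[OF z0] by blast
    have "open (U \<inter> V)" using U V by auto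
    then obtain r where r: "r > 0" "cball z0 r \<subseteq> U \<inter> V"
      using open_contains_cball z0 V by blast
    \<comment> \<open>\<open>infsum\<close> is a limit along the finite subsets of I, so the M-test
      applies to this filter directly and I is never enumerated.\<close>
    have ul: "uniform_limit (cball z0 r) (\<lambda>X z. \<Sum>i\<in>X. f i z) (\<lambda>z. \<Sum>\<^sub>\<infinity>i\<in>I. f i z) (finite_subsets_at_top I)"
      by (rule Weierstrass_m_test_general[where M = M]) (use V r in auto)
    have ev: "\<forall>\<^sub>F X in finite_subsets_at_top I. continuous_on (cball z0 r) (\<lambda>z. \<Sum>i\<in>X. f i z)
        \<and> (\<lambda>z. \<Sum>i\<in>X. f i z) holomorphic_on ball z0 r"
    proof (rule eventually_finite_subsets_at_top_weakI)
      fix X assume "finite X" "X \<subseteq> I"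
      then have *: "(\<lambda>z. \<Sum>i\<in>X. f i z) holomorphic_on U"
        by (intro holomorphic_intros hol) auto
      show "continuous_on (cball z0 r) (\<lambda>z. \<Sum>i\<in>X. f i z) \<and> (\<lambda>z. \<Sum>i\<in>X. f i z) holomorphic_on ball z0 r"
        using r by (intro conjI holomorphic_on_imp_continuous_on holomorphic_on_subset[OF *]) auto
    qed
    have "(\<lambda>z. \<Sum>\<^sub>\<infinity>i\<in>I. f i z) holomorphic_on ball z0 r"
      by (rule holomorphic_uniform_limit[OF ev ul]) auto
    then show ?thesis
      using r(1) by (simp add: holomorphic_on_imp_differentiable_at)
  qed
  then show ?thesis
    by (simp add: U holomorphic_on_def field_differentiable_at_within)
qed

text \<open>Supplies the joint continuity that \<open>holomorphic2_onI_separately\<close> asks for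
  when the sum is a function of two variables.\<close>

lemma continuous_on_infsum:
  fixes f :: "'i \<Rightarrow> 'a::t2_space \<Rightarrow> complex"
  assumes cont: "\<And>i. i \<in> I \<Longrightarrow> continuous_on U (f i)" and U: "open U"
    and bound: "\<And>z0. z0 \<in> U \<Longrightarrow> \<exists>V M. open V \<and> z0 \<in> V \<and> M summable_on I \<and> (\<forall>i\<in>I. \<forall>z\<in>V. norm (f i z) \<le> M i)"
  shows "continuous_on U (\<lambda>z. \<Sum>\<^sub>\<infinity>i\<in>I. f i z)"
proof -
  have "isCont (\<lambda>z. \<Sum>\<^sub>\<infinity>i\<in>I. f i z) z0" if z0: "z0 \<in> U" for z0
  proof -
    obtain V M where V: "open V" "z0 \<in> V" "M summable_on I"
      "\<And>i z. i \<in> I \<Longrightarrow> z \<in> V \<Longrightarrow> norm (f i z) \<le> M i"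
      using bound[OF z0] by blast
    have ul: "uniform_limit (U \<inter> V) (\<lambda>X z. \<Sum>i\<in>X. f i z) (\<lambda>z. \<Sum>\<^sub>\<infinity>i\<in>I. f i z) (finite_subsets_at_top I)"
      by (rule Weierstrass_m_test_general[where M = M]) (use V in auto)
    have ev: "\<forall>\<^sub>F X in finite_subsets_at_top I. continuous_on (U \<inter> V) (\<lambda>z. \<Sum>i\<in>X. f i z)"
      by (rule eventually_finite_subsets_at_top_weakI)
         (intro continuous_intros continuous_on_subset[OF cont], auto)
    have "continuous_on (U \<inter> V) (\<lambda>z. \<Sum>\<^sub>\<infinity>i\<in>I. f i z)"
      by (rule uniform_limit_theorem[OF ev ul]) simp
    then show ?thesis
      using U V z0 by (simp add: continuous_on_eq_continuous_at open_Int)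
  qed
  then show ?thesis
    by (simp add: U continuous_on_eq_continuous_at)
qed

lemma norm_deriv_le:
  assumes "f holomorphic_on S" "open S" "cball z r \<subseteq> S" "r > 0" "\<And>w. w \<in> cball z r \<Longrightarrow> norm (f w) \<le> B"
  shows "norm (deriv f z) \<le> B / r"
proof -
  have "norm ((deriv ^^ 1) f z) \<le> fact 1 * B / r ^ 1"
  proof (rule Cauchy_inequality)
    show "f holomorphic_on ball z r"
      by (rule holomorphic_on_subset[OF assms(1)]) (use assms(3) in auto)
    show "continuous_on (cball z r) f"
      by (rule holomorphic_on_imp_continuous_on, rule holomorphic_on_subset[OF assms(1,3)])
  qed (use assms in \<open>auto simp: dist_norm\<close>)
  then show ?thesis by simp
qed

text \<open>Uniform continuity on the compact polydisc makes \<open>g x\<close> and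
  \<open>g a\<close> uniformly close for x near a. Cauchy's inequality passes this closeness on to
  the derivatives, and \<open>deriv (g a)\<close> is itself continuous.\<close>

lemma isCont_deriv_param:
  fixes g :: "complex \<Rightarrow> complex \<Rightarrow> complex"
  assumes r: "r > 0" and cont: "continuous_on (cball a r \<times> cball b r) (\<lambda>(x, y). g x y)"
    and hol: "\<And>x. x \<in> cball a r \<Longrightarrow> g x holomorphic_on ball b r"
  shows "isCont (\<lambda>(x, y). deriv (g x) y) (a, b)"
proof -
  have ha: "g a holomorphic_on ball b r" using hol r by auto
  have "deriv (g a) holomorphic_on ball b r" using ha by (rule holomorphic_deriv) auto
  then have ca: "isCont (deriv (g a)) b"
    using r by (meson analytic_at_imp_isCont centre_in_ball holomorphic_on_imp_analytic_at open_ball)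
  have uc: "uniformly_continuous_on (cball a r \<times> cball b r) (\<lambda>(x, y). g x y)"
    by (intro compact_uniformly_continuous cont compact_Times compact_cball)
  show ?thesis
    unfolding isCont_def
  proof (rule tendstoI)
    fix e :: real assume e: "e > 0"
    \<comment> \<open>Cauchy's inequality on discs of radius r / 4 turns the bound \<eta> into
      \<eta> / (r / 4) = e / 2.\<close>
    define \<eta> where "\<eta> = e * r / 8"
    have \<eta>: "\<eta> > 0" using e r by (simp add: \<eta>_def)
    obtain d where d: "d > 0" "\<And>p q. p \<in> cball a r \<times> cball b r \<Longrightarrow> q \<in> cball a r \<times> cball b r \<Longrightarrow> dist p q < d
         \<Longrightarrow> dist (case p of (x, y) \<Rightarrow> g x y) (case q of (x, y) \<Rightarrow> g x y) < \<eta>"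
      using uc \<eta> unfolding uniformly_continuous_on_def by (metis dist_commute)
    obtain d' where d': "d' > 0" "\<And>y. dist y b < d' \<Longrightarrow> dist (deriv (g a) y) (deriv (g a) b) < e / 2"
      using ca e unfolding continuous_at_eps_delta by (metis half_gt_zero)
    \<comment> \<open>The bound r / 2 keeps the closed disc of radius r / 4 about y inside the disc
      of radius r about b.\<close>
    define \<rho> where "\<rho> = min (min d d') (r / 2)"
    have \<rho>: "\<rho> > 0" using d d' r by (auto simp: \<rho>_def)
    have key: "dist (deriv (g x) y) (deriv (g a) b) < e" if xy: "dist (x, y) (a, b) < \<rho>" for x y
    proof -
      have dx: "dist x a < \<rho>" "dist y b < \<rho>"
        using xy dist_fst_le[of "(x,y)" "(a,b)"] dist_snd_le[of "(x,y)" "(a,b)"] by auto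
      have x: "x \<in> cball a r" using dx r unfolding \<rho>_def by (auto simp: dist_commute)
      have sub: "cball y (r / 4) \<subseteq> ball b r"
      proof
        fix z assume "z \<in> cball y (r / 4)"
        then have "dist b z \<le> dist b y + dist y z" "dist y z \<le> r / 4"
          by (auto intro: dist_triangle)
        moreover have "dist b y < r / 2" using dx unfolding \<rho>_def by (auto simp: dist_commute)
        ultimately show "z \<in> ball b r" using r by auto
      qed
      have yb: "y \<in> ball b r" using sub r by (meson centre_in_cball less_eq_real_def subsetD zero_less_divide_iff zero_less_numeral)
      have "norm (deriv (\<lambda>w. g x w - g a w) y) \<le> \<eta> / (r / 4)"
      proof (rule norm_deriv_le)
        show "(\<lambda>w. g x w - g a w) holomorphic_on ball b r"
          by (intro holomorphic_intros hol x ha)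
        show "norm (g x w - g a w) \<le> \<eta>" if "w \<in> cball y (r / 4)" for w
        proof -
          have w: "w \<in> cball b r" using that sub by (meson ball_subset_cball subsetD)
          have "dist (x, w) (a, w) < d" using dx by (simp add: dist_Pair_Pair \<rho>_def)
          then show ?thesis using d(2)[of "(x, w)" "(a, w)"] x w r by (auto simp: dist_norm)
        qed
      qed (use sub r in auto)
      moreover have "deriv (\<lambda>w. g x w - g a w) y = deriv (g x) y - deriv (g a) y"
        using yb by (intro deriv_diff) (auto intro!: holomorphic_on_imp_differentiable_at[of _ "ball b r"] hol x ha)
      moreover have "\<eta> / (r / 4) = e / 2" using r by (simp add: \<eta>_def)
      ultimately have "dist (deriv (g x) y) (deriv (g a) y) \<le> e / 2" by (simp add: dist_norm)
      moreover have "dist (deriv (g a) y) (deriv (g a) b) < e / 2"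
        using d'(2) dx by (simp add: \<rho>_def)
      ultimately show ?thesis
        using dist_triangle[of "deriv (g x) y" "deriv (g a) b" "deriv (g a) y"] by linarith
    qed
    show "\<forall>\<^sub>F p in at (a, b). dist (case p of (x, y) \<Rightarrow> deriv (g x) y) (case (a, b) of (x, y) \<Rightarrow> deriv (g x) y) < e"
      unfolding eventually_at using \<rho> key by (intro exI[of _ \<rho>]) auto
  qed
qed

text \<open>Osgood's lemma. Two partial derivatives, one of them jointly continuous, give a total
  derivative; the joint continuity comes from \<open>isCont_deriv_param\<close>.\<close>

lemma holomorphic2_onI_separately:
  assumes U: "open U" and cont: "continuous_on U f"
    and hol1: "\<And>w. (\<lambda>s. f (s, w)) holomorphic_on {s. (s, w) \<in> U}"
    and hol2: "\<And>s. (\<lambda>w. f (s, w)) holomorphic_on {w. (s, w) \<in> U}"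
  shows "holomorphic2_on f U"
  unfolding holomorphic2_on_def
proof safe
  fix a b assume ab: "(a, b) \<in> U"
  define g where "g = (\<lambda>x y. f (x, y))"
  obtain A B where AB: "open A" "open B" "(a, b) \<in> A \<times> B" "A \<times> B \<subseteq> U"
    using open_prod_elim[OF U ab] by metis
  obtain r1 r2 where r12: "r1 > 0" "cball a r1 \<subseteq> A" "r2 > 0" "cball b r2 \<subseteq> B"
    using AB open_contains_cball by (metis mem_Sigma_iff)
  define r where "r = min r1 r2"
  have r: "r > 0" "cball a r \<times> cball b r \<subseteq> U"
  proof -
    show "r > 0" using r12 by (simp add: r_def)
    have "cball a r \<times> cball b r \<subseteq> A \<times> B" using r12 by (intro Sigma_mono) (auto simp: r_def)
    then show "cball a r \<times> cball b r \<subseteq> U" using AB by blast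
  qed
  have h2: "g x holomorphic_on ball b r" if "x \<in> cball a r" for x
    unfolding g_def by (rule holomorphic_on_subset[OF hol2]) (use r that in auto)
  have h1: "(\<lambda>x. g x b) holomorphic_on ball a r"
    unfolding g_def by (rule holomorphic_on_subset[OF hol1]) (use r in auto)
  have ic: "isCont (\<lambda>(x, y). deriv (g x) y) (a, b)"
  proof (rule isCont_deriv_param[OF r(1)])
    show "continuous_on (cball a r \<times> cball b r) (\<lambda>(x, y). g x y)"
      unfolding g_def using continuous_on_subset[OF cont r(2)] by (simp add: case_prod_unfold)
  qed (use h2 in auto)
  have "((\<lambda>(x, y). g x y) has_derivative
      (\<lambda>(tx, ty). (deriv (\<lambda>x. g x b) a * tx) + blinfun_mult_right (deriv (g a) b) ty))
      (at (a, b) within ball a r \<times> ball b r)"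
  proof (rule has_derivative_partialsI)
    have "((\<lambda>x. g x b) has_field_derivative deriv (\<lambda>x. g x b) a) (at a)"
      using h1 r(1) by (meson centre_in_ball holomorphic_derivI open_ball)
    then show "((\<lambda>x. g x b) has_derivative (\<lambda>tx. deriv (\<lambda>x. g x b) a * tx)) (at a within ball a r)"
      by (simp add: has_derivative_at_withinI has_field_derivative_def)
    show "(g x has_derivative blinfun_apply (blinfun_mult_right (deriv (g x) y))) (at y within ball b r)"
      if "x \<in> ball a r" "y \<in> ball b r" for x y
    proof -
      have "(g x has_field_derivative deriv (g x) y) (at y)"
        using h2[of x] that by (meson ball_subset_cball holomorphic_derivI open_ball subsetD)
      then show ?thesis
        by (simp add: has_derivative_at_withinI has_field_derivative_def)
    qed
    have "isCont (\<lambda>p. blinfun_mult_right (case p of (x, y) \<Rightarrow> deriv (g x) y)) (a, b)"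
      using ic by (rule bounded_linear.isCont[OF bounded_linear_blinfun_mult_right])
    then show "continuous (at (a, b) within ball a r \<times> ball b r) (\<lambda>(x, y). blinfun_mult_right (deriv (g x) y))"
      by (simp add: case_prod_unfold continuous_at_imp_continuous_at_within)
  qed (use r in auto)
  moreover have "at (a, b) within ball a r \<times> ball b r = at (a, b)"
    using r by (intro at_within_open open_Times) auto
  moreover have "(\<lambda>(x, y). g x y) = f" by (auto simp: g_def)
  ultimately have "(f has_derivative (\<lambda>(tx, ty). deriv (\<lambda>x. g x b) a * tx + deriv (g a) b * ty)) (at (a, b))"
    by simp
  then show "\<exists>D. (f has_derivative D) (at (a, b)) \<and> (\<forall>c x y. D (c * x, c * y) = c * D (x, y))"
    by (intro exI conjI) (auto simp: algebra_simps)
qed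

lemma holomorphic2_on_add:
  assumes "holomorphic2_on f U" "holomorphic2_on g U"
  shows "holomorphic2_on (\<lambda>z. f z + g z) U"
  unfolding holomorphic2_on_def
proof
  fix z assume "z \<in> U"
  with assms obtain D E where D: "(f has_derivative D) (at z)" "\<forall>c x y. D (c * x, c * y) = c * D (x, y)"
    and E: "(g has_derivative E) (at z)" "\<forall>c x y. E (c * x, c * y) = c * E (x, y)"
    unfolding holomorphic2_on_def by blast
  show "\<exists>D. ((\<lambda>z. f z + g z) has_derivative D) (at z) \<and> (\<forall>c x y. D (c * x, c * y) = c * D (x, y))"
    using has_derivative_add[OF D(1) E(1)] D(2) E(2) by (intro exI conjI) (assumption, simp add: algebra_simps)
qed

lemma holomorphic2_on_mult:
  assumes "holomorphic2_on f U" "holomorphic2_on g U"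
  shows "holomorphic2_on (\<lambda>z. f z * g z) U"
  unfolding holomorphic2_on_def
proof
  fix z assume "z \<in> U"
  with assms obtain D E where D: "(f has_derivative D) (at z)" "\<forall>c x y. D (c * x, c * y) = c * D (x, y)"
    and E: "(g has_derivative E) (at z)" "\<forall>c x y. E (c * x, c * y) = c * E (x, y)"
    unfolding holomorphic2_on_def by blast
  show "\<exists>D. ((\<lambda>z. f z * g z) has_derivative D) (at z) \<and> (\<forall>c x y. D (c * x, c * y) = c * D (x, y))"
    using has_derivative_mult[OF D(1) E(1)] D(2) E(2) by (intro exI conjI) (assumption, simp add: algebra_simps)
qed

lemma holomorphic2_on_subset: "holomorphic2_on f U \<Longrightarrow> V \<subseteq> U \<Longrightarrow> holomorphic2_on f V"
  unfolding holomorphic2_on_def by blast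

lemma holomorphic2_on_const [simp]: "holomorphic2_on (\<lambda>_. c) U"
  unfolding holomorphic2_on_def by (auto intro!: exI[of _ "\<lambda>_. 0"])

lemma holomorphic2_on_imp_continuous_on: "holomorphic2_on f U \<Longrightarrow> continuous_on U f"
  unfolding holomorphic2_on_def
  by (meson continuous_at_imp_continuous_on has_derivative_continuous)

text \<open>The factors of the final formula are functions of one affine combination of s and w,
  such as s + w or s - 3/2, and inherit holomorphy from one variable in this way.\<close>

lemma holomorphic2_on_compose_affine:
  assumes "f holomorphic_on V" "open V" "\<And>s w. (s, w) \<in> U \<Longrightarrow> \<alpha> * s + \<beta> * w + \<gamma> \<in> V"
  shows "holomorphic2_on (\<lambda>(s, w). f (\<alpha> * s + \<beta> * w + \<gamma>)) U"
  unfolding holomorphic2_on_def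
proof safe
  fix s w assume sw: "(s, w) \<in> U"
  let ?l = "\<lambda>z. \<alpha> * fst z + \<beta> * snd z + \<gamma>"
  have "(f has_field_derivative deriv f (\<alpha> * s + \<beta> * w + \<gamma>)) (at (?l (s, w)))"
    using assms sw by (auto intro: holomorphic_derivI)
  then have 1: "(f has_derivative (*) (deriv f (\<alpha> * s + \<beta> * w + \<gamma>))) (at (?l (s, w)))"
    by (simp add: has_field_derivative_def)
  have 2: "(?l has_derivative (\<lambda>h. \<alpha> * fst h + \<beta> * snd h)) (at (s, w))"
    by (auto intro!: derivative_eq_intros)
  have "((\<lambda>z. f (?l z)) has_derivative (\<lambda>h. deriv f (\<alpha> * s + \<beta> * w + \<gamma>) * (\<alpha> * fst h + \<beta> * snd h))) (at (s, w))"
    by (rule has_derivative_compose[OF 2 1])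
  then show "\<exists>D. ((\<lambda>(s, w). f (\<alpha> * s + \<beta> * w + \<gamma>)) has_derivative D) (at (s, w)) \<and>
           (\<forall>c x y. D (c * x, c * y) = c * D (x, y))"
    by (intro exI conjI) (simp add: case_prod_unfold, simp add: algebra_simps)
qed

lemma open_section:
  assumes "open (U :: ('a::topological_space \<times> 'b::topological_space) set)"
  shows "open {s. (s, w) \<in> U}" "open {w. (s, w) \<in> U}"
proof -
  have "open ((\<lambda>s. (s, w)) -` U)" "open ((\<lambda>w. (s, w)) -` U)"
    by (intro open_vimage assms continuous_intros)+
  then show "open {s. (s, w) \<in> U}" "open {w. (s, w) \<in> U}" by (auto simp: vimage_def)
qed

text \<open>Homogeneity of D under complex scalars makes its restriction to each axis a
  multiplication, by \<open>D (1, 0)\<close> or by \<open>D (0, 1)\<close>.\<close>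

lemma holomorphic2_on_imp_holomorphic_on:
  assumes "holomorphic2_on f U"
  shows "(\<lambda>s. f (s, w)) holomorphic_on {s. (s, w) \<in> U}" "(\<lambda>w. f (s, w)) holomorphic_on {w. (s, w) \<in> U}"
proof -
  have "(\<lambda>s. f (s, w)) field_differentiable at s \<and> (\<lambda>w. f (s, w)) field_differentiable at w" if sw: "(s, w) \<in> U" for s w
  proof -
    obtain D where D: "(f has_derivative D) (at (s, w))" and lin: "\<And>c x y. D (c * x, c * y) = c * D (x, y)"
      using assms sw unfolding holomorphic2_on_def by blast
    have "((\<lambda>s. f (s, w)) has_derivative (\<lambda>h. D (h, 0))) (at s)"
      by (rule has_derivative_compose[where g = f and f = "\<lambda>s. (s, w)", OF _ D]) (auto intro!: derivative_eq_intros)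
    moreover have "((\<lambda>w. f (s, w)) has_derivative (\<lambda>h. D (0, h))) (at w)"
      by (rule has_derivative_compose[where g = f and f = "\<lambda>w. (s, w)", OF _ D]) (auto intro!: derivative_eq_intros)
    moreover have "D (h, 0) = D (1, 0) * h" for h
      using lin[of h 1 0] by (metis mult.commute mult_1_right mult_zero_right)
    then have "(\<lambda>h. D (h, 0)) = (*) (D (1, 0))" by (rule ext)
    moreover have "D (0, h) = D (0, 1) * h" for h
      using lin[of h 0 1] by (metis mult.commute mult_1_right mult_zero_right)
    then have "(\<lambda>h. D (0, h)) = (*) (D (0, 1))" by (rule ext)
    ultimately show ?thesis unfolding field_differentiable_def has_field_derivative_def by metis
  qed
  then show "(\<lambda>s. f (s, w)) holomorphic_on {s. (s, w) \<in> U}" "(\<lambda>w. f (s, w)) holomorphic_on {w. (s, w) \<in> U}"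
    unfolding holomorphic_on_def by (auto intro: field_differentiable_at_within)
qed

lemma holomorphic2_on_infsum:
  assumes U: "open U" and hol: "\<And>i. i \<in> I \<Longrightarrow> holomorphic2_on (f i) U"
    and bound: "\<And>z0. z0 \<in> U \<Longrightarrow> \<exists>V M. open V \<and> z0 \<in> V \<and> M summable_on I \<and> (\<forall>i\<in>I. \<forall>z\<in>V. norm (f i z) \<le> M i)"
  shows "holomorphic2_on (\<lambda>z. \<Sum>\<^sub>\<infinity>i\<in>I. f i z) U"
proof (rule holomorphic2_onI_separately[OF U])
  show "continuous_on U (\<lambda>z. \<Sum>\<^sub>\<infinity>i\<in>I. f i z)"
    by (rule continuous_on_infsum[OF _ U bound]) (auto intro: holomorphic2_on_imp_continuous_on hol)
  show "(\<lambda>s. \<Sum>\<^sub>\<infinity>i\<in>I. f i (s, w)) holomorphic_on {s. (s, w) \<in> U}" for w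
  proof (rule holomorphic_on_infsum[OF open_section(1)[OF U] holomorphic2_on_imp_holomorphic_on(1)[OF hol]])
    fix s assume "s \<in> {s. (s, w) \<in> U}"
    then obtain V M where "open V" "(s, w) \<in> V" "M summable_on I" "\<forall>i\<in>I. \<forall>z\<in>V. norm (f i z) \<le> M i"
      using bound[of "(s, w)"] by blast
    then show "\<exists>V M. open V \<and> s \<in> V \<and> M summable_on I \<and> (\<forall>i\<in>I. \<forall>z\<in>V. norm (f i (z, w)) \<le> M i)"
      by (intro exI[of _ "{s. (s, w) \<in> V}"] exI[of _ M]) (auto intro: open_section)
  qed
  show "(\<lambda>w. \<Sum>\<^sub>\<infinity>i\<in>I. f i (s, w)) holomorphic_on {w. (s, w) \<in> U}" for s
  proof (rule holomorphic_on_infsum[OF open_section(2)[OF U] holomorphic2_on_imp_holomorphic_on(2)[OF hol]])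
    fix w assume "w \<in> {w. (s, w) \<in> U}"
    then obtain V M where "open V" "(s, w) \<in> V" "M summable_on I" "\<forall>i\<in>I. \<forall>z\<in>V. norm (f i z) \<le> M i"
      using bound[of "(s, w)"] by blast
    then show "\<exists>V M. open V \<and> w \<in> V \<and> M summable_on I \<and> (\<forall>i\<in>I. \<forall>z\<in>V. norm (f i (s, z)) \<le> M i)"
      by (intro exI[of _ "{w. (s, w) \<in> V}"] exI[of _ M]) (auto intro: open_section)
  qed
qed

section \<open>Meromorphic functions of two variables\<close>

lemma meromorphic2_onE:
  assumes "meromorphic2_on F U" "z \<in> U"
  obtains V g h where "open V" "z \<in> V" "holomorphic2_on g V" "holomorphic2_on h V"
    "\<forall>W. open W \<and> W \<noteq> {} \<and> W \<subseteq> V \<longrightarrow> (\<exists>y\<in>W. h y \<noteq> 0)" "\<forall>y\<in>V. h y \<noteq> 0 \<longrightarrow> F y = g y / h y"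
  using bspec[OF assms(1)[unfolded meromorphic2_on_def] assms(2)] by (elim exE conjE) (rule that)

text \<open>The part of W where \<open>h1\<close> is nonzero is open and nonempty, so
  \<open>h2\<close> is nonzero somewhere in it. This makes products of denominators admissible
  denominators.\<close>

lemma ex_prod_nonzero:
  assumes h1: "holomorphic2_on h1 V1" "\<forall>W. open W \<and> W \<noteq> {} \<and> W \<subseteq> V1 \<longrightarrow> (\<exists>y\<in>W. h1 y \<noteq> 0)"
    and h2: "\<forall>W. open W \<and> W \<noteq> {} \<and> W \<subseteq> V2 \<longrightarrow> (\<exists>y\<in>W. h2 y \<noteq> 0)"
    and W: "open W" "W \<noteq> {}" "W \<subseteq> V1 \<inter> V2"
  shows "\<exists>y\<in>W. h1 y * h2 y \<noteq> 0"
proof -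
  have c: "continuous_on W h1"
    by (rule continuous_on_subset[OF holomorphic2_on_imp_continuous_on[OF h1(1)]]) (use W in auto)
  have "open (W \<inter> h1 -` (- {0}))" by (rule continuous_open_preimage[OF c W(1)]) (simp add: open_Compl)
  moreover have "W \<inter> h1 -` (- {0}) \<noteq> {}" using h1(2)[rule_format, of W] W by auto
  ultimately show ?thesis using h2[rule_format, of "W \<inter> h1 -` (- {0})"] W by auto
qed

lemma meromorphic2_on_mult:
  assumes "meromorphic2_on f U" "meromorphic2_on g U"
  shows "meromorphic2_on (\<lambda>z. f z * g z) U"
  unfolding meromorphic2_on_def
proof
  fix z assume z: "z \<in> U"
  obtain V1 g1 h1 where 1: "open V1" "z \<in> V1" "holomorphic2_on g1 V1" "holomorphic2_on h1 V1"
      "\<forall>W. open W \<and> W \<noteq> {} \<and> W \<subseteq> V1 \<longrightarrow> (\<exists>y\<in>W. h1 y \<noteq> 0)" "\<forall>y\<in>V1. h1 y \<noteq> 0 \<longrightarrow> f y = g1 y / h1 y"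
    by (rule meromorphic2_onE[OF assms(1) z])
  obtain V2 g2 h2 where 2: "open V2" "z \<in> V2" "holomorphic2_on g2 V2" "holomorphic2_on h2 V2"
      "\<forall>W. open W \<and> W \<noteq> {} \<and> W \<subseteq> V2 \<longrightarrow> (\<exists>y\<in>W. h2 y \<noteq> 0)" "\<forall>y\<in>V2. h2 y \<noteq> 0 \<longrightarrow> g y = g2 y / h2 y"
    by (rule meromorphic2_onE[OF assms(2) z])
  have dense: "\<exists>y\<in>W. h1 y * h2 y \<noteq> 0" if "open W" "W \<noteq> {}" "W \<subseteq> V1 \<inter> V2" for W
    by (rule ex_prod_nonzero[OF 1(4,5) 2(5) that])
  have "holomorphic2_on (\<lambda>y. g1 y * g2 y) (V1 \<inter> V2)" "holomorphic2_on (\<lambda>y. h1 y * h2 y) (V1 \<inter> V2)"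
    by (intro holomorphic2_on_mult holomorphic2_on_add holomorphic2_on_subset[OF 1(3)]
      holomorphic2_on_subset[OF 1(4)] holomorphic2_on_subset[OF 2(3)] holomorphic2_on_subset[OF 2(4)]; blast)+
  moreover have "f y * g y = (g1 y * g2 y) / (h1 y * h2 y)" if "y \<in> V1 \<inter> V2" "h1 y * h2 y \<noteq> 0" for y
    using 1(6)[rule_format, of y] 2(6)[rule_format, of y] that by (simp add: add_frac_eq)
  ultimately show "\<exists>V g' h. open V \<and> z \<in> V \<and> holomorphic2_on g' V \<and> holomorphic2_on h V \<and>
     (\<forall>W. open W \<and> W \<noteq> {} \<and> W \<subseteq> V \<longrightarrow> (\<exists>y\<in>W. h y \<noteq> 0)) \<and> (\<forall>y\<in>V. h y \<noteq> 0 \<longrightarrow> f y * g y = g' y / h y)"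
    using 1(1,2) 2(1,2) dense
    by (intro exI[of _ "V1 \<inter> V2"] exI[of _ "\<lambda>y. g1 y * g2 y"] exI[of _ "\<lambda>y. h1 y * h2 y"]) (simp add: open_Int)
qed

lemma meromorphic2_on_add:
  assumes "meromorphic2_on f U" "meromorphic2_on g U"
  shows "meromorphic2_on (\<lambda>z. f z + g z) U"
  unfolding meromorphic2_on_def
proof
  fix z assume z: "z \<in> U"
  obtain V1 g1 h1 where 1: "open V1" "z \<in> V1" "holomorphic2_on g1 V1" "holomorphic2_on h1 V1"
      "\<forall>W. open W \<and> W \<noteq> {} \<and> W \<subseteq> V1 \<longrightarrow> (\<exists>y\<in>W. h1 y \<noteq> 0)" "\<forall>y\<in>V1. h1 y \<noteq> 0 \<longrightarrow> f y = g1 y / h1 y"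
    by (rule meromorphic2_onE[OF assms(1) z])
  obtain V2 g2 h2 where 2: "open V2" "z \<in> V2" "holomorphic2_on g2 V2" "holomorphic2_on h2 V2"
      "\<forall>W. open W \<and> W \<noteq> {} \<and> W \<subseteq> V2 \<longrightarrow> (\<exists>y\<in>W. h2 y \<noteq> 0)" "\<forall>y\<in>V2. h2 y \<noteq> 0 \<longrightarrow> g y = g2 y / h2 y"
    by (rule meromorphic2_onE[OF assms(2) z])
  have dense: "\<exists>y\<in>W. h1 y * h2 y \<noteq> 0" if "open W" "W \<noteq> {}" "W \<subseteq> V1 \<inter> V2" for W
    by (rule ex_prod_nonzero[OF 1(4,5) 2(5) that])
  have "holomorphic2_on (\<lambda>y. g1 y * h2 y + g2 y * h1 y) (V1 \<inter> V2)" "holomorphic2_on (\<lambda>y. h1 y * h2 y) (V1 \<inter> V2)"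
    by (intro holomorphic2_on_mult holomorphic2_on_add holomorphic2_on_subset[OF 1(3)]
      holomorphic2_on_subset[OF 1(4)] holomorphic2_on_subset[OF 2(3)] holomorphic2_on_subset[OF 2(4)]; blast)+
  moreover have "f y + g y = (g1 y * h2 y + g2 y * h1 y) / (h1 y * h2 y)" if "y \<in> V1 \<inter> V2" "h1 y * h2 y \<noteq> 0" for y
    using 1(6)[rule_format, of y] 2(6)[rule_format, of y] that by (simp add: add_frac_eq)
  ultimately show "\<exists>V g' h. open V \<and> z \<in> V \<and> holomorphic2_on g' V \<and> holomorphic2_on h V \<and>
     (\<forall>W. open W \<and> W \<noteq> {} \<and> W \<subseteq> V \<longrightarrow> (\<exists>y\<in>W. h y \<noteq> 0)) \<and> (\<forall>y\<in>V. h y \<noteq> 0 \<longrightarrow> f y + g y = g' y / h y)"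
    using 1(1,2) 2(1,2) dense
    by (intro exI[of _ "V1 \<inter> V2"] exI[of _ "\<lambda>y. g1 y * h2 y + g2 y * h1 y"] exI[of _ "\<lambda>y. h1 y * h2 y"]) (simp add: open_Int)
qed

lemma holomorphic2_on_imp_meromorphic2_on:
  assumes "holomorphic2_on f U" "open U"
  shows "meromorphic2_on f U"
  unfolding meromorphic2_on_def
  by (intro ballI exI[of _ U] exI[of _ f] exI[of _ "\<lambda>_. 1"]) (use assms in auto)

text \<open>Near z0 the Laurent expansion is a power series times an integer power of z - z0; the
  positive part of the exponent goes into the numerator, the negative part into the
  denominator.\<close>

lemma meromorphic_at_imp_quotient:
  assumes "f meromorphic_on {z0}"
  obtains r g h where "r > 0" "g holomorphic_on ball z0 r" "h holomorphic_on ball z0 r"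
    "\<And>z. h z = 0 \<longleftrightarrow> z = z0" "\<And>z. z \<in> ball z0 r - {z0} \<Longrightarrow> f z = g z / h z"
proof -
  obtain F where F: "(\<lambda>w. f (z0 + w)) has_laurent_expansion F"
    using assms unfolding meromorphic_on_def by auto
  define G where "G = fls_base_factor_to_fps F"
  define n where "n = fls_subdegree F"
  have "fls_conv_radius F > 0" and ev: "\<forall>\<^sub>F w in at 0. eval_fls F w = f (z0 + w)"
    using F by (auto simp: has_laurent_expansion_def)
  then have R: "fps_conv_radius G > 0" by (simp add: fls_conv_radius_altdef G_def)
  obtain d where d: "d > 0" "\<And>w. w \<noteq> 0 \<Longrightarrow> norm w < d \<Longrightarrow> eval_fls F w = f (z0 + w)"
    using ev unfolding eventually_at by auto
  obtain r' where r': "r' > 0" "ereal r' < fps_conv_radius G"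
    using ereal_dense2[OF R] by auto
  define r where "r = min d r'"
  have er: "ereal (norm (z - z0)) < fps_conv_radius G" if "z \<in> ball z0 r" for z
  proof -
    have "ereal (norm (z - z0)) < ereal r'" using that by (auto simp: r_def dist_norm norm_minus_commute)
    then show ?thesis using r'(2) by order
  qed
  show ?thesis
  proof (rule that)
    show "r > 0" using d r' by (simp add: r_def)
    have "(eval_fps G \<circ> (\<lambda>z. z - z0)) holomorphic_on ball z0 r"
      by (rule holomorphic_on_compose_gen[where t = "eball 0 (fps_conv_radius G)"])
         (auto intro!: holomorphic_intros simp: in_eball_iff er)
    then show "(\<lambda>z. eval_fps G (z - z0) * (z - z0) ^ (nat n + 1)) holomorphic_on ball z0 r"
      by (intro holomorphic_intros) (simp add: o_def)
    \<comment> \<open>The surplus factor z - z0 in numerator and denominator makes the denominator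
      vanish at z0 even if f has no pole there: meromorphy says nothing about the value of f at z0,
      so that point has to be excluded.\<close>
    show "(\<lambda>z. (z - z0) ^ (nat (- n) + 1)) holomorphic_on ball z0 r"
      by (intro holomorphic_intros)
    fix z
    show "(z - z0) ^ (nat (- n) + 1) = 0 \<longleftrightarrow> z = z0" by auto
    assume z: "z \<in> ball z0 r - {z0}"
    have "f z = eval_fls F (z - z0)"
      using d(2)[of "z - z0"] z by (auto simp: r_def dist_norm norm_minus_commute)
    also have "\<dots> = eval_fps G (z - z0) * (z - z0) powi n"
      by (simp add: eval_fls_def G_def n_def)
    also have "(z - z0) powi n = (z - z0) ^ (nat n + 1) / (z - z0) ^ (nat (- n) + 1)"
      using z by (cases "n \<ge> 0") (auto simp: power_int_def divide_simps)
    finally show "f z = eval_fps G (z - z0) * (z - z0) ^ (nat n + 1) / (z - z0) ^ (nat (- n) + 1)"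
      by simp
  qed
qed

text \<open>The composed denominator vanishes exactly where the affine form equals z0. As \<alpha>
  is nonzero, the form changes along the first coordinate, so no nonempty open set lies in this zero
  set.\<close>

lemma meromorphic2_on_compose_affine:
  assumes f: "f meromorphic_on UNIV" and \<alpha>: "\<alpha> \<noteq> 0"
  shows "meromorphic2_on (\<lambda>(s, w). f (\<alpha> * s + \<beta> * w + \<gamma>)) U"
  unfolding meromorphic2_on_def
proof safe
  fix s0 w0 assume "(s0, w0) \<in> U"
  define l where "l = (\<lambda>(s, w). \<alpha> * s + \<beta> * w + \<gamma>)"
  define z0 where "z0 = l (s0, w0)"
  obtain r g h where gh: "r > 0" "g holomorphic_on ball z0 r" "h holomorphic_on ball z0 r"
    "\<And>z. h z = 0 \<longleftrightarrow> z = z0" "\<And>z. z \<in> ball z0 r - {z0} \<Longrightarrow> f z = g z / h z"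
    using meromorphic_at_imp_quotient[of f z0] f by (metis meromorphic_on_subset top_greatest)
  have lc: "continuous_on UNIV l" unfolding l_def case_prod_unfold by (intro continuous_intros)
  show "\<exists>V g h. open V \<and> (s0, w0) \<in> V \<and> holomorphic2_on g V \<and> holomorphic2_on h V \<and>
        (\<forall>W. open W \<and> W \<noteq> {} \<and> W \<subseteq> V \<longrightarrow> (\<exists>y\<in>W. h y \<noteq> 0)) \<and>
        (\<forall>y\<in>V. h y \<noteq> 0 \<longrightarrow> (case y of (s, w) \<Rightarrow> f (\<alpha> * s + \<beta> * w + \<gamma>)) = g y / h y)"
  proof (rule exI[of _ "l -` ball z0 r"], rule exI[of _ "\<lambda>(s, w). g (\<alpha> * s + \<beta> * w + \<gamma>)"],
      rule exI[of _ "\<lambda>(s, w). h (\<alpha> * s + \<beta> * w + \<gamma>)"], intro conjI allI impI ballI)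
    show "open (l -` ball z0 r)" using lc by (intro open_vimage) auto
    show "(s0, w0) \<in> l -` ball z0 r" using gh by (simp add: z0_def)
    show "holomorphic2_on (\<lambda>(s, w). g (\<alpha> * s + \<beta> * w + \<gamma>)) (l -` ball z0 r)"
      by (rule holomorphic2_on_compose_affine[OF gh(2)]) (auto simp: l_def)
    show "holomorphic2_on (\<lambda>(s, w). h (\<alpha> * s + \<beta> * w + \<gamma>)) (l -` ball z0 r)"
      by (rule holomorphic2_on_compose_affine[OF gh(3)]) (auto simp: l_def)
  next
    fix W assume W: "open W \<and> W \<noteq> {} \<and> W \<subseteq> l -` ball z0 r"
    then obtain s w where sw: "(s, w) \<in> W" by fastforce
    obtain A B where AB: "open A" "open B" "(s, w) \<in> A \<times> B" "A \<times> B \<subseteq> W"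
      using open_prod_elim[OF conjunct1[OF W] sw] by metis
    obtain s' where s': "s' \<in> A" "s' \<noteq> s"
      using AB(1,3) not_open_singleton[of s] by (metis mem_Sigma_iff insertI1 singletonD subsetI subset_antisym empty_subsetI insert_subset)
    have "(s', w) \<in> W" using AB s' by auto
    have "l (s, w) \<noteq> l (s', w)" using \<alpha> s' by (simp add: l_def)
    then have "l (s, w) \<noteq> z0 \<or> l (s', w) \<noteq> z0" by metis
    then show "\<exists>y\<in>W. (case y of (s, w) \<Rightarrow> h (\<alpha> * s + \<beta> * w + \<gamma>)) \<noteq> 0"
    proof
      assume "l (s, w) \<noteq> z0"
      then show ?thesis using gh(4) sw by (intro bexI[of _ "(s, w)"]) (auto simp: l_def)
    next
      assume "l (s', w) \<noteq> z0"
      then show ?thesis using gh(4) \<open>(s', w) \<in> W\<close> by (intro bexI[of _ "(s', w)"]) (auto simp: l_def)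
    qed
  next
    fix y assume y: "y \<in> l -` ball z0 r" "(case y of (s, w) \<Rightarrow> h (\<alpha> * s + \<beta> * w + \<gamma>)) \<noteq> 0"
    obtain s w where sw: "y = (s, w)" by (cases y)
    have "l (s, w) \<in> ball z0 r" "l (s, w) \<noteq> z0"
      using y gh(4)[of "l (s, w)"] unfolding sw by (simp_all add: l_def)
    then have "f (l (s, w)) = g (l (s, w)) / h (l (s, w))" by (intro gh(5)) blast
    then show "(case y of (s, w) \<Rightarrow> f (\<alpha> * s + \<beta> * w + \<gamma>)) =
         (case y of (s, w) \<Rightarrow> g (\<alpha> * s + \<beta> * w + \<gamma>)) / (case y of (s, w) \<Rightarrow> h (\<alpha> * s + \<beta> * w + \<gamma>))"
      unfolding sw l_def by (simp only: prod.case)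
  qed
qed

text \<open>The difference of F and G either vanishes or is nonzero off a sparse set, and U rules
  out the latter. Nice meromorphy determines the remaining values: the limit where it exists, 0 at a
  pole. This is the uniqueness behind the \<open>THE\<close> in \<open>mero_cont\<close>.\<close>

lemma nicely_meromorphic_unique:
  assumes F: "F nicely_meromorphic_on UNIV" and G: "G nicely_meromorphic_on UNIV"
    and U: "open U" "U \<noteq> {}" and eq: "\<And>s. s \<in> U \<Longrightarrow> F s = G s"
  shows "F = G"
proof
  fix z
  have mF: "F meromorphic_on UNIV" and mG: "G meromorphic_on UNIV"
    using F G by (auto simp: nicely_meromorphic_on_def)
  then have m: "(\<lambda>s. F s - G s) meromorphic_on UNIV" by (intro meromorphic_intros)
  obtain u where u: "u \<in> U" using U by auto
  have evu: "eventually (\<lambda>s. F s - G s = 0) (at u)"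
    unfolding eventually_at_topological using eq u U by (intro exI[of _ U]) auto
  have "\<not> eventually (\<lambda>s. F s - G s \<noteq> 0) (at u)"
  proof (rule notI)
    assume "eventually (\<lambda>s. F s - G s \<noteq> 0) (at u)"
    with evu have "eventually (\<lambda>s. False) (at u)" by eventually_elim auto
    then show False by simp
  qed
  then have "\<not> eventually (\<lambda>s. F s - G s \<noteq> 0) (cosparse UNIV)"
    by (auto simp: eventually_cosparse_open_eq)
  then have "eventually (\<lambda>s. F s - G s = 0) (cosparse UNIV)"
    using meromorphic_imp_constant_or_avoid[OF m open_UNIV connected_UNIV, of 0] by metis
  then have "eventually (\<lambda>s. F s - G s = 0) (at z)"
    by (auto simp: eventually_cosparse_open_eq)
  then have ev: "eventually (\<lambda>s. F s = G s) (at z)" by simp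
  have pole: "is_pole F z \<longleftrightarrow> is_pole G z" by (rule is_pole_cong[OF ev refl])
  have FG: "(is_pole F z \<and> F z = 0) \<or> F \<midarrow>z\<rightarrow> F z" "(is_pole G z \<and> G z = 0) \<or> G \<midarrow>z\<rightarrow> G z"
    using F G by (auto simp: nicely_meromorphic_on_def)
  show "F z = G z"
  proof (cases "is_pole F z")
    case True
    then have "\<not> F \<midarrow>z\<rightarrow> F z" "\<not> G \<midarrow>z\<rightarrow> G z"
      using pole not_tendsto_and_filterlim_at_infinity[of "at z"] by (auto simp: is_pole_def)
    then show ?thesis using FG by auto
  next
    case False
    then have 1: "F \<midarrow>z\<rightarrow> F z" and 2: "G \<midarrow>z\<rightarrow> G z" using FG pole by auto
    have "G \<midarrow>z\<rightarrow> F z" using 1 tendsto_cong[OF ev] by simp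
    then show ?thesis using 2 by (rule LIM_unique)
  qed
qed

text \<open>The candidate F is compared with f on a possibly smaller open set V, because a formula
  for F may so far be established only there; connectedness of U spreads the equality. The
  continuation itself is \<open>remove_sings F\<close>.\<close>

lemma mero_cont_eqI:
  assumes F: "F meromorphic_on UNIV" and f: "f holomorphic_on U" and U: "open U" "connected U"
    and V: "open V" "V \<noteq> {}" "V \<subseteq> U" and eq: "\<And>s. s \<in> V \<Longrightarrow> F s = f s"
  shows "mero_cont U f nicely_meromorphic_on UNIV" "\<And>s. s \<in> U \<Longrightarrow> mero_cont U f s = f s"
proof -
  define G where "G = remove_sings F"
  have mG: "G nicely_meromorphic_on UNIV"
    unfolding G_def using F by (rule remove_sings_nicely_meromorphic)
  have m: "(\<lambda>s. F s - f s) meromorphic_on U"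
    using f U by (intro meromorphic_intros meromorphic_on_subset[OF F] analytic_on_imp_meromorphic_on)
      (auto simp: analytic_on_open)
  obtain u where u: "u \<in> V" using V by auto
  have evu: "eventually (\<lambda>s. F s - f s = 0) (at u)"
    unfolding eventually_at_topological using eq u V by (intro exI[of _ V]) auto
  have "\<not> eventually (\<lambda>s. F s - f s \<noteq> 0) (at u)"
  proof (rule notI)
    assume "eventually (\<lambda>s. F s - f s \<noteq> 0) (at u)"
    with evu have "eventually (\<lambda>s. False) (at u)" by eventually_elim auto
    then show False by simp
  qed
  then have "\<not> eventually (\<lambda>s. F s - f s \<noteq> 0) (cosparse U)"
    using u V U by (auto simp: eventually_cosparse_open_eq)
  then have ev: "eventually (\<lambda>s. F s - f s = 0) (cosparse U)"
    using meromorphic_imp_constant_or_avoid[OF m U, of 0] by metis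
  have Gf: "G s = f s" if s: "s \<in> U" for s
  proof -
    have "eventually (\<lambda>s. F s = f s) (at s)"
      using ev s U by (auto simp: eventually_cosparse_open_eq)
    moreover have "f \<midarrow>s\<rightarrow> f s"
      using holomorphic_on_imp_continuous_on[OF f] U s by (metis continuous_on_eq_continuous_at isCont_def)
    ultimately have "F \<midarrow>s\<rightarrow> f s" using tendsto_cong by fastforce
    then show ?thesis unfolding G_def by (rule remove_sings_eqI)
  qed
  have "mero_cont U f = G"
    unfolding mero_cont_def using U u V mG Gf
    by (intro the_equality conjI ballI) (simp_all, metis nicely_meromorphic_unique ex_in_conv subsetD)
  then show "mero_cont U f nicely_meromorphic_on UNIV" "\<And>s. s \<in> U \<Longrightarrow> mero_cont U f s = f s"
    using mG Gf by simp_all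
qed

section \<open>Analytic continuation by alternating sums\<close>

lemma dirichlet_summable:
  fixes a :: "'i \<Rightarrow> real"
  assumes "\<And>i. i \<in> I \<Longrightarrow> a i > 0" "(\<lambda>i. a i powr (- Re s)) summable_on I"
  shows "(\<lambda>i. norm (of_real (a i) powr (- s) :: complex)) summable_on I"
proof -
  have "(\<lambda>i. norm (of_real (a i) powr (- s) :: complex)) summable_on I \<longleftrightarrow> (\<lambda>i. a i powr (- Re s)) summable_on I"
    by (rule summable_on_cong) (use assms(1) in \<open>simp add: norm_powr_real_powr less_imp_le\<close>)
  then show ?thesis using assms by simp
qed

lemma dirichlet_holomorphic:
  fixes a :: "'i \<Rightarrow> real"
  assumes a: "\<And>i. i \<in> I \<Longrightarrow> a i \<ge> 1"
    and sm: "\<And>\<sigma>. \<sigma> > \<sigma>0 \<Longrightarrow> (\<lambda>i. a i powr (- \<sigma>)) summable_on I"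
  shows "(\<lambda>s. \<Sum>\<^sub>\<infinity>i\<in>I. of_real (a i) powr (- s) :: complex) holomorphic_on {s. Re s > \<sigma>0}"
proof (rule holomorphic_on_infsum)
  show "open {s. Re s > \<sigma>0}" by (rule open_halfspace_Re_gt)
  show "(\<lambda>s. of_real (a i) powr (- s)) holomorphic_on {s. Re s > \<sigma>0}" for i
    by (intro holomorphic_intros)
  fix z assume "z \<in> {s. Re s > \<sigma>0}"
  then obtain \<sigma> where \<sigma>: "\<sigma>0 < \<sigma>" "\<sigma> < Re z" using dense by auto
  show "\<exists>V M. open V \<and> z \<in> V \<and> M summable_on I \<and> (\<forall>i\<in>I. \<forall>z\<in>V. cmod (of_real (a i) powr - z) \<le> M i)"
  proof (intro exI conjI ballI)
    show "open {s. Re s > \<sigma>}" by (rule open_halfspace_Re_gt)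
    show "(\<lambda>i. a i powr (- \<sigma>)) summable_on I" using sm \<sigma> by simp
    show "cmod (of_real (a i) powr - z) \<le> a i powr (- \<sigma>)" if "i \<in> I" "z \<in> {s. Re s > \<sigma>}" for i z
      using a[OF that(1)] that by (subst norm_powr_real_powr) (auto intro!: powr_mono)
  qed (use \<sigma> in auto)
qed

lemma summable_on_int_square:
  fixes a :: real
  assumes "a > 1 / 2"
  shows "(\<lambda>x::int. (of_int x ^ 2 + 1) powr (- a)) summable_on UNIV"
proof -
  let ?f = "\<lambda>x::int. (of_int x ^ 2 + 1) powr (- a) :: real"
  have "summable (\<lambda>n. real n powr (- 2 * a))" using assms by (subst summable_real_powr_iff) auto
  then have "summable (\<lambda>n. ?f (int n))"
  proof (rule summable_comparison_test_ev[rotated])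
    show "\<forall>\<^sub>F n in sequentially. norm (?f (int n)) \<le> real n powr (- 2 * a)"
      using eventually_gt_at_top[of 0]
    proof eventually_elim
      case (elim n)
      have "real n powr (- 2 * a) = (real n ^ 2) powr (- a)"
        using powr_powr[of "real n" 2 "- a"] elim by simp
      moreover have "(real n ^ 2 + 1) powr (- a) \<le> (real n ^ 2) powr (- a)"
        using elim assms by (intro powr_mono2') auto
      ultimately show ?case by simp
    qed
  qed
  then have 1: "(\<lambda>n. ?f (int n)) summable_on UNIV"
    by (intro summable_nonneg_imp_summable_on) auto
  have r1: "?f summable_on range int"
    by (subst summable_on_reindex) (use 1 in \<open>auto simp: o_def\<close>)
  have r2: "?f summable_on range (\<lambda>n. - int n)"
    by (subst summable_on_reindex) (use 1 in \<open>auto simp: o_def inj_on_def\<close>)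
  have "x \<in> range int \<union> range (\<lambda>n. - int n)" for x :: int
    by (cases x rule: int_cases2) auto
  then have "UNIV = range int \<union> range (\<lambda>n. - int n)" by blast
  then show ?thesis using summable_on_union[OF r1 r2] by metis
qed

lemma summable_on_product:
  fixes f :: "'a \<Rightarrow> real" and g :: "'b \<Rightarrow> real"
  assumes "f summable_on A" "g summable_on B" "\<And>x. f x \<ge> 0" "\<And>y. g y \<ge> 0"
  shows "(\<lambda>(x, y). f x * g y) summable_on A \<times> B"
proof (rule summable_on_SigmaI)
  show "((\<lambda>y. case (x, y) of (x, y) \<Rightarrow> f x * g y) has_sum f x * infsum g B) B" for x
    using assms(2) by (simp add: has_sum_cmult_right)
  show "(\<lambda>x. f x * infsum g B) summable_on A"
    using assms(1) by (rule summable_on_cmult_left)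
qed (use assms in auto)

text \<open>The inequality (A + 1) (B + 1) \<le> (A + B + 1)^2 dominates the sum by a product of two
  one-dimensional sums with exponent a / 2 > 1/2.\<close>

lemma summable_on_lattice:
  fixes a :: real
  assumes "a > 1"
  shows "(\<lambda>(x, y). (of_int x ^ 2 + of_int y ^ 2 + 1) powr (- a)) summable_on (UNIV :: (int \<times> int) set)"
proof -
  let ?g = "\<lambda>x::int. (of_int x ^ 2 + 1) powr (- (a / 2)) :: real"
  have g: "?g summable_on UNIV" using assms by (intro summable_on_int_square) auto
  have "(\<lambda>(x, y). ?g x * ?g y) summable_on UNIV \<times> UNIV"
    by (rule summable_on_product[OF g g]) auto
  then have prod: "(\<lambda>(x, y). ?g x * ?g y) summable_on UNIV" by simp
  have le: "(of_int x ^ 2 + of_int y ^ 2 + 1) powr (- a) \<le> ?g x * ?g y" for x y :: int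
  proof -
    have "(of_int x ^ 2 + of_int y ^ 2 + 1) powr (- a) = ((of_int x ^ 2 + of_int y ^ 2 + 1 :: real) ^ 2) powr (- (a / 2))"
      using powr_powr[of "of_int x ^ 2 + of_int y ^ 2 + 1 :: real" 2 "- (a / 2)"] by simp
    also have "\<dots> \<le> ((of_int x ^ 2 + 1) * (of_int y ^ 2 + 1)) powr (- (a / 2))"
    proof (rule powr_mono2')
      show "(of_int x ^ 2 + 1) * (of_int y ^ 2 + 1) \<le> (of_int x ^ 2 + of_int y ^ 2 + 1 :: real) ^ 2"
      proof -
        have "(A + 1) * (B + 1) \<le> (A + B + 1) ^ 2" if "A \<ge> 0" "B \<ge> 0" for A B :: real
        proof -
          have "(A + B + 1) ^ 2 = (A + 1) * (B + 1) + (A * A + B * B + A * B + A + B)"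
            by (simp add: power2_eq_square algebra_simps)
          then show ?thesis using that by simp
        qed
        then show ?thesis by simp
      qed
      show "0 < (of_int x ^ 2 + 1) * (of_int y ^ 2 + 1 :: real)" by (intro mult_pos_pos add_nonneg_pos) auto
    qed (use assms in auto)
    also have "\<dots> = ?g x * ?g y" by (simp add: powr_mult)
    finally show ?thesis .
  qed
  show ?thesis
    by (rule summable_on_comparison_test[OF prod]) (use le in auto)
qed

section \<open>Iterated differences of powers of the quadratic form\<close>

definition fdiff :: "(complex \<Rightarrow> complex) \<Rightarrow> complex \<Rightarrow> complex" where
  "fdiff g z = g z - g (z + 1)"

lemma fdiff_power_Suc: "(fdiff ^^ Suc N) g z = (fdiff ^^ N) g z - (fdiff ^^ N) g (z + 1)"
  by (simp add: fdiff_def[of "(fdiff ^^ N) g"])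

text \<open>One difference is bounded by the derivative along a unit step, and the derivative by
  Cauchy's inequality on discs of radius \<delta>. Each step gains a factor 1 / \<delta> and uses up
  1 + \<delta> of the radius. With \<delta> proportional to the radius, N differences therefore save
  N powers of it.\<close>

lemma norm_fdiff_power_le:
  assumes "g holomorphic_on ball z0 \<rho>" "\<And>z. z \<in> ball z0 \<rho> \<Longrightarrow> norm (g z) \<le> M" "\<delta> > 0" "real N * (1 + \<delta>) < \<rho>"
  shows "norm ((fdiff ^^ N) g z0) \<le> M / \<delta> ^ N"
  using assms(1,2,4)
proof (induction N arbitrary: g M \<rho>)
  case 0
  then show ?case by simp
next
  case (Suc N)
  have "norm ((fdiff ^^ N) (fdiff g) z0) \<le> (M / \<delta>) / \<delta> ^ N"
  proof (rule Suc.IH)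
    let ?\<rho> = "\<rho> - (1 + \<delta>)"
    have in1: "z + t \<in> ball z0 (\<rho> - \<delta>)" if "z \<in> ball z0 ?\<rho>" "norm t \<le> 1" for z t
    proof -
      have "dist z0 (z + t) \<le> dist z0 z + norm t" by (metis add_diff_cancel_left' dist_norm dist_triangle2 dist_commute)
      then show ?thesis using that by auto
    qed
    have sub: "cball w \<delta> \<subseteq> ball z0 \<rho>" if "w \<in> ball z0 (\<rho> - \<delta>)" for w
    proof
      fix v assume "v \<in> cball w \<delta>"
      then show "v \<in> ball z0 \<rho>" using that dist_triangle[of z0 v w] by auto
    qed
    show "fdiff g holomorphic_on ball z0 ?\<rho>"
      unfolding fdiff_def
    proof (rule holomorphic_on_diff)
      show "g holomorphic_on ball z0 ?\<rho>"
        by (rule holomorphic_on_subset[OF Suc.prems(1)]) (use assms(3) in auto)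
      have "(g \<circ> (\<lambda>z. z + 1)) holomorphic_on ball z0 ?\<rho>"
      proof (rule holomorphic_on_compose_gen[OF _ Suc.prems(1)])
        show "(\<lambda>z. z + 1) ` ball z0 ?\<rho> \<subseteq> ball z0 \<rho>" using in1[of _ 1] assms(3) by force
      qed (intro holomorphic_intros)
      then show "(\<lambda>z. g (z + 1)) holomorphic_on ball z0 ?\<rho>" by (simp add: o_def)
    qed
    show "norm (fdiff g z) \<le> M / \<delta>" if z: "z \<in> ball z0 ?\<rho>" for z
    proof -
      have "norm (g z - g (z + 1)) \<le> M / \<delta> * norm (z - (z + 1))"
      proof (rule field_differentiable_bound)
        show "convex (ball z0 (\<rho> - \<delta>))" by (rule convex_ball)
        show "(g has_field_derivative deriv g w) (at w within ball z0 (\<rho> - \<delta>))" if "w \<in> ball z0 (\<rho> - \<delta>)" for w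
        proof -
          have "w \<in> cball w \<delta>" using assms(3) by simp
          then have "w \<in> ball z0 \<rho>" using sub[OF that] by blast
          then show ?thesis
            by (rule has_field_derivative_at_within[OF holomorphic_derivI[OF Suc.prems(1) open_ball]])
        qed
        show "norm (deriv g w) \<le> M / \<delta>" if "w \<in> ball z0 (\<rho> - \<delta>)" for w
          by (rule norm_deriv_le[OF Suc.prems(1) open_ball sub[OF that] assms(3)])
             (rule Suc.prems(2), use sub[OF that] in blast)
        show "z \<in> ball z0 (\<rho> - \<delta>)" "z + 1 \<in> ball z0 (\<rho> - \<delta>)"
          using in1[OF z, of 0] in1[OF z, of 1] by simp_all
      qed
      then show ?thesis by (simp add: fdiff_def)
    qed
    show "real N * (1 + \<delta>) < ?\<rho>" using Suc.prems(3) by (simp add: algebra_simps)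
  qed
  then show ?case by (simp add: funpow_swap1 divide_simps)
qed

text \<open>Serves the finitely many lattice points near the origin, where the disc of holomorphy is
  too small for N unit steps. The binomial coefficients add up to 2^N.\<close>

lemma norm_fdiff_power_le_trivial:
  assumes "\<And>j. j \<le> N \<Longrightarrow> norm (g (z + of_nat j)) \<le> M"
  shows "norm ((fdiff ^^ N) g z) \<le> 2 ^ N * M"
  using assms
proof (induction N arbitrary: z)
  case 0
  then show ?case using 0[of 0] by simp
next
  case (Suc N)
  have "norm ((fdiff ^^ N) g z) \<le> 2 ^ N * M" using Suc.prems by (intro Suc.IH) auto
  moreover have "norm ((fdiff ^^ N) g (z + 1)) \<le> 2 ^ N * M"
  proof (rule Suc.IH)
    show "norm (g (z + 1 + of_nat j)) \<le> M" if "j \<le> N" for j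
      using Suc.prems[of "Suc j"] that by (simp add: add_ac)
  qed
  ultimately have "norm ((fdiff ^^ N) g z - (fdiff ^^ N) g (z + 1)) \<le> 2 ^ N * M + 2 ^ N * M"
    by (intro norm_triangle_le_diff add_mono)
  then show ?case unfolding fdiff_power_Suc by (simp add: mult_ac)
qed

text \<open>The first coordinate is a complex variable so that Cauchy estimates can be applied to
  differences in it. The value at the origin is 0, by the convention for
  \<open>0 powr (- s)\<close>.\<close>

definition qpow :: "complex \<Rightarrow> int \<Rightarrow> complex \<Rightarrow> complex" where
  "qpow s y z = (z ^ 2 + of_int y ^ 2) powr (- s)"

lemma qpow_of_int: "qpow s y (of_int x) = of_real (of_int x ^ 2 + of_int y ^ 2) powr (- s)"
  by (simp add: qpow_def)

text \<open>Moving x by less than r / 4 changes the form by at most 2 r (r / 4) + (r / 4)^2 = 9/16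
  r^2. So w stays in a disc about r^2 inside the right half-plane, where its complex powers are
  holomorphic and its modulus is comparable to r^2.\<close>

lemma quadratic_near_axis:
  fixes x y :: real and h :: complex
  assumes r: "r > 0" "r ^ 2 = x ^ 2 + y ^ 2" and h: "norm h < r / 4"
  defines "w \<equiv> (of_real x + h) ^ 2 + of_real y ^ 2"
  shows "Re w > 0" "r ^ 2 / 4 \<le> norm w" "norm w \<le> 4 * r ^ 2"
proof -
  have xr: "\<bar>x\<bar> \<le> r" using r by (metis abs_le_square_iff abs_of_pos le_add_same_cancel1 zero_le_power2)
  have "w - of_real (r ^ 2) = 2 * of_real x * h + h ^ 2"
    using r(2) by (simp add: w_def power2_eq_square algebra_simps flip: of_real_mult of_real_add)
  then have "norm (w - of_real (r ^ 2)) \<le> 2 * \<bar>x\<bar> * norm h + norm h ^ 2"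
    by (metis (no_types, opaque_lifting) norm_mult norm_numeral norm_of_real norm_power norm_triangle_ineq mult.assoc)
  also have "\<dots> \<le> 2 * r * (r / 4) + (r / 4) ^ 2"
    using xr h r by (intro add_mono mult_mono power_mono) auto
  also have "\<dots> = 9 / 16 * r ^ 2" by (simp add: power2_eq_square)
  finally have b: "norm (w - of_real (r ^ 2)) \<le> 9 / 16 * r ^ 2" .
  have r2: "r ^ 2 > 0" using r(1) by simp
  have "Re w \<ge> r ^ 2 - norm (w - of_real (r ^ 2))"
    using abs_Re_le_cmod[of "w - of_real (r ^ 2)"] by simp
  then show "Re w > 0" using b r2 by linarith
  have n: "norm (of_real (r ^ 2) :: complex) = r ^ 2" using r2 by (simp only: norm_of_real abs_of_pos)
  show "r ^ 2 / 4 \<le> norm w"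
    using norm_triangle_ineq2[of "of_real (r ^ 2)" w] b r2 unfolding n norm_minus_commute[of w] by linarith
  show "norm w \<le> 4 * r ^ 2"
    using norm_triangle_ineq2[of w "of_real (r ^ 2)"] b r2 unfolding n by linarith
qed

text \<open>Comparability in both directions is what allows an exponent of either sign: one
  direction is used for a \<ge> 0, the other for a < 0.\<close>

lemma powr_le_powr_abs:
  fixes A B c :: real
  assumes "A > 0" "B > 0" "A \<le> c * B" "B \<le> c * A" "c \<ge> 1" "\<bar>a\<bar> \<le> b"
  shows "A powr a \<le> c powr b * B powr a"
proof (cases "a \<ge> 0")
  case True
  have "A powr a \<le> (c * B) powr a" using assms True by (intro powr_mono2) auto
  also have "\<dots> = c powr a * B powr a" using assms by (simp add: powr_mult)
  also have "\<dots> \<le> c powr b * B powr a" using assms True by (intro mult_right_mono powr_mono) auto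
  finally show ?thesis .
next
  case False
  have "A powr a \<le> (B / c) powr a" using assms False by (intro powr_mono2') (auto simp: field_simps)
  also have "\<dots> = c powr (- a) * B powr a" using assms by (simp add: powr_divide powr_minus field_simps)
  also have "\<dots> \<le> c powr b * B powr a" using assms False by (intro mult_right_mono powr_mono) auto
  finally show ?thesis .
qed

text \<open>The factor 4 powr B accounts for the ratio between the modulus of w and r^2, the factor
  exp (4 B) for the argument of w, which is at most pi < 4 in absolute value.\<close>

lemma norm_qpow_le:
  assumes r: "r > 0" "r ^ 2 = (of_int x ^ 2 + of_int y ^ 2 :: real)" and z: "z \<in> ball (of_int x) (r / 4)"
    and s: "norm s \<le> B"
  shows "norm (qpow s y z) \<le> exp (4 * B) * 4 powr B * (r ^ 2) powr (- Re s)"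
proof -
  define h where "h = z - of_int x"
  define w where "w = z ^ 2 + of_int y ^ 2"
  have h: "norm h < r / 4" using z by (simp add: h_def dist_norm norm_minus_commute)
  have w: "Re w > 0" "r ^ 2 / 4 \<le> norm w" "norm w \<le> 4 * r ^ 2"
    using quadratic_near_axis[OF r(1), of "of_int x" "of_int y" h] r(2) h by (simp_all add: w_def h_def)
  have w0: "w \<noteq> 0" using w(1) by auto
  have "norm (w powr (- s)) = exp (Re (- s * Ln w))" using w0 by (simp add: powr_def)
  also have "Re (- s * Ln w) = - Re s * ln (norm w) + Im s * Im (Ln w)" using w0 by simp
  also have "exp \<dots> = norm w powr (- Re s) * exp (Im s * Im (Ln w))"
    using w0 by (simp add: powr_def exp_add exp_minus field_simps exp_diff)
  also have "\<dots> \<le> (4 powr B * (r ^ 2) powr (- Re s)) * exp (4 * B)"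
  proof (intro mult_mono)
    show "norm w powr (- Re s) \<le> 4 powr B * (r ^ 2) powr (- Re s)"
    proof (rule powr_le_powr_abs)
      show "\<bar>- Re s\<bar> \<le> B" using s abs_Re_le_cmod[of s] by linarith
    qed (use w w0 r(1) in auto)
    have "\<bar>Im (Ln w)\<bar> \<le> 4" using mpi_less_Im_Ln[OF w0] Im_Ln_le_pi[OF w0] pi_less_4 by linarith
    moreover have "\<bar>Im s\<bar> \<le> B" using s abs_Im_le_cmod[of s] by linarith
    ultimately have "\<bar>Im s * Im (Ln w)\<bar> \<le> B * 4" unfolding abs_mult by (intro mult_mono) auto
    then show "exp (Im s * Im (Ln w)) \<le> exp (4 * B)" by simp
  qed auto
  finally show ?thesis by (simp add: qpow_def w_def mult_ac)
qed

lemma qpow_holomorphic: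
  assumes r: "r > 0" "r ^ 2 = (of_int x ^ 2 + of_int y ^ 2 :: real)"
  shows "qpow s y holomorphic_on ball (of_int x) (r / 4)"
  unfolding qpow_def
proof (rule holomorphic_on_powr)
  fix z :: complex assume "z \<in> ball (of_int x) (r / 4)"
  then have "norm (z - of_int x) < r / 4" by (simp add: dist_norm norm_minus_commute)
  then have "Re (z ^ 2 + of_int y ^ 2) > 0"
    using quadratic_near_axis(1)[OF r(1), of "of_int x" "of_int y" "z - of_int x"] r(2) by simp
  then show "z ^ 2 + of_int y ^ 2 \<notin> \<real>\<^sub>\<le>\<^sub>0" by (auto simp: complex_nonpos_Reals_iff)
qed (intro holomorphic_intros)+

text \<open>Each difference saves one power of r, the distance from the origin, hence 1/2 in the
  exponent of the form. The constant is uniform for s in a disc, as locally uniform convergence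
  requires. Points with r at least 8 n are treated by Cauchy estimates, the others by the trivial
  bound.\<close>

lemma norm_fdiff_qpow_le:
  "\<exists>C. \<forall>s x y. norm s \<le> B \<longrightarrow>
     norm ((fdiff ^^ N) (qpow s y) (of_int x)) \<le> C * (of_int x ^ 2 + of_int y ^ 2 + 1) powr (- (Re s + real N / 2))"
proof (cases "B \<ge> 0")
  case False
  then show ?thesis by (metis norm_ge_zero order_trans)
next
  case True
  define n where "n = real N + 1"
  define K where "K = exp (4 * B) * 4 powr B"
  \<comment> \<open>In \<open>C1\<close>, (8 n)^N comes from \<delta> = r / (8 n) and 2 powr (B + n)
    from replacing r^2 by r^2 + 1. In \<open>C2\<close>, the last factor compensates for the least
    value that the decaying power can take in the range L \<le> 100 n^2.\<close>
  define C1 where "C1 = K * (8 * n) ^ N * 2 powr (B + n)"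
  define C2 where "C2 = 2 ^ N * (100 * n ^ 2) powr B * (100 * n ^ 2) powr (B + n)"
  have n: "n \<ge> 1" by (simp add: n_def)
  have K: "K \<ge> 0" by (simp add: K_def)
  have C12: "C1 \<ge> 0" "C2 \<ge> 0" using n K by (auto simp: C1_def C2_def)
  have main: "norm ((fdiff ^^ N) (qpow s y) (of_int x))
    \<le> (C1 + C2) * (of_int x ^ 2 + of_int y ^ 2 + 1) powr (- (Re s + real N / 2))"
    if s: "norm s \<le> B" for s and x y :: int
  proof -
    define r where "r = sqrt (of_int x ^ 2 + of_int y ^ 2)"
    define L where "L = (of_int x ^ 2 + of_int y ^ 2 + 1 :: real)"
    define a where "a = Re s + real N / 2"
    have r2: "r ^ 2 = of_int x ^ 2 + of_int y ^ 2" by (simp add: r_def)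
    have L: "L = r ^ 2 + 1" by (simp add: L_def r2)
    have L1: "L \<ge> 1" by (simp add: L)
    have Res: "\<bar>Re s\<bar> \<le> B" using s abs_Re_le_cmod[of s] by linarith
    then have a: "\<bar>- a\<bar> \<le> B + n" by (auto simp: a_def n_def)
    show ?thesis
    proof (cases "r \<ge> 8 * n")
      case True
      have r0: "r > 0" using True n by linarith
      have r1: "r \<ge> 1" using True n by linarith
      \<comment> \<open>With this radius both N \<delta> and N are at most r / 8, the latter
        strictly less, so N steps stay within the radius r / 4 of holomorphy.\<close>
      define \<delta> where "\<delta> = r / (8 * n)"
      have \<delta>: "\<delta> > 0" using r0 n by (simp add: \<delta>_def)
      have "real N * \<delta> \<le> r / 8" using r0 n unfolding \<delta>_def n_def by (simp add: field_simps)
      moreover have "real N < r / 8" using True n_def by simp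
      ultimately have N: "real N * (1 + \<delta>) < r / 4" by (simp add: algebra_simps)
      have "norm ((fdiff ^^ N) (qpow s y) (of_int x)) \<le> K * (r ^ 2) powr (- Re s) / \<delta> ^ N"
        by (rule norm_fdiff_power_le[OF qpow_holomorphic[OF r0 r2] _ \<delta> N])
           (use norm_qpow_le[OF r0 r2 _ s] in \<open>simp add: K_def\<close>)
      also have "\<dots> = K * (8 * n) ^ N * ((r ^ 2) powr (- Re s) / r ^ N)"
        by (simp add: \<delta>_def power_divide)
      also have "r ^ N = (r ^ 2) powr (real N / 2)"
        using powr_powr[of r 2 "real N / 2"] r0 by (simp add: powr_realpow)
      also have "(r ^ 2) powr (- Re s) / \<dots> = (r ^ 2) powr (- a)"
        by (simp add: powr_diff[symmetric] a_def)
      also have "K * (8 * n) ^ N * (r ^ 2) powr (- a) \<le> K * (8 * n) ^ N * (2 powr (B + n) * L powr (- a))"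
      proof (intro mult_left_mono powr_le_powr_abs[OF _ _ _ _ _ a])
        have "r ^ 2 \<ge> 1" using r1 by simp
        then show "L \<le> 2 * r ^ 2" by (simp add: L)
        show "r ^ 2 \<le> 2 * L" by (simp add: L)
      qed (use r0 L1 K n in auto)
      finally have "norm ((fdiff ^^ N) (qpow s y) (of_int x)) \<le> C1 * L powr (- a)"
        by (simp add: C1_def mult_ac)
      also have "\<dots> \<le> (C1 + C2) * L powr (- a)" using C12 by (intro mult_right_mono) auto
      finally show ?thesis by (simp add: L_def a_def)
    next
      case False
      have "L \<le> (8 * n) ^ 2 + 1" unfolding L using False r_def by (intro add_mono power_mono) auto
      also have "\<dots> \<le> 100 * n ^ 2" using one_le_power[OF n, of 2] by (simp only: power_mult_distrib) simp
      finally have Ln: "L \<le> 100 * n ^ 2" .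
      have "norm ((fdiff ^^ N) (qpow s y) (of_int x)) \<le> 2 ^ N * (100 * n ^ 2) powr B"
      proof (rule norm_fdiff_power_le_trivial)
        fix j assume j: "j \<le> N"
        define x' where "x' = x + int j"
        define q where "q = x' ^ 2 + y ^ 2"
        have eq: "qpow s y (of_int x + of_nat j) = of_real (of_int q) powr (- s)"
          using qpow_of_int[of s y x'] by (simp add: x'_def q_def)
        have "\<bar>of_int x\<bar> \<le> r" unfolding r_def by (rule real_le_rsqrt) simp
        \<comment> \<open>The three terms of the expansion contribute at most 64 n^2, 16 n^2 and
          n^2.\<close>
        have qn: "of_int q \<le> 100 * n\<^sup>2"
        proof -
          have "(of_int q :: real) = r\<^sup>2 + 2 * (of_int x * real j) + (real j)\<^sup>2"
            unfolding r2 by (simp add: q_def x'_def power2_eq_square algebra_simps)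
          also have "\<dots> \<le> (8 * n)\<^sup>2 + 2 * (8 * n * n) + n\<^sup>2"
          proof -
            have "of_int x * real j \<le> \<bar>of_int x\<bar> * real j" by (intro mult_right_mono) auto
            also have "\<dots> \<le> 8 * n * n"
              using False \<open>\<bar>of_int x\<bar> \<le> r\<close> j n n_def by (intro mult_mono) auto
            finally have 1: "of_int x * real j \<le> 8 * n * n" .
            have 2: "r\<^sup>2 \<le> (8 * n)\<^sup>2" using False r_def by (intro power_mono) auto
            have 3: "(real j)\<^sup>2 \<le> n\<^sup>2" using j n_def by (intro power_mono) auto
            show ?thesis using 1 2 3 by linarith
          qed
          also have "\<dots> \<le> 100 * n\<^sup>2" using n by (simp add: power2_eq_square)
          finally show ?thesis by simp
        qed
        show "norm (qpow s y (of_int x + of_nat j)) \<le> (100 * n ^ 2) powr B"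
        proof (cases "q = 0")
          case False
          then have "q > 0" by (simp add: q_def sum_power2_gt_zero_iff)
          then have q1: "of_int q \<ge> (1::real)" by simp
          have "norm (qpow s y (of_int x + of_nat j)) = of_int q powr (- Re s)"
            unfolding eq using q1 by (subst norm_powr_real_powr) auto
          also have "\<dots> \<le> of_int q powr B" using q1 Res by (intro powr_mono) auto
          also have "\<dots> \<le> (100 * n ^ 2) powr B" using q1 qn True by (intro powr_mono2) auto
          finally show ?thesis .
        qed (simp add: eq)
      qed
      also have "\<dots> = C2 * (100 * n ^ 2) powr (- (B + n))"
        using n by (simp add: C2_def powr_add[symmetric])
      also have "(100 * n ^ 2) powr (- (B + n)) \<le> L powr (- (B + n))"
        using Ln L1 True n by (intro powr_mono2') auto
      also have "\<dots> \<le> L powr (- a)" using L1 a by (intro powr_mono) auto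
      finally have "norm ((fdiff ^^ N) (qpow s y) (of_int x)) \<le> C2 * L powr (- a)"
        using C12 by (simp add: mult_left_mono)
      also have "\<dots> \<le> (C1 + C2) * L powr (- a)" using C12 by (intro mult_right_mono) auto
      finally show ?thesis by (simp add: L_def a_def)
    qed
  qed
  then show ?thesis by (intro exI[of _ "C1 + C2"]) blast
qed

section \<open>Alternating sums over the line and the plane\<close>

definition alt_term :: "nat \<Rightarrow> complex \<Rightarrow> int \<times> int \<Rightarrow> complex" where
  "alt_term N s = (\<lambda>(x, y). (if even (x + y) then 1 else -1) * (fdiff ^^ N) (qpow s y) (of_int x) / 2 ^ N)"

definition alt_sum :: "nat \<Rightarrow> int set \<Rightarrow> complex \<Rightarrow> complex" where
  "alt_sum N Y s = (\<Sum>\<^sub>\<infinity>p\<in>UNIV \<times> Y. alt_term N s p)"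

lemma fdiff_qpow_holomorphic: "(\<lambda>s. (fdiff ^^ N) (qpow s y) z) holomorphic_on A"
proof (induction N arbitrary: z)
  case 0
  then show ?case unfolding qpow_def by (auto intro!: holomorphic_intros)
next
  case (Suc N)
  have "(\<lambda>s. (fdiff ^^ N) (qpow s y) z - (fdiff ^^ N) (qpow s y) (z + 1)) holomorphic_on A"
    by (intro holomorphic_intros Suc.IH)
  then show ?case unfolding fdiff_power_Suc .
qed

text \<open>The threshold is the one for the whole plane, with exponent Re z + N / 2 > 1; the
  majorant for any smaller Y is its restriction.\<close>

lemma alt_sum_bound:
  assumes z: "Re z > 1 - real N / 2"
  shows "\<exists>V M. open V \<and> z \<in> V \<and> M summable_on UNIV \<times> Y \<and> (\<forall>p\<in>UNIV \<times> Y. \<forall>s\<in>V. norm (alt_term N s p) \<le> M p)"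
proof -
  obtain a where a: "1 - real N / 2 < a" "a < Re z" using dense[OF z] by auto
  define V where "V = ball z 1 \<inter> {s. Re s > a}"
  obtain C where C: "\<And>s x y. norm s \<le> norm z + 1 \<Longrightarrow> norm ((fdiff ^^ N) (qpow s y) (of_int x))
      \<le> C * (of_int x ^ 2 + of_int y ^ 2 + 1) powr (- (Re s + real N / 2))"
    using norm_fdiff_qpow_le[of "norm z + 1" N] by blast
  define M where "M = (\<lambda>(x, y). \<bar>C\<bar> * (of_int x ^ 2 + of_int y ^ 2 + 1) powr (- (a + real N / 2)) :: real)"
  have "(\<lambda>(x, y). (of_int x ^ 2 + of_int y ^ 2 + 1) powr (- (a + real N / 2))) summable_on (UNIV :: (int \<times> int) set)"
    by (rule summable_on_lattice) (use a in auto)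
  then have "(\<lambda>p. \<bar>C\<bar> * (case p of (x, y) \<Rightarrow> (of_int x ^ 2 + of_int y ^ 2 + 1) powr (- (a + real N / 2)))) summable_on (UNIV :: (int \<times> int) set)"
    by (rule summable_on_cmult_right)
  also have "(\<lambda>p. \<bar>C\<bar> * (case p of (x, y) \<Rightarrow> (of_int x ^ 2 + of_int y ^ 2 + 1) powr (- (a + real N / 2)))) = M"
    by (auto simp: M_def)
  finally have M: "M summable_on UNIV \<times> Y" by (rule summable_on_subset_banach) auto
  have bd: "norm (alt_term N s p) \<le> M p" if s: "s \<in> V" for s p
  proof -
    obtain x y where p: "p = (x, y)" by (cases p)
    have s': "norm s \<le> norm z + 1" "Re s > a"
      using s norm_triangle_ineq2[of s z] by (auto simp: V_def dist_norm norm_minus_commute)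
    let ?F = "(fdiff ^^ N) (qpow s y) (of_int x)"
    have "norm (alt_term N s p) = norm ?F / 2 ^ N"
      by (simp add: alt_term_def p norm_mult norm_divide norm_power)
    also have "\<dots> \<le> norm ?F / 1" by (intro divide_left_mono) auto
    also have "\<dots> \<le> C * (of_int x ^ 2 + of_int y ^ 2 + 1) powr (- (Re s + real N / 2))" using C[OF s'(1)] by simp
    also have "\<dots> \<le> \<bar>C\<bar> * (of_int x ^ 2 + of_int y ^ 2 + 1) powr (- (a + real N / 2))"
      using s' by (intro mult_mono powr_mono) auto
    finally show ?thesis by (simp add: M_def p)
  qed
  have "open V" "z \<in> V" using a by (auto simp: V_def open_halfspace_Re_gt)
  then show ?thesis using M bd by (intro exI[of _ V] exI[of _ M]) auto
qed

lemma alt_sum_summable: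
  assumes "Re s > 1 - real N / 2"
  shows "alt_term N s summable_on UNIV \<times> Y"
proof -
  obtain V M where V: "s \<in> V" "M summable_on UNIV \<times> Y" "\<forall>p\<in>UNIV \<times> Y. \<forall>s\<in>V. norm (alt_term N s p) \<le> M p"
    using alt_sum_bound[OF assms, of Y] by blast
  show ?thesis
    by (rule abs_summable_summable, rule Infinite_Sum.abs_summable_on_comparison_test'[OF V(2)]) (use V in auto)
qed

lemma alt_sum_holomorphic: "alt_sum N Y holomorphic_on {s. Re s > 1 - real N / 2}"
  unfolding alt_sum_def[abs_def]
proof (rule holomorphic_on_infsum)
  show "open {s. 1 - real N / 2 < Re s}" by (rule open_halfspace_Re_gt)
  show "(\<lambda>s. alt_term N s p) holomorphic_on {s. 1 - real N / 2 < Re s}" for p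
    unfolding alt_term_def by (cases p) (auto intro!: holomorphic_intros fdiff_qpow_holomorphic)
qed (use alt_sum_bound in blast)

text \<open>Summation by parts: the shift of x by one permutes the index set and reverses the sign
  (-1)^(x + y). The twisted sum of a function thus equals half the twisted sum of its difference,
  which explains the division by 2^N in \<open>alt_term\<close>.\<close>

lemma alt_sum_Suc:
  assumes "Re s > 1 - real N / 2"
  shows "alt_sum (Suc N) Y s = alt_sum N Y s"
proof -
  define f where "f = alt_term N s"
  define g where "g = (\<lambda>(x, y). - f (x + 1, y))"
  have f: "f summable_on UNIV \<times> Y" unfolding f_def by (rule alt_sum_summable[OF assms])
  have bij: "bij_betw (\<lambda>(x, y). (x + 1, y)) (UNIV \<times> Y) ((UNIV :: int set) \<times> Y)"
    by (rule bij_betwI[of _ _ _ "\<lambda>(x, y). (x - 1, y)"]) auto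
  have fg: "(\<lambda>p. - g p) = (\<lambda>p. f (case p of (x, y) \<Rightarrow> (x + 1, y)))" by (auto simp: g_def)
  have "(\<lambda>p. - g p) summable_on UNIV \<times> Y"
    unfolding fg using summable_on_reindex_bij_betw[OF bij, of f] f by simp
  then have g: "g summable_on UNIV \<times> Y" by (simp add: summable_on_uminus)
  have "(\<Sum>\<^sub>\<infinity>p\<in>UNIV \<times> Y. - g p) = infsum f (UNIV \<times> Y)"
    unfolding fg by (rule infsum_reindex_bij_betw[OF bij])
  then have gs: "infsum g (UNIV \<times> Y) = - infsum f (UNIV \<times> Y)"
    by (simp add: infsum_uminus equation_minus_iff[of "infsum g _"])
  have eq: "alt_term (Suc N) s p = (f p - g p) / 2" for p
    unfolding alt_term_def fdiff_power_Suc by (cases p) (auto simp: f_def g_def alt_term_def divide_simps)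
  have "alt_sum (Suc N) Y s = (\<Sum>\<^sub>\<infinity>p\<in>UNIV \<times> Y. (f p - g p) / 2)"
    by (simp only: alt_sum_def eq)
  also have "\<dots> = infsum f (UNIV \<times> Y)"
  proof (rule infsumI)
    have "((\<lambda>p. f p - g p) has_sum (infsum f (UNIV \<times> Y) - infsum g (UNIV \<times> Y))) (UNIV \<times> Y)"
      using has_sum_add[OF has_sum_infsum[OF f] has_sum_uminusI[OF has_sum_infsum[OF g]]] by simp
    from has_sum_divide_const[OF this, of 2]
    show "((\<lambda>p. (f p - g p) / 2) has_sum infsum f (UNIV \<times> Y)) (UNIV \<times> Y)" by (simp add: gs)
  qed
  finally show ?thesis by (simp add: f_def alt_sum_def)
qed

lemma alt_sum_mono:
  assumes "N \<le> M" "Re s > 1 - real N / 2"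
  shows "alt_sum M Y s = alt_sum N Y s"
  using assms(1)
proof (induction M rule: dec_induct)
  case (step M)
  have "Re s > 1 - real M / 2" using step(1) assms(2) by (simp add: field_simps)
  then show ?case using alt_sum_Suc step by simp
qed simp

text \<open>The number of differences grows with s: it makes 1 - N / 2 less than - norm s, hence
  less than Re s. All admissible N give the same value, so these choices glue to an entire
  function.\<close>

definition alt_entire :: "int set \<Rightarrow> complex \<Rightarrow> complex" where
  "alt_entire Y s = alt_sum (nat \<lceil>2 * norm s\<rceil> + 3) Y s"

lemma alt_entire_eq:
  assumes "Re s > 1 - real N / 2"
  shows "alt_entire Y s = alt_sum N Y s"
proof -
  define M where "M = nat \<lceil>2 * norm s\<rceil> + 3"
  have "real M \<ge> 2 * norm s + 3" unfolding M_def by linarith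
  then have "Re s > 1 - real M / 2" using abs_Re_le_cmod[of s] by (simp add: field_simps)
  then have "alt_sum M Y s = alt_sum N Y s"
    using assms alt_sum_mono[of N M] alt_sum_mono[of M N] by (cases "N \<le> M") auto
  then show ?thesis by (simp add: alt_entire_def M_def)
qed

lemma alt_entire_holomorphic: "alt_entire Y holomorphic_on UNIV"
proof (rule holomorphic_onI)
  fix s :: complex
  obtain n where n: "2 - 2 * Re s < real n" using reals_Archimedean2 by blast
  let ?U = "{s. Re s > 1 - real n / 2}"
  have "s \<in> ?U" using n by simp
  moreover have "alt_entire Y holomorphic_on ?U"
    using alt_sum_holomorphic by (rule holomorphic_transform) (simp add: alt_entire_eq)
  ultimately show "alt_entire Y field_differentiable at s within UNIV"
    using open_halfspace_Re_gt by (metis holomorphic_on_imp_differentiable_at)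
qed

text \<open>The origin contributes nothing to the following sums, since \<^term>\<open>0 powr s = (0 :: complex)\<close>.\<close>

definition qsum :: "int set \<Rightarrow> complex \<Rightarrow> complex" where
  "qsum Y s = (\<Sum>\<^sub>\<infinity>(x, y)\<in>UNIV \<times> Y. of_real (of_int (x ^ 2 + y ^ 2)) powr (- s))"

lemma qsum_summable:
  assumes "Re s > 1"
  shows "(\<lambda>(x, y). of_real (of_int (x ^ 2 + y ^ 2)) powr (- s) :: complex) summable_on UNIV \<times> Y"
proof -
  define g where "g = (\<lambda>(x, y). (if even (x + y) then 1 else -1) * qpow s y (of_int x))"
  define h where "h = (\<lambda>(x, y). of_real (of_int (x ^ 2 + y ^ 2)) powr (- s) :: complex)"
  have "g summable_on UNIV \<times> Y"
    using alt_sum_summable[of 0 s Y] assms by (simp add: g_def alt_term_def)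
  then have "(\<lambda>p. norm (g p)) summable_on UNIV \<times> Y"
    by (simp add: summable_on_iff_abs_summable_on_complex)
  moreover have "norm (g p) = norm (h p)" for p
    by (cases p) (simp add: g_def h_def qpow_def norm_mult)
  ultimately have "(\<lambda>p. norm (h p)) summable_on UNIV \<times> Y" by simp
  then have "h summable_on UNIV \<times> Y" by (rule abs_summable_summable)
  then show ?thesis by (simp add: h_def)
qed

text \<open>The twisted sum is twice the sum over points with x + y even, minus the total. The
  similitude \<phi> carries the full index set onto those points and multiplies the form by k, so
  the even part is k powr (- s) times the total.\<close>

lemma alt_entire_qsum:
  assumes s: "Re s > 1" and bij: "bij_betw \<phi> (UNIV \<times> Y) {(x, y). y \<in> Y \<and> even (x + y)}"
    and q: "\<And>x y x' y'. \<phi> (x, y) = (x', y') \<Longrightarrow> y \<in> Y \<Longrightarrow> x' ^ 2 + y' ^ 2 = int k * (x ^ 2 + y ^ 2)"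
  shows "alt_entire Y s = (2 * of_nat k powr (- s) - 1) * qsum Y s"
proof -
  define f where "f = (\<lambda>(x, y). of_real (of_int (x ^ 2 + y ^ 2)) powr (- s) :: complex)"
  define E where "E = {(x :: int, y). y \<in> Y \<and> even (x + y)}"
  have f: "f summable_on UNIV \<times> Y" unfolding f_def by (rule qsum_summable[OF s])
  have E: "E \<subseteq> UNIV \<times> Y" by (auto simp: E_def)
  have fE: "f summable_on E" "f summable_on (UNIV \<times> Y - E)"
    using f E by (auto intro: summable_on_subset_banach)
  have tot: "infsum f (UNIV \<times> Y) = infsum f E + infsum f (UNIV \<times> Y - E)"
    using infsum_Un_disjoint[OF fE] E by (simp add: Un_absorb1)
  have fk: "f (\<phi> p) = of_nat k powr (- s) * f p" if pin: "p \<in> UNIV \<times> Y" for p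
  proof -
    obtain x y where p: "p = (x, y)" "y \<in> Y" using pin by (cases p) auto
    obtain x' y' where p': "\<phi> p = (x', y')" by (cases "\<phi> p")
    have "of_real (of_int (x' ^ 2 + y' ^ 2)) = (of_real (real k) * of_real (of_int (x ^ 2 + y ^ 2)) :: complex)"
      using q[of x y x' y'] p p' by simp
    then have "f (\<phi> p) = (of_real (real k) * of_real (of_int (x ^ 2 + y ^ 2))) powr (- s)"
      unfolding p' f_def by simp
    also have "\<dots> = of_real (real k) powr (- s) * of_real (of_int (x ^ 2 + y ^ 2)) powr (- s)"
      by (rule powr_times_real_left) auto
    finally show ?thesis by (simp add: f_def p)
  qed
  have "infsum f E = infsum (\<lambda>p. f (\<phi> p)) (UNIV \<times> Y)"
    using infsum_reindex_bij_betw[OF bij, of f] unfolding E_def by (rule sym)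
  then have ev: "infsum f E = of_nat k powr (- s) * infsum f (UNIV \<times> Y)"
    by (simp add: fk infsum_cmult_right' cong: infsum_cong)
  have "alt_entire Y s = alt_sum 0 Y s" using s by (intro alt_entire_eq) simp
  also have "\<dots> = (\<Sum>\<^sub>\<infinity>p\<in>UNIV \<times> Y. if p \<in> E then f p else - f p)"
    unfolding alt_sum_def
  proof (rule infsum_cong, clarify)
    fix x y assume "y \<in> Y"
    then show "alt_term 0 s (x, y) = (if (x, y) \<in> E then f (x, y) else - f (x, y))"
      by (cases "even (x + y)") (simp_all add: alt_term_def E_def f_def qpow_def)
  qed
  also have "\<dots> = (\<Sum>\<^sub>\<infinity>p\<in>E \<union> (UNIV \<times> Y - E). if p \<in> E then f p else - f p)"
    using E by (simp add: Un_absorb1)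
  also have "\<dots> = (\<Sum>\<^sub>\<infinity>p\<in>E. if p \<in> E then f p else - f p) + (\<Sum>\<^sub>\<infinity>p\<in>UNIV \<times> Y - E. if p \<in> E then f p else - f p)"
  proof (rule infsum_Un_disjoint)
    show "(\<lambda>p. if p \<in> E then f p else - f p) summable_on E"
      using fE(1) by (simp cong: summable_on_cong)
    have "(\<lambda>p. if p \<in> E then f p else - f p) summable_on UNIV \<times> Y - E \<longleftrightarrow> (\<lambda>p. - f p) summable_on UNIV \<times> Y - E"
      by (rule summable_on_cong) auto
    then show "(\<lambda>p. if p \<in> E then f p else - f p) summable_on UNIV \<times> Y - E"
      using fE(2) by (simp add: summable_on_uminus)
  qed auto
  also have "(\<Sum>\<^sub>\<infinity>p\<in>E. if p \<in> E then f p else - f p) = infsum f E" by (intro infsum_cong) auto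
  also have "(\<Sum>\<^sub>\<infinity>p\<in>UNIV \<times> Y - E. if p \<in> E then f p else - f p) = (\<Sum>\<^sub>\<infinity>p\<in>UNIV \<times> Y - E. - f p)" by (intro infsum_cong) auto
  also have "\<dots> = infsum f E - infsum f (UNIV \<times> Y)" by (simp add: infsum_uminus tot)
  finally have "alt_entire Y s = (2 * of_nat k powr (- s) - 1) * infsum f (UNIV \<times> Y)"
    by (simp add: ev algebra_simps)
  then show ?thesis by (simp add: qsum_def f_def)
qed

lemma alt_entire_line:
  assumes "Re s > 1"
  shows "alt_entire {0} s = (2 * 4 powr (- s) - 1) * qsum {0} s"
proof -
  have "alt_entire {0} s = (2 * of_nat 4 powr (- s) - 1) * qsum {0} s"
  proof (rule alt_entire_qsum[OF assms, where \<phi> = "\<lambda>(x, y). (2 * x, y)"])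
    show "bij_betw (\<lambda>(x, y). (2 * x, y)) (UNIV \<times> {0}) {(x, y). y \<in> {0} \<and> even ((x::int) + y)}"
      by (rule bij_betwI[of _ _ _ "\<lambda>(x, y). (x div 2, y)"]) auto
  qed (auto simp: power2_eq_square split: prod.splits)
  then show ?thesis by simp
qed

lemma alt_entire_plane:
  assumes "Re s > 1"
  shows "alt_entire UNIV s = (2 * 2 powr (- s) - 1) * qsum UNIV s"
proof -
  have "alt_entire UNIV s = (2 * of_nat 2 powr (- s) - 1) * qsum UNIV s"
  \<comment> \<open>This map is multiplication by 1 + i on the Gaussian integers: its image is the
    set of points with even coordinate sum, and 1 + i has norm 2.\<close>
  proof (rule alt_entire_qsum[OF assms, where \<phi> = "\<lambda>(x, y). (x - y, x + y)"])
    show "bij_betw (\<lambda>(x, y). (x - y, x + y)) (UNIV \<times> UNIV) {(x, y). y \<in> UNIV \<and> even ((x::int) + y)}"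
    proof (rule bij_betwI[of _ _ _ "\<lambda>(x, y). ((x + y) div 2, (y - x) div 2)"])
      fix p :: "int \<times> int" assume "p \<in> {(x, y). y \<in> UNIV \<and> even (x + y)}"
      then obtain x y where p: "p = (x, y)" "even (x + y)" by (cases p) auto
      then obtain k where "x + y = 2 * k" by (elim evenE)
      then have y: "y = 2 * k - x" by simp
      have "(x + y) div 2 = k" "(y - x) div 2 = k - x" using y by auto
      then show "(case case p of (x, y) \<Rightarrow> ((x + y) div 2, (y - x) div 2) of (x, y) \<Rightarrow> (x - y, x + y)) = p"
        using y by (simp add: p)
    qed auto
  qed (auto simp: power2_eq_square algebra_simps)
  then show ?thesis by simp
qed

definition qmero :: "int set \<Rightarrow> nat \<Rightarrow> complex \<Rightarrow> complex" where
  "qmero Y k s = alt_entire Y s / (2 * of_nat k powr (- s) - 1)"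

lemma qmero_props:
  assumes "Y = {0} \<and> k = 4 \<or> Y = UNIV \<and> k = 2"
  shows "qmero Y k meromorphic_on UNIV" and "Re s > 1 \<Longrightarrow> qmero Y k s = qsum Y s"
  unfolding qmero_def[abs_def]
proof -
  show "(\<lambda>s. alt_entire Y s / (2 * of_nat k powr (- s) - 1)) meromorphic_on UNIV"
    using alt_entire_holomorphic[of Y]
    by (intro meromorphic_intros analytic_on_imp_meromorphic_on)
       (auto intro!: holomorphic_intros simp: analytic_on_open)
  assume s: "Re s > 1"
  \<comment> \<open>For Re s > 1 the modulus of the left side is less than 2 / k, which is at most 1
    for k = 2 and for k = 4.\<close>
  have "2 * of_nat k powr (- s) \<noteq> (1 :: complex)"
  proof
    assume "2 * of_nat k powr (- s) = (1 :: complex)"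
    then have "norm (2 * of_nat k powr (- s) :: complex) = 1" by simp
    then have "2 * (real k powr (- Re s)) = 1"
      by (subst (asm) norm_mult, subst (asm) of_real_of_nat_eq[symmetric], subst (asm) norm_powr_real_powr) auto
    moreover have "real k powr (- Re s) < real k powr (- 1)" using s assms by (intro powr_less_mono) auto
    ultimately show False using assms by (auto simp: powr_minus)
  qed
  then show "alt_entire Y s / (2 * of_nat k powr (- s) - 1) = qsum Y s"
    using assms alt_entire_line[OF s] alt_entire_plane[OF s] by auto
qed

section \<open>The zeta function and sums over primitive vectors\<close>

text \<open>The zeta series as an unordered sum, the form in which it can be multiplied with sums
  over lattice points. \<open>zeta_ser_sums\<close> links it to the ordered series behind
  \<open>zeta\<close>.\<close>

definition zeta_ser :: "complex \<Rightarrow> complex" where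
  "zeta_ser s = (\<Sum>\<^sub>\<infinity>n\<in>{0<..}. of_real (real n) powr (- s))"

lemma bij_Suc: "bij_betw Suc UNIV {0<..}"
  by (rule bij_betwI[of _ _ _ "\<lambda>n. n - 1"]) auto

lemma summable_powr_pos:
  assumes "\<sigma> > (1 :: real)"
  shows "(\<lambda>n. real n powr (- \<sigma>)) summable_on {0<..}"
proof -
  have "summable (\<lambda>n. real n powr (- \<sigma>))" using assms by (subst summable_real_powr_iff) auto
  then have "(\<lambda>n. real n powr (- \<sigma>)) summable_on UNIV"
    by (intro summable_nonneg_imp_summable_on) auto
  then show ?thesis by (rule summable_on_subset_banach) auto
qed

lemma zeta_ser_summable:
  assumes "Re s > 1"
  shows "(\<lambda>n. norm (of_real (real n) powr (- s) :: complex)) summable_on {0<..}"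
  by (rule dirichlet_summable) (use assms summable_powr_pos in auto)

lemma zeta_ser_has_sum:
  assumes "Re s > 1"
  shows "((\<lambda>n. of_real (real n) powr (- s)) has_sum zeta_ser s) {0<..}"
  unfolding zeta_ser_def by (rule has_sum_infsum, rule abs_summable_summable, rule zeta_ser_summable[OF assms])

lemma zeta_ser_holomorphic: "zeta_ser holomorphic_on {s. Re s > 1}"
proof -
  have "(\<lambda>s. \<Sum>\<^sub>\<infinity>n\<in>{0<..}. of_real (real n) powr (- s) :: complex) holomorphic_on {s. Re s > 1}"
    by (rule dirichlet_holomorphic) (auto intro: summable_powr_pos)
  then show ?thesis by (simp add: zeta_ser_def[abs_def])
qed

lemma zeta_ser_sums:
  assumes "Re s > 1"
  shows "(\<lambda>n. 1 / of_nat (Suc n) powr s) sums zeta_ser s"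
proof -
  have "((\<lambda>n. of_real (real (Suc n)) powr (- s)) has_sum zeta_ser s) (UNIV :: nat set)"
    using has_sum_reindex_bij_betw[OF bij_Suc, of "\<lambda>n. of_real (real n) powr (- s)"] zeta_ser_has_sum[OF assms] by simp
  then have "(\<lambda>n. of_real (real (Suc n)) powr (- s)) sums zeta_ser s" by (rule has_sum_imp_sums)
  then show ?thesis by (simp add: powr_minus field_simps)
qed

text \<open>The term 1 dominates: the second term is at most 1/4, and the others are bounded by the
  telescoping series of 1/(m (m + 1)) from m = 2 on, with sum 1/2.\<close>

lemma zeta_ser_nonzero:
  assumes s: "Re s \<ge> 2"
  shows "zeta_ser s \<noteq> 0"
proof -
  define f where "f = (\<lambda>n. 1 / of_nat (Suc n) powr s)"
  define g where "g = (\<lambda>n. inverse (real (n + 2)) - inverse (real (n + 3)))"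
  have f: "f sums zeta_ser s" unfolding f_def by (rule zeta_ser_sums) (use s in simp)
  have "(\<lambda>n. inverse (real (n + 2))) \<longlonglongrightarrow> 0"
    using LIMSEQ_ignore_initial_segment[OF LIMSEQ_inverse_real_of_nat, of 1] by (simp add: add_ac)
  from telescope_sums'[OF this] have g: "g sums (1 / 2)" by (simp add: g_def add_ac)
  have f2: "(\<lambda>n. f (n + 2)) sums (zeta_ser s - f 0 - f 1)"
    using sums_split_initial_segment[OF f, of 2] by (simp add: numeral_2_eq_2 algebra_simps)
  have nf: "norm (f n) \<le> 1 / real (Suc n) ^ 2" for n
  proof -
    have "norm (f n) = 1 / real (Suc n) powr Re s"
      unfolding f_def norm_divide
      by (subst of_real_of_nat_eq[symmetric], subst norm_powr_real_powr) auto
    also have "\<dots> \<le> 1 / real (Suc n) powr 2"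
      using s by (intro divide_left_mono powr_mono) auto
    finally show ?thesis by simp
  qed
  have le: "norm (f (n + 2)) \<le> g n" for n
  proof -
    have "1 / real (Suc (n + 2)) ^ 2 \<le> 1 / (real (n + 2) * real (n + 3))"
      unfolding power2_eq_square by (intro divide_left_mono mult_mono) auto
    also have "\<dots> = g n" by (simp add: g_def divide_simps)
    finally show ?thesis using nf[of "n + 2"] by linarith
  qed
  have "norm (zeta_ser s - f 0 - f 1) \<le> 1 / 2"
    using norm_suminf_le[of "\<lambda>n. f (n + 2)" g] le f2 g by (simp add: sums_iff)
  moreover have "f 0 = 1" by (simp add: f_def)
  moreover have "norm (f 1) \<le> 1 / 4" using nf[of 1] by (simp add: power2_eq_square)
  moreover have "norm (1 :: complex) \<le> norm (zeta_ser s) + norm (zeta_ser s - f 0 - f 1) + norm (f 1)"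
    using norm_triangle_ineq4[of "zeta_ser s" "zeta_ser s - f 0 - f 1"]
      norm_triangle_ineq4[of "zeta_ser s - (zeta_ser s - f 0 - f 1)" "f 1"] \<open>f 0 = 1\<close> by simp
  ultimately show ?thesis by auto
qed

section \<open>Primitive vectors and the sum that is the Eisenstein series\<close>

definition lexpos :: "(int \<times> int) set" where
  "lexpos = {(c, d). c > 0 \<or> c = 0 \<and> d > 0}"

text \<open>\<open>lexpos\<close> contains exactly one of v and -v for every nonzero v, so
  \<open>prim\<close> has exactly one vector for each point of the projective line over the
  rationals.\<close>

definition prim :: "(int \<times> int) set" where
  "prim = {(c, d) \<in> lexpos. coprime c d}"

definition Q :: "int \<times> int \<Rightarrow> real" where
  "Q p = of_int (fst p ^ 2 + snd p ^ 2)"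

lemma bij_prim: "bij_betw (\<lambda>(g :: nat, c, d). (int g * c, int g * d)) ({0<..} \<times> prim) lexpos"
proof (rule bij_betwI[of _ _ _ "\<lambda>(c, d). (nat (gcd c d), c div gcd c d, d div gcd c d)"])
  show "(\<lambda>(g :: nat, c, d). (int g * c, int g * d)) \<in> {0<..} \<times> prim \<rightarrow> lexpos"
    by (auto simp: prim_def lexpos_def)
  show "(\<lambda>(c, d). (nat (gcd c d), c div gcd c d, d div gcd c d)) \<in> lexpos \<rightarrow> {0<..} \<times> prim"
  proof
    fix p assume "p \<in> lexpos"
    then obtain c d where p: "p = (c, d)" "c > 0 \<or> c = 0 \<and> d > 0" by (auto simp: lexpos_def)
    have g: "gcd c d > 0" using p by auto
    have "coprime (c div gcd c d) (d div gcd c d)" using p by (intro div_gcd_coprime) auto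
    moreover have "c div gcd c d > 0 \<or> c div gcd c d = 0 \<and> d div gcd c d > 0"
    proof (cases "c > 0")
      case True
      then show ?thesis by (simp add: pos_imp_zdiv_pos_iff g zdvd_imp_le)
    next
      case False
      then show ?thesis using p by auto
    qed
    ultimately show "(case p of (c, d) \<Rightarrow> (nat (gcd c d), c div gcd c d, d div gcd c d)) \<in> {0<..} \<times> prim"
      using g p by (auto simp: prim_def lexpos_def)
  qed
  fix q :: "nat \<times> int \<times> int" assume "q \<in> {0<..} \<times> prim"
  then obtain g c d where q: "q = (g, c, d)" "g > 0" "coprime c d" by (cases q) (auto simp: prim_def)
  then have "gcd (int g * c) (int g * d) = int g" by (simp add: gcd_mult_left)
  then show "(case case q of (g, c, d) \<Rightarrow> (int g * c, int g * d) of (c, d) \<Rightarrow> (nat (gcd c d), c div gcd c d, d div gcd c d)) = q"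
    using q by simp
next
  fix p assume "p \<in> lexpos"
  then show "(case case p of (c, d) \<Rightarrow> (nat (gcd c d), c div gcd c d, d div gcd c d) of (g, c, d) \<Rightarrow> (int g * c, int g * d)) = p"
    by (cases p) auto
qed

lemma Q_pos: "p \<in> lexpos \<Longrightarrow> Q p \<ge> 1"
proof -
  assume "p \<in> lexpos"
  then have "fst p ^ 2 + snd p ^ 2 > 0" by (auto simp: lexpos_def sum_power2_gt_zero_iff)
  then show ?thesis unfolding Q_def by linarith
qed

lemma prim_lexpos: "p \<in> prim \<Longrightarrow> p \<in> lexpos" by (auto simp: prim_def)

lemma Q_mult: "Q (g * c, g * d) = of_int g ^ 2 * Q (c, d)"
  by (simp add: Q_def algebra_simps power_mult_distrib)

lemma qsum_has_sum:
  assumes "Re s > 1"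
  shows "((\<lambda>p. of_real (Q p) powr (- s)) has_sum qsum Y s) (UNIV \<times> Y)"
proof -
  have "((\<lambda>(x, y). of_real (of_int (x ^ 2 + y ^ 2)) powr (- s)) has_sum qsum Y s) (UNIV \<times> Y)"
    unfolding qsum_def by (rule has_sum_infsum[OF qsum_summable[OF assms]])
  then show ?thesis by (simp add: Q_def case_prod_unfold)
qed

lemma Q_summable:
  assumes "\<sigma> > (1 :: real)"
  shows "(\<lambda>p. Q p powr (- \<sigma>)) summable_on A"
proof -
  have "(\<lambda>p. of_real (Q p) powr (- of_real \<sigma>) :: complex) summable_on UNIV"
    using qsum_has_sum[of "of_real \<sigma>" UNIV] assms by (auto dest: has_sum_imp_summable)
  then have "(\<lambda>p. norm (of_real (Q p) powr (- of_real \<sigma>) :: complex)) summable_on UNIV"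
    by (simp add: summable_on_iff_abs_summable_on_complex)
  also have "(\<lambda>p. norm (of_real (Q p) powr (- of_real \<sigma>) :: complex)) = (\<lambda>p. Q p powr (- \<sigma>))"
  proof
    fix p
    have "Q p \<ge> 0" by (simp add: Q_def)
    then show "norm (of_real (Q p) powr (- of_real \<sigma>) :: complex) = Q p powr (- \<sigma>)"
      by (subst norm_powr_real_powr) auto
  qed
  finally show ?thesis by (rule summable_on_subset_banach) auto
qed

text \<open>The Eisenstein series at the identity, with its argument shifted by 1/2 so that the
  exponent is s.\<close>

definition eis :: "complex \<Rightarrow> complex" where
  "eis s = (\<Sum>\<^sub>\<infinity>p\<in>prim. of_real (Q p) powr (- s))"

lemma eis_summable:
  assumes "Re s > 1"
  shows "(\<lambda>p. norm (of_real (Q p) powr (- s) :: complex)) summable_on prim"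
  by (rule dirichlet_summable) (use assms Q_summable Q_pos prim_lexpos in \<open>force+\<close>)

lemma eis_has_sum:
  assumes "Re s > 1"
  shows "((\<lambda>p. of_real (Q p) powr (- s)) has_sum eis s) prim"
  unfolding eis_def by (rule has_sum_infsum, rule abs_summable_summable, rule eis_summable[OF assms])

lemma eis_holomorphic: "eis holomorphic_on {s. Re s > 1}"
proof -
  have "(\<lambda>s. \<Sum>\<^sub>\<infinity>p\<in>prim. of_real (Q p) powr (- s) :: complex) holomorphic_on {s. Re s > 1}"
    by (rule dirichlet_holomorphic) (auto intro: Q_summable Q_pos prim_lexpos)
  then show ?thesis by (simp add: eis_def[abs_def])
qed

lemma powr_of_square_mult:
  fixes g q :: real and s :: complex
  assumes "g > 0" "q \<ge> 0"
  shows "of_real (g ^ 2 * q) powr s = of_real g powr (2 * s) * of_real q powr s"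
proof -
  have "of_real (g ^ 2 * q) powr s = (of_real (g ^ 2) * of_real q) powr s" by simp
  also have "\<dots> = of_real (g ^ 2) powr s * of_real q powr s"
    using assms by (intro powr_times_real) auto
  also have "of_real (g ^ 2) powr s = of_real g powr (2 * s)"
    using assms by (simp add: powr_def Ln_of_real ln_realpow mult_ac flip: of_real_power)
  finally show ?thesis .
qed

text \<open>Every vector is its gcd times a primitive vector, and \<open>Q\<close> is homogeneous of
  degree 2, so the sum over the gcd is the zeta series at 2 s.\<close>

lemma lexpos_has_sum:
  assumes "Re s > 1"
  shows "((\<lambda>p. of_real (Q p) powr (- s)) has_sum (zeta_ser (2 * s) * eis s)) lexpos"
proof -
  let ?f = "\<lambda>p. of_real (Q p) powr (- s) :: complex"
  have sm: "?f summable_on lexpos"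
    using qsum_has_sum[OF assms, of UNIV] by (auto intro: summable_on_subset_banach dest: has_sum_imp_summable)
  have eq: "?f (case x of (g, c, d) \<Rightarrow> (int g * c, int g * d)) = (case x of (g, p) \<Rightarrow> of_real (real g) powr (- (2 * s)) * ?f p)"
    if xin: "x \<in> {0<..} \<times> prim" for x
  proof -
    obtain g c d where x: "x = (g, c, d)" "g > 0" using xin by (cases x) auto
    have "Q (int g * c, int g * d) = real g ^ 2 * Q (c, d)" by (simp add: Q_mult)
    then show ?thesis using powr_of_square_mult[of "real g" "Q (c, d)" "- s"] x by (simp add: Q_def)
  qed
  have "(\<lambda>(g, p). of_real (real g) powr (- (2 * s)) * ?f p) summable_on {0<..} \<times> prim"
    using summable_on_reindex_bij_betw[OF bij_prim, of ?f] sm eq by (simp cong: summable_on_cong)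
  then have "((\<lambda>(g, p). of_real (real g) powr (- (2 * s)) * ?f p) has_sum (zeta_ser (2 * s) * eis s)) ({0<..} \<times> prim)"
  proof (rule has_sum_SigmaI[rotated 2])
    show "((\<lambda>p. case (g, p) of (g, p) \<Rightarrow> of_real (real g) powr (- (2 * s)) * ?f p) has_sum of_real (real g) powr (- (2 * s)) * eis s) prim" for g
      unfolding prod.case by (rule has_sum_cmult_right[OF eis_has_sum[OF assms]])
    show "((\<lambda>g. of_real (real g) powr (- (2 * s)) * eis s) has_sum zeta_ser (2 * s) * eis s) {0<..}"
      by (rule has_sum_cmult_left[OF zeta_ser_has_sum]) (use assms in simp)
  qed
  then show ?thesis
    using has_sum_reindex_bij_betw[OF bij_prim, of ?f] eq by (simp cong: has_sum_cong)
qed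

text \<open>The plane without the origin consists of \<open>lexpos\<close> and its negative; the
  origin contributes 0.\<close>

lemma qsum_plane:
  assumes s: "Re s > 1"
  shows "qsum UNIV s = 2 * zeta_ser (2 * s) * eis s"
proof -
  let ?f = "\<lambda>p. of_real (Q p) powr (- s) :: complex"
  note L = lexpos_has_sum[OF s]
  have bij: "bij_betw (\<lambda>(c, d). (- c, - d)) lexpos {(c, d). (- c, - d) \<in> lexpos}"
    by (rule bij_betwI[of _ _ _ "\<lambda>(c, d). (- c, - d)"]) auto
  have "(?f has_sum (zeta_ser (2 * s) * eis s)) {(c, d). (- c, - d) \<in> lexpos}"
    using has_sum_reindex_bij_betw[OF bij, of ?f] L by (simp add: Q_def case_prod_unfold)
  moreover have disj: "lexpos \<inter> {(c, d). (- c, - d) \<in> lexpos} = {}" by (auto simp: lexpos_def)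
  ultimately have "(?f has_sum (zeta_ser (2 * s) * eis s + zeta_ser (2 * s) * eis s)) (lexpos \<union> {(c, d). (- c, - d) \<in> lexpos})"
    by (intro has_sum_Un_disjoint L)
  then
  have "(?f has_sum (2 * zeta_ser (2 * s) * eis s)) (lexpos \<union> {(c, d). (- c, - d) \<in> lexpos})"
    by (simp add: algebra_simps)
  moreover have "(?f has_sum (2 * zeta_ser (2 * s) * eis s)) (lexpos \<union> {(c, d). (- c, - d) \<in> lexpos})
     \<longleftrightarrow> (?f has_sum (2 * zeta_ser (2 * s) * eis s)) UNIV"
    by (rule has_sum_cong_neutral) (auto simp: lexpos_def Q_def)
  ultimately show ?thesis using qsum_has_sum[OF s, of UNIV] by (simp add: has_sum_unique)
qed

lemma qsum_line:
  assumes s: "Re s > 1"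
  shows "qsum {0} s = 2 * zeta_ser (2 * s)"
proof -
  let ?f = "\<lambda>p. of_real (Q p) powr (- s) :: complex"
  have z: "((\<lambda>n. of_real (real n) powr (- (2 * s))) has_sum zeta_ser (2 * s)) {0<..}"
    by (rule zeta_ser_has_sum) (use s in simp)
  have half: "(?f has_sum zeta_ser (2 * s)) ((\<lambda>n. (\<epsilon> * int n, 0)) ` {0<..})" if "\<epsilon> \<in> {1, -1}" for \<epsilon> :: int
  proof (subst has_sum_reindex)
    show "inj_on (\<lambda>n. (\<epsilon> * int n, 0 :: int)) {0<..}" using that by (auto simp: inj_on_def)
    have "?f (\<epsilon> * int n, 0) = of_real (real n) powr (- (2 * s))" if "n > 0" for n
      using powr_of_square_mult[of "real n" 1 "- s"] that \<open>\<epsilon> \<in> {1, -1}\<close> by (auto simp: Q_def)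
    then show "(?f \<circ> (\<lambda>n. (\<epsilon> * int n, 0)) has_sum zeta_ser (2 * s)) {0<..}"
      using z has_sum_cong[of "{0<..}" "\<lambda>n. ?f (\<epsilon> * int n, 0)" "\<lambda>n. of_real (real n) powr (- (2 * s))"] by (simp add: o_def)
  qed
  have disj: "(\<lambda>n. (1 * int n, 0 :: int)) ` {0<..} \<inter> (\<lambda>n. (-1 * int n, 0)) ` {0<..} = {}" by auto
  have "(?f has_sum (zeta_ser (2 * s) + zeta_ser (2 * s))) ((\<lambda>n. (1 * int n, 0)) ` {0<..} \<union> (\<lambda>n. (-1 * int n, 0)) ` {0<..})"
    by (rule has_sum_Un_disjoint[OF half half disj]) auto
  then have "(?f has_sum (2 * zeta_ser (2 * s))) ((\<lambda>n. (1 * int n, 0)) ` {0<..} \<union> (\<lambda>n. (-1 * int n, 0)) ` {0<..})"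
    by (simp only: mult_2)
  moreover have "(?f has_sum (2 * zeta_ser (2 * s))) ((\<lambda>n. (1 * int n, 0)) ` {0<..} \<union> (\<lambda>n. (-1 * int n, 0)) ` {0<..})
     \<longleftrightarrow> (?f has_sum (2 * zeta_ser (2 * s))) (UNIV \<times> {0})"
  proof (rule has_sum_cong_neutral)
    fix p :: "int \<times> int"
    assume p: "p \<in> UNIV \<times> {0} - ((\<lambda>n. (1 * int n, 0)) ` {0<..} \<union> (\<lambda>n. (-1 * int n, 0)) ` {0<..})"
    obtain x where x: "p = (x, 0)" using p by auto
    have "x = 0"
    proof (rule ccontr)
      assume "x \<noteq> 0"
      have "p \<in> (\<lambda>n. (1 * int n, 0)) ` {0<..} \<union> (\<lambda>n. (-1 * int n, 0)) ` {0<..}"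
      proof (cases "x > 0")
        case True
        then show ?thesis unfolding x by (intro UnI1 image_eqI[of _ _ "nat x"]) auto
      next
        case False
        then show ?thesis using \<open>x \<noteq> 0\<close> unfolding x by (intro UnI2 image_eqI[of _ _ "nat (- x)"]) auto
      qed
      then show False using p by blast
    qed
    then show "?f p = 0" using x by (simp add: Q_def)
  qed auto
  ultimately show ?thesis using qsum_has_sum[OF s, of "{0}"] by (simp add: has_sum_unique)
qed

section \<open>Continuation of zeta, \<open>Lambda\<close> and the Eisenstein series\<close>

lemma zeta_props:
  shows "zeta nicely_meromorphic_on UNIV" "\<And>s. Re s > 1 \<Longrightarrow> zeta s = zeta_ser s"
proof -
  let ?W = "qmero {0} 4"
  have "(\<lambda>s. ?W (s / 2)) meromorphic_on UNIV"
    by (rule meromorphic_on_compose[OF qmero_props(1)]) (auto intro!: analytic_intros)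
  \<comment> \<open>The sum over the line at s / 2 is twice the zeta series at s. It is known to
    agree with \<open>qmero\<close> only where Re (s / 2) > 1, so the comparison is made on Re s > 2
    and extended to Re s > 1 by the identity theorem.\<close>
  then have F: "(\<lambda>s. ?W (s / 2) / 2) meromorphic_on UNIV" by (intro meromorphic_intros)
  have eq: "(\<Sum>n. 1 / of_nat (Suc n) powr s) = zeta_ser s" if "Re s > 1" for s
    using zeta_ser_sums[OF that] by (simp add: sums_iff)
  have f: "(\<lambda>s. \<Sum>n. 1 / of_nat (Suc n) powr s) holomorphic_on {s. Re s > 1}"
    using zeta_ser_holomorphic by (rule holomorphic_transform) (simp only: eq mem_Collect_eq)
  have U: "open {s. Re s > 1}" "connected {s. Re s > 1}" "open {s. Re s > 2}"
    by (auto simp: open_halfspace_Re_gt convex_connected convex_halfspace_Re_gt)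
  have V: "{s. Re s > 2} \<noteq> {}" by (auto intro!: exI[of _ 3])
  have VU: "{s. Re s > 2} \<subseteq> {s. Re s > 1}" by auto
  have Feq: "?W (s / 2) / 2 = (\<Sum>n. 1 / of_nat (Suc n) powr s)" if "s \<in> {s. Re s > 2}" for s
  proof -
    have "?W (s / 2) = qsum {0} (s / 2)" using that by (simp add: qmero_props(2))
    also have "\<dots> = 2 * zeta_ser s" using that by (subst qsum_line) auto
    finally have "?W (s / 2) / 2 = zeta_ser s" by simp
    then show ?thesis using that by (subst eq) auto
  qed
  show "zeta nicely_meromorphic_on UNIV"
    unfolding zeta_def by (rule mero_cont_eqI(1)[OF F f U(1,2) U(3) V VU Feq])
  show "zeta s = zeta_ser s" if "Re s > 1" for s
    unfolding zeta_def using mero_cont_eqI(2)[OF F f U(1,2) U(3) V VU Feq, of s] eq that by simp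
qed

lemma Lambda_meromorphic: "Lambda meromorphic_on UNIV"
proof -
  have "zeta meromorphic_on UNIV" using zeta_props(1) by (simp add: nicely_meromorphic_on_def)
  moreover have "(\<lambda>s :: complex. of_real pi powr (- s / 2)) meromorphic_on UNIV"
    by (intro analytic_on_imp_meromorphic_on) (auto intro!: holomorphic_intros simp: analytic_on_open)
  moreover have "(\<lambda>s. inverse (rGamma (s / 2)) :: complex) meromorphic_on UNIV"
    by (intro meromorphic_on_inverse analytic_on_imp_meromorphic_on) (auto intro!: holomorphic_intros simp: analytic_on_open)
  then have "(\<lambda>s. Gamma (s / 2) :: complex) meromorphic_on UNIV" by (simp add: rGamma_inverse_Gamma)
  ultimately show ?thesis
    unfolding Lambda_def by (intro meromorphic_intros)
qed

lemma Lambda_eq_and_holomorphic: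
  shows Lambda_eq: "\<And>s. Re s > 1 \<Longrightarrow> Lambda s = of_real pi powr (- s / 2) * Gamma (s / 2) * zeta_ser s"
    and Lambda_holomorphic: "Lambda holomorphic_on {s. Re s > 1}"
proof -
  have hol: "(\<lambda>s. of_real pi powr (- s / 2) * Gamma (s / 2) * zeta_ser s) holomorphic_on {s. Re s > 1}"
  proof (intro holomorphic_intros zeta_ser_holomorphic)
    fix z :: complex assume "z \<in> {s. Re s > 1}"
    then have "Re (z / 2) > 0" by simp
    then show "z / 2 \<notin> \<int>\<^sub>\<le>\<^sub>0" by (auto elim!: nonpos_Ints_cases)
  qed auto
  then have "(\<lambda>s. of_real pi powr (- s / 2) * Gamma (s / 2) * zeta s) holomorphic_on {s. Re s > 1}"
    by (rule holomorphic_transform) (simp add: zeta_props(2))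
  then have "(\<lambda>s. of_real pi powr (- s / 2) * Gamma (s / 2) * zeta s) analytic_on {s}" if "Re s > 1" for s
    using that by (intro holomorphic_on_imp_analytic_at[OF _ open_halfspace_Re_gt[of 1]]) auto
  then show eq: "Lambda s = of_real pi powr (- s / 2) * Gamma (s / 2) * zeta_ser s" if "Re s > 1" for s
    unfolding Lambda_def using that by (simp add: zeta_props(2))
  show "Lambda holomorphic_on {s. Re s > 1}"
    using hol by (rule holomorphic_transform) (simp add: eq)
qed

text \<open>The sums over the plane and over the line share the factor 2 \<zeta>(2s), so the
  quotient of their continuations continues \<open>eis\<close>. The function f is left open so that
  the lemma fits the series over cosets in \<open>eisenstein_e\<close>.\<close>

lemma mero_cont_eis:
  assumes f: "\<And>s. Re s > 1 / 2 \<Longrightarrow> f s = eis (s + 1 / 2)"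
  shows "mero_cont {s. Re s > 1 / 2} f nicely_meromorphic_on UNIV"
    "\<And>s. Re s > 1 / 2 \<Longrightarrow> mero_cont {s. Re s > 1 / 2} f s = eis (s + 1 / 2)"
proof -
  let ?U = "{s. Re s > 1 / 2}"
  let ?W = "qmero"
  have "(\<lambda>s. ?W {0} 4 (s + 1 / 2)) meromorphic_on UNIV" "(\<lambda>s. ?W UNIV 2 (s + 1 / 2)) meromorphic_on UNIV"
    by (rule meromorphic_on_compose[OF qmero_props(1)]; auto intro!: analytic_intros)+
  then have F: "(\<lambda>s. ?W UNIV 2 (s + 1 / 2) / ?W {0} 4 (s + 1 / 2)) meromorphic_on UNIV" by (intro meromorphic_intros)
  have "(eis \<circ> (\<lambda>s. s + 1 / 2)) holomorphic_on ?U"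
    by (rule holomorphic_on_compose_gen[OF _ eis_holomorphic]) (auto intro!: holomorphic_intros)
  then have hf: "f holomorphic_on ?U" by (rule holomorphic_transform) (simp add: f)
  have U: "open ?U" "connected ?U" "?U \<noteq> {}"
    using open_halfspace_Re_gt[of "1 / 2"] convex_connected[OF convex_halfspace_Re_gt[of "1 / 2"]] by (auto intro!: exI[of _ 1])
  have Feq: "?W UNIV 2 (s + 1 / 2) / ?W {0} 4 (s + 1 / 2) = f s" if "s \<in> ?U" for s
  proof -
    have s: "Re (s + 1 / 2) > 1" using that by simp
    have "?W UNIV 2 (s + 1 / 2) = qsum UNIV (s + 1 / 2)" "?W {0} 4 (s + 1 / 2) = qsum {0} (s + 1 / 2)"
      using s by (simp_all add: qmero_props(2))
    moreover have "zeta_ser (2 * (s + 1 / 2)) \<noteq> 0"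
      by (rule zeta_ser_nonzero) (use s in simp)
    ultimately show ?thesis using that by (simp only: f qsum_plane[OF s] qsum_line[OF s] mem_Collect_eq) simp
  qed
  show "mero_cont ?U f nicely_meromorphic_on UNIV"
    by (rule mero_cont_eqI(1)[OF F hf U(1,2) U(1,3) subset_refl Feq])
  show "mero_cont ?U f s = eis (s + 1 / 2)" if "Re s > 1 / 2" for s
    using mero_cont_eqI(2)[OF F hf U(1,2) U(1,3) subset_refl Feq, of s] f that by simp
qed

section \<open>Lattice sums and plane integrals\<close>

text \<open>Stands in for polar coordinates: the disc of radius sqrt a has area pi a, so the image
  of planar Lebesgue measure under the squared norm is pi times Lebesgue measure on the positive
  half-line. The half-lines ending at a form a generating system stable under intersection.\<close>

lemma distr_norm_square:
  "distr lborel borel (\<lambda>z :: real \<times> real. norm z ^ 2) = density lborel (\<lambda>t. ennreal pi * indicator {0<..} t)"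
proof (rule measure_eqI_generator_eq[where \<Omega> = UNIV and E = "range atMost" and A = "\<lambda>n. {..real n}"])
  have [measurable]: "(\<lambda>z :: real \<times> real. norm z ^ 2) \<in> borel_measurable lborel" by measurable
  have D: "emeasure (distr lborel borel (\<lambda>z :: real \<times> real. norm z ^ 2)) {..a} = ennreal pi * ennreal a" for a :: real
  proof -
    have "emeasure (distr lborel borel (\<lambda>z :: real \<times> real. norm z ^ 2)) {..a}
        = emeasure lborel ((\<lambda>z :: real \<times> real. norm z ^ 2) -` {..a} \<inter> space lborel)"
      by (rule emeasure_distr) auto
    also have "(\<lambda>z :: real \<times> real. norm z ^ 2) -` {..a} \<inter> space lborel = (if a \<ge> 0 then cball 0 (sqrt a) else {})"
    proof -
      have "norm z ^ 2 \<le> a \<longleftrightarrow> norm z \<le> sqrt a" for z :: "real \<times> real"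
        using real_sqrt_le_iff[of "norm z ^ 2" a] by simp
      moreover have "\<not> norm z \<le> sqrt a" if "a < 0" for z :: "real \<times> real"
        using that real_sqrt_lt_0_iff[of a] norm_ge_zero[of z] by linarith
      ultimately show ?thesis by auto
    qed
    also have "emeasure lborel \<dots> = ennreal pi * ennreal a"
      by (auto simp: emeasure_cball unit_ball_vol_2 ennreal_mult'[symmetric] ennreal_neg mult_nonneg_nonpos)
    finally show ?thesis .
  qed
  have N: "emeasure (density lborel (\<lambda>t. ennreal pi * indicator {0<..} t)) {..a} = ennreal pi * ennreal a" for a :: real
  proof -
    have "emeasure (density lborel (\<lambda>t. ennreal pi * indicator {0<..} t)) {..a}
        = (\<integral>\<^sup>+ t. ennreal pi * indicator {0<..} t * indicator {..a} t \<partial>lborel)"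
      by (rule emeasure_density) auto
    also have "\<dots> = (\<integral>\<^sup>+ t. ennreal pi * indicator {0<..a} t \<partial>lborel)"
      by (rule nn_integral_cong) (auto simp: indicator_def)
    also have "\<dots> = ennreal pi * emeasure lborel {0<..a}" by (rule nn_integral_cmult_indicator) auto
    also have "emeasure lborel {0<..a} = ennreal a" by (cases "a \<ge> 0") (auto simp: ennreal_neg)
    finally show ?thesis .
  qed
  show "emeasure (distr lborel borel (\<lambda>z :: real \<times> real. norm z ^ 2)) X
      = emeasure (density lborel (\<lambda>t. ennreal pi * indicator {0<..} t)) X" if "X \<in> range atMost" for X
    using that D N by auto
  show "Int_stable (range (atMost :: real \<Rightarrow> _))"
    by (auto simp: Int_stable_def min_def intro!: image_eqI)
  show "(\<Union>n. {..real n}) = UNIV" using real_arch_simple by auto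
  show "emeasure (distr lborel borel (\<lambda>z :: real \<times> real. norm z ^ 2)) {..real i} \<noteq> \<infinity>" for i
    using D by (simp add: ennreal_mult'[symmetric])
qed (auto simp: borel_eq_atMost intro!: sets_measure_of)

text \<open>The nonnegative real case yields integrability together with the value; it then serves
  as the majorant that makes the complex integrand integrable.\<close>

lemma powr_tail_integral_real:
  fixes \<sigma> R :: real
  assumes "\<sigma> > 1" "R > 0"
  shows "set_integrable lborel {0<..} (\<lambda>t. (t + R) powr (- \<sigma>))"
    "(LBINT t:{0<..}. (t + R) powr (- \<sigma>)) = R powr (1 - \<sigma>) / (\<sigma> - 1)"
proof -
  let ?F = "\<lambda>t. (t + R) powr (1 - \<sigma>) / (1 - \<sigma>)"
  have ei: "einterval 0 \<infinity> = {0<..}" by (auto simp: einterval_def)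
  have 1: "((?F \<circ> real_of_ereal) \<longlongrightarrow> R powr (1 - \<sigma>) / (1 - \<sigma>)) (at_right 0)"
  proof -
    have "(?F \<longlongrightarrow> (0 + R) powr (1 - \<sigma>) / (1 - \<sigma>)) (at_right 0)"
      using assms by (intro tendsto_intros) auto
    then show ?thesis by (simp add: zero_ereal_def ereal_tendsto_simps)
  qed
  have 2: "((?F \<circ> real_of_ereal) \<longlongrightarrow> 0) (at_left \<infinity>)"
  proof -
    have "filterlim (\<lambda>t. t + R) at_top at_top"
      using filterlim_tendsto_add_at_top[OF tendsto_const filterlim_ident, of R] by (simp add: add.commute)
    then have "((\<lambda>t. (t + R) powr (1 - \<sigma>)) \<longlongrightarrow> 0) at_top"
      using assms by (intro tendsto_neg_powr) auto
    then have "(?F \<longlongrightarrow> 0 / (1 - \<sigma>)) at_top" using assms by (intro tendsto_divide tendsto_const) auto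
    then show ?thesis by (simp add: ereal_tendsto_simps)
  qed
  have D: "DERIV ?F x :> (x + R) powr (- \<sigma>)" if "0 < ereal x" for x
    using that assms by (auto intro!: derivative_eq_intros simp: zero_ereal_def)
  have C: "isCont (\<lambda>t. (t + R) powr (- \<sigma>)) x" if "0 < ereal x" for x
    using that assms by (intro continuous_intros) (auto simp: zero_ereal_def)
  note FTC = interval_integral_FTC_nonneg[of 0 \<infinity> ?F "\<lambda>t. (t + R) powr (- \<sigma>)", OF _ D C _ 1 2]
  show "set_integrable lborel {0<..} (\<lambda>t. (t + R) powr (- \<sigma>))"
    using FTC(1) by (simp add: ei)
  show "(LBINT t:{0<..}. (t + R) powr (- \<sigma>)) = R powr (1 - \<sigma>) / (\<sigma> - 1)"
    using FTC(2) assms by (simp add: interval_lebesgue_integral_def ei field_simps)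
qed

lemma powr_tail_integral:
  fixes s :: complex and R :: real
  assumes s: "Re s > 1" and R: "R > 0"
  shows "set_integrable lborel {0<..} (\<lambda>t. of_real (t + R) powr (- s) :: complex)"
    "(LBINT t:{0<..}. of_real (t + R) powr (- s) :: complex) = of_real R powr (1 - s) / (s - 1)"
proof -
  let ?f = "\<lambda>t. of_real (t + R) powr (- s) :: complex"
  let ?F = "\<lambda>t. of_real (t + R) powr (1 - s) / (1 - s) :: complex"
  have s1: "s \<noteq> 1" using s by auto
  have ei: "einterval 0 \<infinity> = {0<..}" by (auto simp: einterval_def)
  have D: "(?F has_vector_derivative ?f x) (at x)" if "0 < ereal x" for x
  proof -
    have x: "x + R > 0" using that R by (simp add: zero_ereal_def)
    then have xr: "of_real (x + R) \<notin> (\<real>\<^sub>\<le>\<^sub>0 :: complex set)" by (simp only: complex_nonpos_Reals_iff) simp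
    have "((\<lambda>z. z powr (1 - s) / (1 - s)) has_field_derivative (1 - s) * of_real (x + R) powr (1 - s - 1) / (1 - s)) (at (of_real (x + R)))"
      using xr s1 by (intro derivative_eq_intros) auto
    then have d: "((\<lambda>z. z powr (1 - s) / (1 - s)) has_field_derivative of_real (x + R) powr (- s)) (at (of_real (x + R)))"
      using s1 by simp
    have "((\<lambda>t. of_real (t + R)) has_vector_derivative (1 :: complex)) (at x)"
      by (auto intro!: derivative_eq_intros has_vector_derivative_of_real simp: )
    from field_vector_diff_chain_at[OF this d] show ?thesis by (simp add: o_def)
  qed
  have C: "isCont ?f x" if "0 < ereal x" for x
  proof -
    have x: "x + R > 0" using that R by (simp add: zero_ereal_def)
    then have xr: "of_real (x + R) \<notin> (\<real>\<^sub>\<le>\<^sub>0 :: complex set)" by (simp only: complex_nonpos_Reals_iff) simp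
    then show ?thesis by (intro continuous_intros) auto
  qed
  have nrm: "norm (of_real (t + R) powr z :: complex) = (t + R) powr Re z" if "t \<ge> 0" for t z
    using that R by (subst norm_powr_real_powr) auto
  have meas: "set_borel_measurable lborel {0<..} ?f"
    unfolding set_borel_measurable_def
    using borel_measurable_continuous_on_indicator[of "{0<..}" ?f] continuous_at_imp_continuous_on[of "{0<..}" ?f] C
    by (simp add: zero_ereal_def)
  show I: "set_integrable lborel {0<..} ?f"
  proof (rule set_integrable_bound[OF powr_tail_integral_real(1)[OF s R] meas])
    show "AE t in lborel. t \<in> {0<..} \<longrightarrow> norm (?f t) \<le> norm ((t + R) powr (- Re s))"
      by (intro AE_I2 impI) (subst nrm, auto)
  qed
  have 1: "((?F \<circ> real_of_ereal) \<longlongrightarrow> of_real R powr (1 - s) / (1 - s)) (at_right 0)"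
  proof -
    have xr: "of_real R \<notin> (\<real>\<^sub>\<le>\<^sub>0 :: complex set)" using R by (simp only: complex_nonpos_Reals_iff) simp
    have "(?F \<longlongrightarrow> of_real (0 + R) powr (1 - s) / (1 - s)) (at_right 0)"
      using s1 xr by (intro tendsto_intros) auto
    then show ?thesis by (simp add: zero_ereal_def ereal_tendsto_simps)
  qed
  have 2: "((?F \<circ> real_of_ereal) \<longlongrightarrow> 0) (at_left \<infinity>)"
  proof -
    have "filterlim (\<lambda>t. t + R) at_top at_top"
      using filterlim_tendsto_add_at_top[OF tendsto_const filterlim_ident, of R] by (simp add: add.commute)
    then have "((\<lambda>t. (t + R) powr (1 - Re s)) \<longlongrightarrow> 0) at_top"
      using s by (intro tendsto_neg_powr) auto
    then have "((\<lambda>t. of_real (t + R) powr (1 - s) :: complex) \<longlongrightarrow> 0) at_top"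
    proof (rule Lim_null_comparison[rotated])
      show "\<forall>\<^sub>F t in at_top. norm (of_real (t + R) powr (1 - s) :: complex) \<le> (t + R) powr (1 - Re s)"
        using eventually_ge_at_top[of 0] by eventually_elim (subst nrm, auto)
    qed
    then have "(?F \<longlongrightarrow> 0 / (1 - s)) at_top" using s1 by (intro tendsto_divide tendsto_const) auto
    then show ?thesis by (simp add: ereal_tendsto_simps)
  qed
  have I': "set_integrable lborel (einterval 0 \<infinity>) ?f" using I by (simp add: ei)
  have "(LBINT t=0..\<infinity>. ?f t) = 0 - of_real R powr (1 - s) / (1 - s)"
    by (rule interval_integral_FTC_integrable[OF _ D C I' 1 2]) auto
  then show "(LBINT t:{0<..}. ?f t) = of_real R powr (1 - s) / (s - 1)"
    using minus_divide_right[of "of_real R powr (1 - s)" "1 - s"] by (simp add: interval_lebesgue_integral_def ei)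
qed

lemma plane_integral:
  fixes s :: complex and R :: real
  assumes s: "Re s > 1" and R: "R > 0"
  shows "integrable lborel (\<lambda>z :: real \<times> real. of_real (norm z ^ 2 + R) powr (- s) :: complex)"
    "(\<integral>z. of_real (norm z ^ 2 + R) powr (- s) \<partial>(lborel :: (real \<times> real) measure)) = (of_real pi / (s - 1) * of_real R powr (1 - s) :: complex)"
proof -
  let ?f = "\<lambda>t. of_real (t + R) powr (- s) :: complex"
  \<comment> \<open>Cutting the integrand off at negative t makes it Borel measurable by its
    continuity on the closed half-line. Squared norms never leave that half-line, so nothing changes
    after substitution.\<close>
  let ?g = "\<lambda>t. indicator {0..} t *\<^sub>R ?f t"
  let ?D = "density lborel (\<lambda>t :: real. ennreal pi * indicator {0<..} t)"
  have cont: "continuous_on {0..} ?f"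
  proof (intro continuous_at_imp_continuous_on ballI)
    fix t :: real assume "t \<in> {0..}"
    then have "t + R > 0" using R by simp
    then have xr: "of_real (t + R) \<notin> (\<real>\<^sub>\<le>\<^sub>0 :: complex set)" by (simp only: complex_nonpos_Reals_iff) simp
    then show "isCont ?f t" by (intro continuous_intros) auto
  qed
  have gm[measurable]: "?g \<in> borel_measurable borel"
    by (rule borel_measurable_continuous_on_indicator[OF _ cont]) auto
  have eq: "(\<lambda>t. (pi * indicator {0<..} t) *\<^sub>R ?g t) = (\<lambda>t. pi *\<^sub>R (indicator {0<..} t *\<^sub>R ?f t))"
    by (auto simp: indicator_def)
  have De: "?D = density lborel (\<lambda>t. ennreal (pi * indicator {0<..} t))"
    by (rule arg_cong[of _ _ "density lborel"]) (auto simp: indicator_def)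
  have ID: "integrable ?D ?g"
  proof -
    have "integrable lborel (\<lambda>t. (pi * indicator {0<..} t) *\<^sub>R ?g t)"
      unfolding eq by (rule integrable_scaleR_right[OF powr_tail_integral(1)[OF s R, unfolded set_integrable_def]])
    then show ?thesis unfolding De by (subst integrable_density) auto
  qed
  have VD: "integral\<^sup>L ?D ?g = of_real pi / (s - 1) * of_real R powr (1 - s)"
  proof -
    have "integral\<^sup>L ?D ?g = (\<integral>t. (pi * indicator {0<..} t) *\<^sub>R ?g t \<partial>lborel)"
      unfolding De by (rule integral_density) auto
    also have "\<dots> = pi *\<^sub>R (LBINT t:{0<..}. ?f t)" unfolding eq set_lebesgue_integral_def by (rule integral_scaleR_right)
    finally show ?thesis using powr_tail_integral(2)[OF s R] by (simp add: scaleR_conv_of_real)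
  qed
  have h: "(\<lambda>z :: real \<times> real. ?g (norm z ^ 2)) = (\<lambda>z. ?f (norm z ^ 2))" by (auto simp: indicator_def)
  have nm: "(\<lambda>z :: real \<times> real. norm z ^ 2) \<in> measurable lborel borel" by measurable
  show "integrable lborel (\<lambda>z :: real \<times> real. ?f (norm z ^ 2))"
    using ID unfolding distr_norm_square[symmetric] by (subst (asm) integrable_distr_eq[OF nm gm]) (simp only: h)
  show "(\<integral>z. ?f (norm z ^ 2) \<partial>(lborel :: (real \<times> real) measure)) = of_real pi / (s - 1) * of_real R powr (1 - s)"
    using VD unfolding distr_norm_square[symmetric] by (subst (asm) integral_distr[OF nm gm]) (simp only: h)
qed

section \<open>Lattice sums as integrals of step functions\<close>

definition fl :: "real \<times> real \<Rightarrow> int \<times> int" where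
  "fl z = (\<lfloor>fst z\<rfloor>, \<lfloor>snd z\<rfloor>)"

lemma fl_measurable [measurable]: "fl \<in> measurable lborel (count_space UNIV)"
proof -
  have "fl \<in> borel \<Otimes>\<^sub>M borel \<rightarrow>\<^sub>M count_space UNIV \<Otimes>\<^sub>M count_space UNIV"
    unfolding fl_def by measurable
  moreover have "(count_space UNIV :: int measure) \<Otimes>\<^sub>M (count_space UNIV :: int measure) = count_space UNIV"
    by (subst pair_measure_countable) auto
  ultimately show ?thesis by (simp add: borel_prod)
qed

text \<open>The points with a given corner under \<open>fl\<close> form a square of area 1. A sum
  over the lattice is therefore the integral of a step function over the plane and can be compared
  with \<open>plane_integral\<close> point by point.\<close>

lemma distr_fl: "distr lborel (count_space UNIV) fl = count_space UNIV"
proof (rule measure_eqI_countable)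
  fix v :: "int \<times> int"
  obtain a b where v: "v = (a, b)" by (cases v)
  have "fl -` {v} \<inter> space lborel = {of_int a..<of_int a + 1} \<times> {of_int b..<of_int b + 1}"
    by (auto simp: v fl_def floor_eq_iff)
  moreover have "emeasure lborel ({real_of_int a..<of_int a + 1} \<times> {real_of_int b..<of_int b + 1}) = 1"
    by (subst lborel_prod[symmetric], subst lborel.emeasure_pair_measure_Times) auto
  ultimately show "emeasure (distr lborel (count_space UNIV) fl) {v} = emeasure (count_space UNIV) {v}"
    by (subst emeasure_distr) auto
qed auto

definition lat :: "complex \<Rightarrow> real \<Rightarrow> complex" where
  "lat s R = (\<Sum>\<^sub>\<infinity>v. of_real (Q v + R) powr (- s))"

lemma Q_nonneg: "Q v \<ge> 0" by (simp add: Q_def)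

lemma lat_summable:
  fixes \<sigma> R :: real
  assumes "\<sigma> > 1" "R \<ge> 1"
  shows "(\<lambda>v. (Q v + R) powr (- \<sigma>)) summable_on A"
proof -
  have "(\<lambda>(x, y). (of_int x ^ 2 + of_int y ^ 2 + 1) powr (- \<sigma>)) summable_on (UNIV :: (int \<times> int) set)"
    by (rule summable_on_lattice[OF assms(1)])
  then have "(\<lambda>v. (Q v + 1) powr (- \<sigma>)) summable_on UNIV" by (simp add: Q_def case_prod_unfold)
  then have "(\<lambda>v. (Q v + R) powr (- \<sigma>)) summable_on UNIV"
  proof (rule summable_on_comparison_test)
    show "(Q v + R) powr (- \<sigma>) \<le> (Q v + 1) powr (- \<sigma>)" for v
      using assms Q_nonneg[of v] by (intro powr_mono2') auto
  qed auto
  then show ?thesis by (rule summable_on_subset_banach) auto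
qed

lemma lat_has_sum:
  assumes "Re s > 1" "R \<ge> 1"
  shows "((\<lambda>v. of_real (Q v + R) powr (- s)) has_sum lat s R) UNIV"
proof -
  have pos: "Q v + R > 0" for v using Q_nonneg[of v] assms by linarith
  have "(\<lambda>v. norm (of_real (Q v + R) powr (- s) :: complex)) summable_on UNIV"
    by (rule dirichlet_summable) (use pos lat_summable[OF assms] in auto)
  then show ?thesis unfolding lat_def by (rule has_sum_infsum[OF abs_summable_summable])
qed

lemma lat_holomorphic:
  assumes "R \<ge> 1"
  shows "(\<lambda>s. lat s R) holomorphic_on {s. Re s > 1}"
  unfolding lat_def
proof (rule dirichlet_holomorphic)
  show "1 \<le> Q i + R" for i using assms Q_nonneg[of i] by linarith
qed (rule lat_summable[OF _ assms])

lemma lat_integral: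
  assumes "Re s > 1" "R \<ge> 1"
  shows "integrable lborel (\<lambda>z. of_real (Q (fl z) + R) powr (- s) :: complex)"
    "(\<integral>z. of_real (Q (fl z) + R) powr (- s) \<partial>lborel) = lat s R"
proof -
  let ?h = "\<lambda>v. of_real (Q v + R) powr (- s) :: complex"
  have "?h summable_on UNIV" using lat_has_sum[OF assms] by (rule has_sum_imp_summable)
  then have "Infinite_Sum.abs_summable_on ?h UNIV" by (rule summable_on_iff_abs_summable_on_complex[THEN iffD1])
  then have ab: "Infinite_Set_Sum.abs_summable_on ?h UNIV" by (rule abs_summable_equivalent[THEN iffD1])
  then have I: "integrable (count_space UNIV) ?h" unfolding Infinite_Set_Sum.abs_summable_on_def .
  have V: "integral\<^sup>L (count_space UNIV) ?h = lat s R"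
    using infsetsum_infsum[OF ab] unfolding infsetsum_def lat_def .
  show "integrable lborel (\<lambda>z. ?h (fl z))"
    using I integrable_distr_eq[OF fl_measurable, of ?h] by (simp only: distr_fl) simp
  show "(\<integral>z. ?h (fl z) \<partial>lborel) = lat s R"
    using V integral_distr[OF fl_measurable, of ?h] by (simp only: distr_fl) simp
qed

text \<open>Mean value inequality on the real ray from m: the derivative of z powr (- s) has modulus
  norm s times t powr (- Re s - 1), which is largest at t = m.\<close>

lemma norm_powr_diff_le:
  fixes A B m :: real and s :: complex
  assumes m: "0 < m" "m \<le> A" "m \<le> B" and s: "Re s > 0"
  shows "norm (of_real A powr (- s) - of_real B powr (- s) :: complex) \<le> norm s * m powr (- Re s - 1) * \<bar>A - B\<bar>"
proof -
  have "norm (of_real A powr (- s) - of_real B powr (- s) :: complex)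
      \<le> (norm s * m powr (- Re s - 1)) * norm (of_real A - of_real B :: complex)"
  proof (rule field_differentiable_bound)
    fix z :: complex assume "z \<in> of_real ` {m..}"
    then obtain t where t: "z = of_real t" "t \<ge> m" by auto
    then have "z \<notin> \<real>\<^sub>\<le>\<^sub>0" using m by auto
    then show "((\<lambda>z. z powr (- s)) has_field_derivative (- s) * z powr (- s - 1)) (at z within of_real ` {m..})"
      by (auto intro!: derivative_eq_intros)
    have "norm (z powr (- s - 1)) = t powr (- Re s - 1)"
      using t m by (simp only: t(1)) (subst norm_powr_real_powr, auto)
    also have "\<dots> \<le> m powr (- Re s - 1)" using t m s by (intro powr_mono2') auto
    finally show "norm ((- s) * z powr (- s - 1)) \<le> norm s * m powr (- Re s - 1)"
      by (simp add: norm_mult mult_left_mono)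
  next
    show "convex (complex_of_real ` {m..})"
      by (rule convex_linear_image) (auto intro: bounded_linear.linear bounded_linear_of_real)
  qed (use m in auto)
  also have "norm (of_real A - of_real B :: complex) = \<bar>A - B\<bar>"
    by (metis norm_of_real of_real_diff)
  finally show ?thesis .
qed

text \<open>The corner differs from z by at most 1 in each coordinate, so the norms p and q of the
  corner and of z differ by at most 2. Then q^2 \<le> 2 p^2 + 8 and R \<ge> 1 give B \<le> 9 A, and
  conversely p \<le> 3 sqrt B. The factor 8 is 2 (3 + 1), from A - B = (p - q) (p + q).\<close>

lemma fl_compare:
  fixes z :: "real \<times> real" and R :: real
  assumes R: "R \<ge> 1"
  defines "A \<equiv> Q (fl z) + R" and "B \<equiv> norm z ^ 2 + R"
  shows "B / 9 \<le> A" "\<bar>A - B\<bar> \<le> 8 * sqrt B" "B \<ge> 1"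
proof -
  obtain x y where z: "z = (x, y)" by (cases z)
  define a b where "a = real_of_int \<lfloor>x\<rfloor>" and "b = real_of_int \<lfloor>y\<rfloor>"
  define p where "p = norm (a, b)"
  define q where "q = norm (x, y)"
  have Bq: "B = q ^ 2 + R" by (simp add: B_def q_def z)
  have Ap: "A = p ^ 2 + R"
    by (simp add: A_def p_def Q_def fl_def z a_def b_def norm_Pair)
  have "\<bar>a - x\<bar> \<le> 1" "\<bar>b - y\<bar> \<le> 1" unfolding a_def b_def by linarith+
  then have "norm ((a, b) - (x, y)) \<le> 2"
    using norm_Pair_le[of "a - x" "b - y"] by (simp add: real_norm_def)
  then have pq: "\<bar>p - q\<bar> \<le> 2" unfolding p_def q_def using norm_triangle_ineq3[of "(a, b)" "(x, y)"] by linarith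
  have p0: "p \<ge> 0" and q0: "q \<ge> 0" by (auto simp: p_def q_def)
  show B1: "B \<ge> 1" using R zero_le_power2[of q] unfolding Bq by linarith
  have sq: "(u + 2) ^ 2 \<le> 2 * u ^ 2 + 8" for u :: real
    using zero_le_power2[of "u - 2"] by (simp add: power2_eq_square algebra_simps)
  have "q ^ 2 \<le> (p + 2) ^ 2" using pq q0 by (intro power_mono) auto
  then have "q ^ 2 \<le> 2 * p ^ 2 + 8" using sq[of p] by linarith
  moreover have "(v + R) / 9 \<le> u + R" if "v \<le> 2 * u + 8" "0 \<le> u" for u v
    using that R by (simp add: field_simps)
  ultimately show "B / 9 \<le> A" unfolding Ap Bq by simp
  have "p ^ 2 \<le> (q + 2) ^ 2" using pq p0 by (intro power_mono) auto
  then have "p ^ 2 \<le> 2 * q ^ 2 + 8" using sq[of q] by linarith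
  moreover have "v \<le> 9 * (u + R)" if "v \<le> 2 * u + 8" "0 \<le> u" for u v
    using that R by (simp add: field_simps)
  ultimately have "p ^ 2 \<le> 9 * B" unfolding Bq by simp
  then have "p \<le> sqrt (9 * B)" by (rule real_le_rsqrt)
  then have p3: "p \<le> 3 * sqrt B" by (simp add: real_sqrt_mult)
  have q1: "q \<le> sqrt B" using R by (intro real_le_rsqrt) (simp add: Bq)
  have "\<bar>A - B\<bar> = \<bar>p - q\<bar> * (p + q)"
  proof -
    have "A - B = (p - q) * (p + q)" by (simp add: Ap Bq power2_eq_square algebra_simps)
    then show ?thesis using p0 q0 by (simp add: abs_mult)
  qed
  also have "\<dots> \<le> 2 * (3 * sqrt B + sqrt B)" using pq p3 q1 p0 q0 by (intro mult_mono) auto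
  finally show "\<bar>A - B\<bar> \<le> 8 * sqrt B" by simp
qed

text \<open>By the mean value inequality the two integrands differ by at most a constant times B
  powr (- Re s - 1) times sqrt B. This is once more an integrand of \<open>plane_integral\<close>,
  now with exponent Re s + 1/2, which produces the power 1/2 - Re s of R. The factors 8 and 9 come
  from \<open>fl_compare\<close>.\<close>

lemma lat_asymp:
  assumes s: "Re s > 1" and R: "R \<ge> 1"
  shows "norm (lat s R - of_real pi / (s - 1) * of_real R powr (1 - s))
    \<le> norm s * 8 * 9 powr (Re s + 1) * (pi / (Re s - 1 / 2)) * R powr (1 / 2 - Re s)"
proof -
  let ?f = "\<lambda>z :: real \<times> real. of_real (Q (fl z) + R) powr (- s) :: complex"
  let ?g = "\<lambda>z :: real \<times> real. of_real (norm z ^ 2 + R) powr (- s) :: complex"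
  let ?C = "norm s * 8 * 9 powr (Re s + 1)"
  let ?h = "\<lambda>z :: real \<times> real. of_real (norm z ^ 2 + R) powr (- of_real (Re s + 1 / 2)) :: complex"
  have R0: "R > 0" using R by simp
  note f = lat_integral[OF s R] and g = plane_integral[OF s R0]
  have s': "Re (of_real (Re s + 1 / 2) :: complex) > 1" using s by simp
  note h = plane_integral[OF s' R0]
  have hr: "?h z = of_real ((norm z ^ 2 + R) powr (- (Re s + 1 / 2)))" for z
    using fl_compare(3)[OF R, of z] by (subst powr_of_real[symmetric]) auto
  have bd: "norm (?f z - ?g z) \<le> ?C * norm (?h z)" for z
  proof -
    let ?B = "norm z ^ 2 + R"
    note c = fl_compare[OF R, of z]
    have B: "?B > 0" using c(3) by linarith
    have "norm (?f z - ?g z) \<le> norm s * (?B / 9) powr (- Re s - 1) * \<bar>Q (fl z) + R - ?B\<bar>"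
      using c B s by (intro norm_powr_diff_le) auto
    also have "\<dots> \<le> norm s * (?B / 9) powr (- Re s - 1) * (8 * sqrt ?B)"
      using c(2) by (intro mult_left_mono) auto
    also have "(?B / 9) powr (- Re s - 1) = 9 powr (Re s + 1) * ?B powr (- Re s - 1)"
      using B by (simp add: powr_divide powr_diff powr_minus powr_add field_simps)
    also have "sqrt ?B = ?B powr (1 / 2)" using B by (simp add: powr_half_sqrt)
    also have "norm s * (9 powr (Re s + 1) * ?B powr (- Re s - 1)) * (8 * ?B powr (1 / 2))
        = ?C * (?B powr (- Re s - 1) * ?B powr (1 / 2))" by simp
    also have "?B powr (- Re s - 1) * ?B powr (1 / 2) = ?B powr (- (Re s + 1 / 2))"
      unfolding powr_add[symmetric] by (rule arg_cong[of _ _ "(powr) _"]) simp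
    finally show ?thesis unfolding hr by simp
  qed
  have "lat s R - of_real pi / (s - 1) * of_real R powr (1 - s) = (\<integral>z. ?f z - ?g z \<partial>lborel)"
    using f g by simp
  then have "norm (lat s R - of_real pi / (s - 1) * of_real R powr (1 - s)) \<le> (\<integral>z. norm (?f z - ?g z) \<partial>lborel)"
    by (simp only:) (rule integral_norm_bound)
  also have "\<dots> \<le> (\<integral>z. ?C * norm (?h z) \<partial>lborel)"
    by (intro integral_mono integrable_norm integrable_mult_right Bochner_Integration.integrable_diff f(1) g(1) h(1) bd)
  also have "\<dots> = ?C * (\<integral>z. norm (?h z) \<partial>lborel)" by simp
  also have "(\<integral>z. norm (?h z) \<partial>lborel) = pi / (Re s - 1 / 2) * R powr (1 / 2 - Re s)"
  proof -
    have "of_real (\<integral>z. (norm (z :: real \<times> real) ^ 2 + R) powr (- (Re s + 1 / 2)) \<partial>lborel) = (\<integral>z. ?h z \<partial>lborel)"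
      unfolding hr by simp
    also have "\<dots> = of_real (pi / (Re s - 1 / 2) * R powr (1 / 2 - Re s))"
      unfolding h(2) using powr_of_real[of R "1 / 2 - Re s"] R0 by simp
    finally show ?thesis unfolding hr by (simp only: of_real_eq_iff) simp
  qed
  finally show ?thesis by (simp add: mult_ac)
qed

section \<open>Absolute values and the Eisenstein series\<close>

text \<open>Otherwise every matrix entry has several parses.\<close>

no_notation fps_nth (infixl "$" 75)

text \<open>\<open>padic_abs\<close> is defined through the reduced fraction; cross-multiplication
  shows that any fraction gives the same valuation.\<close>

lemma padic_abs_quotient:
  assumes p: "prime p" and m: "m \<noteq> 0" and n: "n \<noteq> 0"
  shows "padic_abs p (of_int m / of_int n) = real p powi (int (multiplicity (int p) n) - int (multiplicity (int p) m))"
proof -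
  obtain m' n' where q: "quotient_of (of_int m / of_int n) = (m', n')" by (cases "quotient_of (of_int m / of_int n)")
  have n': "n' > 0" using quotient_of_denom_pos[OF q] .
  have "(of_int m / of_int n :: rat) = of_int m' / of_int n'" using quotient_of_div[OF q] .
  then have "(of_int (m * n') :: rat) = of_int (m' * n)" using n n' by (simp add: field_simps)
  then have eq: "m * n' = m' * n" by (simp only: of_int_eq_iff)
  have m': "m' \<noteq> 0" using eq m n' by auto
  have pp: "prime_elem (int p)" using p by simp
  have "multiplicity (int p) m + multiplicity (int p) n' = multiplicity (int p) m' + multiplicity (int p) n"
    using arg_cong[OF eq, of "multiplicity (int p)"] m n m' n' by (simp add: prime_elem_multiplicity_mult_distrib[OF pp])
  then have "int (multiplicity (int p) n') - int (multiplicity (int p) m') = int (multiplicity (int p) n) - int (multiplicity (int p) m)"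
    by linarith
  then show ?thesis using m n by (simp add: padic_abs_def q)
qed

lemma rat_quotient_cases:
  fixes x :: rat
  obtains m n :: int where "x = of_int m / of_int n" "n > 0"
  using quotient_of_div[of x] quotient_of_denom_pos[of x] by (metis surj_pair)

lemma padic_abs_of_int:
  assumes "prime p" "m \<noteq> 0"
  shows "padic_abs p (of_int m) = real p powi (- int (multiplicity (int p) m))"
  using padic_abs_quotient[OF assms, of 1] by simp

lemma padic_abs_0 [simp]: "padic_abs p 0 = 0" by (simp add: padic_abs_def)

lemma padic_abs_1 [simp]: "padic_abs p 1 = 1"
  using quotient_of_rat_of_int[of 1] by (simp add: padic_abs_def)

lemma padic_abs_pos: "prime p \<Longrightarrow> x \<noteq> 0 \<Longrightarrow> padic_abs p x > 0"
  by (simp add: padic_abs_def case_prod_unfold prime_gt_0_nat)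

lemma padic_abs_nonneg: "prime p \<Longrightarrow> padic_abs p x \<ge> 0"
  using padic_abs_pos[of p x] by (cases "x = 0") auto

lemma padic_abs_mult:
  assumes p: "prime p"
  shows "padic_abs p (x * y) = padic_abs p x * padic_abs p y"
proof (cases "x = 0 \<or> y = 0")
  case False
  obtain m n where x: "x = of_int m / of_int n" "n > 0" by (rule rat_quotient_cases)
  obtain m' n' where y: "y = of_int m' / of_int n'" "n' > 0" by (rule rat_quotient_cases)
  have nz: "m \<noteq> 0" "m' \<noteq> 0" using False x y by auto
  have xy: "x * y = of_int (m * m') / of_int (n * n')" by (simp add: x y)
  have pp: "prime_elem (int p)" using p by simp
  have p0: "real p \<noteq> 0" using p by (simp add: prime_gt_0_nat)
  show ?thesis
    unfolding xy unfolding x y using nz x(2) y(2) p0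
    by (subst (1 2 3) padic_abs_quotient[OF p])
       (auto simp: prime_elem_multiplicity_mult_distrib[OF pp] algebra_simps simp flip: power_int_add)
qed auto

lemma padic_abs_minus_1: "prime p \<Longrightarrow> padic_abs p (- 1) = 1"
proof -
  assume p: "prime p"
  have "padic_abs p (- 1) ^ 2 = 1" using padic_abs_mult[OF p, of "-1" "-1"] by (simp add: power2_eq_square)
  then show ?thesis using padic_abs_nonneg[OF p, of "-1"] by (auto simp: power2_eq_1_iff)
qed

lemma padic_abs_of_int_le_1: "prime p \<Longrightarrow> padic_abs p (of_int m) \<le> 1"
proof (cases "m = 0")
  case False
  assume p: "prime p"
  have "real p \<ge> 1" using p prime_ge_1_nat by auto
  then have "real p ^ multiplicity (int p) m \<ge> 1" by (rule one_le_power)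
  then show ?thesis using padic_abs_of_int[OF p False]
    by (simp add: power_int_minus inverse_le_1_iff)
qed auto

text \<open>Over a common denominator d the claim is that the smaller of the two powers of p
  dividing the numerators also divides their sum.\<close>

lemma padic_abs_add_le:
  assumes p: "prime p"
  shows "padic_abs p (x + y) \<le> max (padic_abs p x) (padic_abs p y)"
proof (cases "x = 0 \<or> y = 0 \<or> x + y = 0")
  case True
  then show ?thesis using padic_abs_nonneg[OF p] by (auto simp: max_def)
next
  case False
  obtain m n where x: "x = of_int m / of_int n" "n > 0" by (rule rat_quotient_cases)
  obtain m' n' where y: "y = of_int m' / of_int n'" "n' > 0" by (rule rat_quotient_cases)
  define a b d where "a = m * n'" and "b = m' * n" and "d = n * n'"
  have d: "d \<noteq> 0" using x y by (simp add: d_def)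
  have eqs: "x = of_int a / of_int d" "y = of_int b / of_int d" "x + y = of_int (a + b) / of_int d"
    using x y by (auto simp: a_def b_def d_def field_simps)
  have nz: "a \<noteq> 0" "b \<noteq> 0" "a + b \<noteq> 0" using False eqs by auto
  have mono: "real p powi (k - int u) \<le> real p powi (k - int v)" if "v \<le> u" for k u v
    using p prime_ge_1_nat that by (intro power_int_increasing) auto
  let ?v = "multiplicity (int p)"
  have "?v a \<le> ?v (a + b) \<or> ?v b \<le> ?v (a + b)"
  proof -
    let ?k = "min (?v a) (?v b)"
    have "int p ^ ?k dvd a + b" by (intro dvd_add multiplicity_dvd') auto
    then have "?k \<le> ?v (a + b)" using p nz by (intro multiplicity_geI) auto
    then show ?thesis by (auto simp: min_def split: if_splits)
  qed
  moreover have vx: "padic_abs p x = real p powi (int (?v d) - int (?v a))" and vy: "padic_abs p y = real p powi (int (?v d) - int (?v b))"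
    and vs: "padic_abs p (x + y) = real p powi (int (?v d) - int (?v (a + b)))"
    unfolding eqs(3) unfolding eqs(1,2) by (intro padic_abs_quotient p d nz)+
  ultimately show ?thesis
    unfolding vx vy vs le_max_iff_disj using mono by blast
qed

lemma prod_prime_multiplicity:
  assumes S: "finite S" "\<And>p. p \<in> S \<Longrightarrow> prime p" and m: "m \<noteq> 0" "\<And>p. prime p \<Longrightarrow> int p dvd m \<Longrightarrow> p \<in> S"
  shows "(\<Prod>p\<in>S. real p ^ multiplicity (int p) m) = real_of_int \<bar>m\<bar>"
proof -
  have "(\<Prod>p\<in>S. real p ^ multiplicity (int p) m) = (\<Prod>q\<in>int ` S. real_of_int q ^ multiplicity q m)"
    by (subst prod.reindex) auto
  also have "\<dots> = (\<Prod>q\<in>prime_factors m. real_of_int q ^ multiplicity q m)"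
  proof (rule prod.mono_neutral_right)
    show "prime_factors m \<subseteq> int ` S"
    proof
      fix q assume q: "q \<in> prime_factors m"
      then have "prime q" "q dvd m" by auto
      then show "q \<in> int ` S" using m(2)[of "nat q"] by (intro image_eqI[of _ _ "nat q"]) (auto simp: prime_ge_0_int prime_nat_iff_prime)
    qed
    show "\<forall>q\<in>int ` S - prime_factors m. real_of_int q ^ multiplicity q m = 1"
      using S m by (auto simp: in_prime_factors_iff not_dvd_imp_multiplicity_0)
  qed (use S in auto)
  also have "\<dots> = real_of_int (\<Prod>q\<in>prime_factors m. q ^ multiplicity q m)" by simp
  also have "\<dots> = real_of_int \<bar>m\<bar>" using m by (subst prod_prime_factors) auto
  finally show ?thesis .
qed

section \<open>Products over all places\<close>

lemma prod_places_eq: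
  assumes "finite K" "K \<subseteq> places" "\<And>v. v \<in> places - K \<Longrightarrow> f v = 1"
  shows "prod_places f = prod f K"
  unfolding prod_places_def by (rule prod.mono_neutral_left) (use assms in auto)

lemma prod_places_split:
  assumes "finite S" "\<And>p. p \<in> S \<Longrightarrow> prime p" "\<And>p. prime p \<Longrightarrow> p \<notin> S \<Longrightarrow> f (Finite p) = 1"
  shows "prod_places f = f Infinite * (\<Prod>p\<in>S. f (Finite p))"
proof -
  have "prod_places f = prod f (insert Infinite (Finite ` S))"
    using assms by (intro prod_places_eq) (auto simp: places_def)
  also have "\<dots> = f Infinite * prod f (Finite ` S)" using assms by (subst prod.insert) auto
  also have "prod f (Finite ` S) = (\<Prod>p\<in>S. f (Finite p))" by (subst prod.reindex) (auto simp: inj_on_def)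
  finally show ?thesis .
qed

definition prime_divs :: "int \<Rightarrow> nat set" where
  "prime_divs m = {p. prime p \<and> int p dvd m}"

lemma finite_prime_divs: "m \<noteq> 0 \<Longrightarrow> finite (prime_divs m)"
proof -
  assume m: "m \<noteq> 0"
  have "p \<le> nat \<bar>m\<bar>" if "int p dvd m" for p
    using dvd_imp_le_int[OF m that] by linarith
  then have "prime_divs m \<subseteq> {..nat \<bar>m\<bar>}" by (auto simp: prime_divs_def)
  then show ?thesis by (rule finite_subset) auto
qed

lemma prod_prime_divs:
  assumes "m \<noteq> 0" "k \<noteq> 0" "m dvd k"
  shows "(\<Prod>p\<in>prime_divs k. real p ^ multiplicity (int p) m) = real_of_int \<bar>m\<bar>"
  by (rule prod_prime_multiplicity) (use assms finite_prime_divs in \<open>auto simp: prime_divs_def intro: dvd_trans\<close>)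

lemma multiplicity_prime_divs:
  assumes "prime p" "p \<notin> prime_divs k" "m dvd k"
  shows "multiplicity (int p) m = 0"
  using assms by (auto simp: prime_divs_def intro!: not_dvd_imp_multiplicity_0 intro: dvd_trans)

text \<open>The extra factor r at infinity fits \<open>chi_P\<close>, whose local factors are the
  absolute values of one rational number except for an additional real factor at infinity.\<close>

lemma product_formula:
  assumes e: "e \<noteq> 0"
  shows "prod_places (\<lambda>v. place_abs v e * (if v = Infinite then r else 1)) = r"
proof -
  obtain m n where x: "e = of_int m / of_int n" "n > 0" by (rule rat_quotient_cases)
  have m: "m \<noteq> 0" using x e by auto
  let ?S = "prime_divs (m * n)"
  have mn: "m * n \<noteq> 0" using m x by auto
  have fin: "padic_abs p e = real p ^ multiplicity (int p) n / real p ^ multiplicity (int p) m" if "prime p" for p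
    using padic_abs_quotient[OF that m, of n] x that by (simp add: power_int_diff prime_gt_0_nat)
  have "prod_places (\<lambda>v. place_abs v e * (if v = Infinite then r else 1))
     = (place_abs Infinite e * r) * (\<Prod>p\<in>?S. padic_abs p e)"
    by (subst prod_places_split[OF finite_prime_divs[OF mn]])
       (auto simp: fin multiplicity_prime_divs[of _ "m * n"] simp flip: prime_divs_def, auto simp: prime_divs_def)
  also have "(\<Prod>p\<in>?S. padic_abs p e) = (\<Prod>p\<in>?S. real p ^ multiplicity (int p) n / real p ^ multiplicity (int p) m)"
    by (rule prod.cong) (auto simp: prime_divs_def fin)
  also have "\<dots> = real_of_int \<bar>n\<bar> / real_of_int \<bar>m\<bar>"
    unfolding prod_dividef using m x mn by (simp add: prod_prime_divs)
  finally show ?thesis using m x(2) by (simp add: x(1) of_rat_divide)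
qed

section \<open>Two-by-two matrices and local Iwasawa decompositions\<close>

lemma mat2_nth [simp]: "mat2 a b c d $ 1 $ 1 = a" "mat2 a b c d $ 1 $ 2 = b" "mat2 a b c d $ 2 $ 1 = c" "mat2 a b c d $ 2 $ 2 = d"
  by (simp_all add: mat2_def)

lemma mat2_eq_iff: "mat2 a b c d = mat2 a' b' c' d' \<longleftrightarrow> a = a' \<and> b = b' \<and> c = c' \<and> d = d'"
  by (auto simp: vec_eq_iff forall_2)

lemma mat2_cases: obtains a b c d where "A = mat2 a b c d"
proof
  show "A = mat2 (A $ 1 $ 1) (A $ 1 $ 2) (A $ 2 $ 1) (A $ 2 $ 2)"
    by (simp add: vec_eq_iff forall_2)
qed

lemma mat2_mult: "mat2 a b c d ** mat2 a' b' c' d' =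
    mat2 (a * a' + b * c') (a * b' + b * d') (c * a' + d * c') (c * b' + d * (d' :: 'a :: comm_ring_1))"
  by (simp add: vec_eq_iff forall_2 matrix_matrix_mult_def sum_2)

lemma mat_mat2: "mat t = mat2 t 0 0 (t :: 'a :: comm_ring_1)"
  by (simp add: vec_eq_iff forall_2 mat_def)

lemma det_mat2: "det (mat2 a b c d) = a * d - b * (c :: 'a :: comm_ring_1)"
  by (simp add: det_2)

lemma transpose_mat2: "transpose (mat2 a b c d) = mat2 a c b d"
  by (simp add: vec_eq_iff forall_2 transpose_def)

lemma map_matrix_mat2: "map_matrix f (mat2 a b c d) = mat2 (f a) (f b) (f c) (f d)"
  by (simp add: vec_eq_iff forall_2 map_matrix_def)

lemma rotation_mat2: "rotation_matrix (mat2 a b c d) \<longleftrightarrow>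
    a\<^sup>2 + c\<^sup>2 = 1 \<and> a * b + c * d = 0 \<and> b\<^sup>2 + d\<^sup>2 = 1 \<and> a * d - b * c = (1 :: real)"
  by (auto simp: rotation_matrix_def orthogonal_matrix transpose_mat2 mat2_mult mat_mat2 mat2_eq_iff det_mat2 power2_eq_square mult.commute)

text \<open>The bottom row of the product is t times the bottom row of the rotation, a unit vector,
  so t^2 is the squared norm of the row (c, d). The determinant is t^2 times the diagonal entry,
  which fixes the latter.\<close>

lemma iwasawa_infinite:
  fixes a b c d :: rat
  assumes det: "a * d - b * c \<noteq> 0"
  shows "iwasawa_abs Infinite (mat2 a b c d) r \<longleftrightarrow>
     r = \<bar>real_of_rat (a * d - b * c)\<bar> / (real_of_rat c ^ 2 + real_of_rat d ^ 2)"
proof -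
  define A B C D where "A = real_of_rat a" and "B = real_of_rat b" and "C = real_of_rat c" and "D = real_of_rat d"
  have Ddef: "real_of_rat (a * d - b * c) = A * D - B * C" by (simp add: A_def B_def C_def D_def of_rat_diff of_rat_mult)
  have nz: "A * D - B * C \<noteq> 0" unfolding Ddef[symmetric] using det by simp
  define q where "q = C ^ 2 + D ^ 2"
  have q: "q > 0" using nz unfolding q_def by (auto simp: sum_power2_gt_zero_iff)
  have uniq: "r = \<bar>A * D - B * C\<bar> / q"
    if h: "iwasawa_abs Infinite (mat2 a b c d) r"
  proof -
    obtain t x e k where k: "t \<noteq> 0" "e \<noteq> 0" "rotation_matrix k"
      "map_matrix real_of_rat (mat2 a b c d) = mat t ** mat2 1 x 0 1 ** mat2 e 0 0 1 ** k" "r = \<bar>e\<bar>"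
      using h by auto
    obtain k1 k2 k3 k4 where kk: "k = mat2 k1 k2 k3 k4" by (rule mat2_cases)
    have e: "A = t * e * k1 + t * x * k3" "B = t * e * k2 + t * x * k4" "C = t * k3" "D = t * k4"
      using k(4) unfolding kk map_matrix_mat2 mat_mat2 mat2_mult mat2_eq_iff A_def B_def C_def D_def by (simp_all add: algebra_simps)
    have rot: "k1\<^sup>2 + k3\<^sup>2 = 1" "k1 * k2 + k3 * k4 = 0" "k2\<^sup>2 + k4\<^sup>2 = 1" "k1 * k4 - k2 * k3 = 1"
      using k(3) unfolding kk rotation_mat2 by auto
    \<comment> \<open>Orthonormality is given for the columns. That the bottom row is a unit vector
      follows because the sum of all squares is 2 and twice the determinant is 2, so the squares
      below add up to 0.\<close>
    have "(k3\<^sup>2 + k4\<^sup>2) = 1"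
    proof -
      have "k1 ^ 2 + k2 ^ 2 + k3 ^ 2 + k4 ^ 2 = 2" using rot by linarith
      have "(k1 - k4) ^ 2 + (k2 + k3) ^ 2 = 0"
        using rot \<open>k1 ^ 2 + k2 ^ 2 + k3 ^ 2 + k4 ^ 2 = 2\<close> by (simp add: power2_eq_square algebra_simps)
      then have "k1 = k4" "k2 = - k3" by (auto simp: sum_power2_eq_zero_iff)
      then show ?thesis using rot by (simp add: add.commute)
    qed
    then have "q = t ^ 2" unfolding q_def e by (simp add: power_mult_distrib flip: distrib_left)
    moreover have "A * D - B * C = t ^ 2 * e"
    proof -
      have "A * D - B * C = t ^ 2 * e * (k1 * k4 - k2 * k3)" unfolding e by (simp add: power2_eq_square algebra_simps)
      then show ?thesis using rot by simp
    qed
    ultimately show ?thesis using k by (simp add: abs_mult)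
  qed
  have ex: "iwasawa_abs Infinite (mat2 a b c d) (\<bar>A * D - B * C\<bar> / q)"
  proof -
    \<comment> \<open>The bottom row of the rotation must be (C, D) / t. The top row then splits
      into a multiple x of the bottom row, found by orthogonal projection, and a multiple e of the
      perpendicular vector (D, - C).\<close>
    define t where "t = sqrt q"
    have t: "t > 0" "t * t = q" using q by (auto simp: t_def)
    define e where "e = (A * D - B * C) / q"
    define x where "x = (A * C + B * D) / q"
    define k where "k = mat2 (D / t) (- C / t) (C / t) (D / t)"
    have "(C / t) ^ 2 + (D / t) ^ 2 = (C ^ 2 + D ^ 2) / (t * t)"
      by (simp add: power2_eq_square add_divide_distrib)
    also have "\<dots> = 1" using q by (simp only: t(2) q_def[symmetric]) simp
    finally have one: "(C / t) ^ 2 + (D / t) ^ 2 = 1" .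
    from one have "rotation_matrix k"
      unfolding k_def rotation_mat2 by (simp add: power2_eq_square add.commute)
    moreover have "map_matrix real_of_rat (mat2 a b c d) = mat t ** mat2 1 x 0 1 ** mat2 e 0 0 1 ** k"
    proof -
      have 1: "e * D + x * C = A"
      proof -
        have "e * D + x * C = (A * (C ^ 2 + D ^ 2)) / q"
          by (simp add: e_def x_def add_divide_distrib[symmetric] power2_eq_square algebra_simps)
        then show ?thesis using q by (simp flip: q_def)
      qed
      have 2: "x * D - e * C = B"
      proof -
        have "x * D - e * C = (B * (C ^ 2 + D ^ 2)) / q"
          by (simp add: e_def x_def diff_divide_distrib[symmetric] power2_eq_square algebra_simps)
        then show ?thesis using q by (simp flip: q_def)
      qed
      show ?thesis
        unfolding k_def map_matrix_mat2 mat_mat2 mat2_mult mat2_eq_iff A_def[symmetric] B_def[symmetric] C_def[symmetric] D_def[symmetric]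
        using t 1 2 by (simp add: algebra_simps)
    qed
    moreover have "e \<noteq> 0" using nz q by (simp add: e_def)
    moreover have "\<bar>A * D - B * C\<bar> / q = \<bar>e\<bar>" using q by (simp add: e_def)
    ultimately show ?thesis
      unfolding iwasawa_abs.simps using t by (intro exI[of _ t] exI[of _ x] exI[of _ e] exI[of _ k] conjI) auto
  qed
  show ?thesis using uniq ex unfolding Ddef q_def C_def D_def by blast
qed

text \<open>The bottom row of an integral matrix of unit determinant has maximum norm 1, by the
  ultrametric inequality applied to the determinant. Hence max (|c|, |d|) = |t|, while the
  determinant is t^2 times the diagonal entry times a unit.\<close>

lemma iwasawa_finite:
  fixes a b c d :: rat
  assumes p: "prime p" and det: "a * d - b * c \<noteq> 0"
  shows "iwasawa_abs (Finite p) (mat2 a b c d) r \<longleftrightarrow>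
     r = padic_abs p (a * d - b * c) / (max (padic_abs p c) (padic_abs p d)) ^ 2"
proof -
  let ?n = "padic_abs p"
  note mult = padic_abs_mult[OF p]
  have uniq: "r = ?n (a * d - b * c) / (max (?n c) (?n d)) ^ 2" if h: "iwasawa_abs (Finite p) (mat2 a b c d) r" for r
  proof -
    obtain t x e k where k: "t \<noteq> 0" "e \<noteq> 0" "k \<in> GL2_Z_loc p"
      "mat2 a b c d = mat t ** mat2 1 x 0 1 ** mat2 e 0 0 1 ** k" "r = ?n e"
      using h by auto
    obtain k1 k2 k3 k4 where kk: "k = mat2 k1 k2 k3 k4" by (rule mat2_cases)
    have e: "a = t * e * k1 + t * x * k3" "b = t * e * k2 + t * x * k4" "c = t * k3" "d = t * k4"
      using k(4) unfolding kk mat_mat2 mat2_mult mat2_eq_iff by (simp_all add: algebra_simps)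
    have le: "?n k1 \<le> 1" "?n k2 \<le> 1" "?n k3 \<le> 1" "?n k4 \<le> 1" and dk: "?n (k1 * k4 - k2 * k3) = 1"
      using k(3) unfolding kk GL2_Z_loc_def by (auto simp: forall_2 det_mat2)
    have "max (?n k3) (?n k4) = 1"
    proof -
      have neg: "?n (- (k2 * k3)) = ?n (k2 * k3)"
        using mult[of "-1" "k2 * k3"] padic_abs_minus_1[OF p] by simp
      have "1 \<le> max (?n (k1 * k4)) (?n (- (k2 * k3)))"
        using padic_abs_add_le[OF p, of "k1 * k4" "- (k2 * k3)"] dk by simp
      moreover have "?n (k1 * k4) \<le> ?n k4" "?n (k2 * k3) \<le> ?n k3"
        unfolding mult using le padic_abs_nonneg[OF p] by (auto intro!: mult_left_le_one_le)
      ultimately show ?thesis using le neg by linarith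
    qed
    moreover have "max (?n c) (?n d) = ?n t * max (?n k3) (?n k4)"
      unfolding e mult using padic_abs_nonneg[OF p, of t] by (simp add: max_mult_distrib_left)
    moreover have "?n (a * d - b * c) = ?n t ^ 2 * ?n e"
    proof -
      have "a * d - b * c = t * (t * (e * (k1 * k4 - k2 * k3)))" unfolding e by (simp add: algebra_simps)
      then show ?thesis using dk by (simp add: mult power2_eq_square)
    qed
    ultimately show ?thesis using k padic_abs_pos[OF p k(1)] by simp
  qed
  have cd: "c \<noteq> 0 \<or> d \<noteq> 0" using det by auto
  \<comment> \<open>Dividing the bottom row by its entry of larger absolute value keeps the right
    factor p-integral, with determinant 1 or -1.\<close>
  have ex: "\<exists>r. iwasawa_abs (Finite p) (mat2 a b c d) r"
  proof (cases "?n c \<le> ?n d")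
    case True
    have d: "d \<noteq> 0" using True cd padic_abs_pos[OF p, of c] by auto
    have nd: "?n d > 0" using padic_abs_pos[OF p d] .
    define e where "e = (a - b * c / d) / d"
    have e0: "e \<noteq> 0" using det d by (simp add: e_def field_simps)
    have "?n d * ?n (c / d) = ?n c" using mult[of d "c / d"] d by simp
    then have "?n (c / d) \<le> 1" using True nd by (metis mult_le_cancel_left_pos mult_1_right)
    then have "mat2 1 0 (c / d) 1 \<in> GL2_Z_loc p" by (simp add: GL2_Z_loc_def forall_2 det_mat2)
    moreover have "mat2 a b c d = mat d ** mat2 1 (b / d) 0 1 ** mat2 e 0 0 1 ** mat2 1 0 (c / d) 1"
      using d unfolding mat_mat2 mat2_mult mat2_eq_iff by (simp add: e_def field_simps)
    ultimately show ?thesis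
      unfolding iwasawa_abs.simps using d e0
      by (intro exI[of _ "?n e"] exI[of _ d] exI[of _ "b / d"] exI[of _ e] exI[of _ "mat2 1 0 (c / d) 1"] conjI refl)
  next
    case False
    have c: "c \<noteq> 0" using False padic_abs_nonneg[OF p, of d] by auto
    have nc: "?n c > 0" using padic_abs_pos[OF p c] .
    define e where "e = (b - a * d / c) / c"
    have e0: "e \<noteq> 0" using det c by (simp add: e_def field_simps)
    have "?n c * ?n (d / c) = ?n d" using mult[of c "d / c"] c by simp
    then have "?n (d / c) \<le> 1" using False nc by (metis mult_le_cancel_left_pos mult_1_right less_imp_le not_le)
    then have "mat2 0 1 1 (d / c) \<in> GL2_Z_loc p" by (simp add: GL2_Z_loc_def forall_2 det_mat2 padic_abs_minus_1[OF p])
    moreover have "mat2 a b c d = mat c ** mat2 1 (a / c) 0 1 ** mat2 e 0 0 1 ** mat2 0 1 1 (d / c)"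
      using c unfolding mat_mat2 mat2_mult mat2_eq_iff by (simp add: e_def field_simps)
    ultimately show ?thesis
      unfolding iwasawa_abs.simps using c e0
      by (intro exI[of _ "?n e"] exI[of _ c] exI[of _ "a / c"] exI[of _ e] exI[of _ "mat2 0 1 1 (d / c)"] conjI refl)
  qed
  show ?thesis using uniq ex by blast
qed

lemma not_int_prime_dvd_gcd:
  assumes p: "prime p" and m: "m \<noteq> 0" "\<not> int p dvd m"
  shows "padic_abs p (of_int m) = 1"
  using padic_abs_of_int[OF p m(1)] m by (simp add: not_dvd_imp_multiplicity_0)

lemma padic_max_coprime:
  assumes p: "prime p" and cd: "coprime c d"
  shows "max (padic_abs p (of_int c)) (padic_abs p (of_int d)) = 1"
proof -
  have "\<not> (int p dvd c \<and> int p dvd d)"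
    using cd p by (metis coprime_common_divisor not_prime_unit prime_nat_int_transfer)
  then have "padic_abs p (of_int c) = 1 \<or> padic_abs p (of_int d) = 1"
    using not_int_prime_dvd_gcd[OF p, of c] not_int_prime_dvd_gcd[OF p, of d] by (cases "c = 0"; cases "d = 0") auto
  then show ?thesis using padic_abs_of_int_le_1[OF p, of c] padic_abs_of_int_le_1[OF p, of d] by (auto simp: max_def)
qed

lemma chi_P_eq:
  fixes a b z :: rat
  assumes cd: "coprime c d" and z: "z \<noteq> 0" and det: "a * (z * of_int d) - b * (z * of_int c) \<noteq> 0"
  shows "chi_P (mat2 a b (z * of_int c) (z * of_int d)) = 1 / Q (c, d)"
proof -
  \<comment> \<open>The bottom row is z times a primitive vector, so the local factor at every
    finite place is the absolute value of e, and at infinity that value divided by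
    \<open>Q (c, d)\<close>. The product formula removes e.\<close>
  define e where "e = (a * (z * of_int d) - b * (z * of_int c)) / z ^ 2"
  have e: "e \<noteq> 0" using det z by (simp add: e_def)
  let ?A = "mat2 a b (z * of_int c) (z * of_int d)"
  have D: "a * (z * of_int d) - b * (z * of_int c) = e * (z * z)" using z by (simp add: e_def power2_eq_square)
  have 1: "(THE r. iwasawa_abs Infinite ?A r) = place_abs Infinite e * (1 / Q (c, d))"
  proof -
    have "Q (c, d) = real_of_rat (of_int c) ^ 2 + real_of_rat (of_int d) ^ 2" by (simp add: Q_def)
    moreover have "real_of_rat (z * of_int c) ^ 2 + real_of_rat (z * of_int d) ^ 2 = real_of_rat z ^ 2 * (real_of_rat (of_int c) ^ 2 + real_of_rat (of_int d) ^ 2)"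
      by (simp add: of_rat_mult power_mult_distrib distrib_left)
    moreover have "\<bar>real_of_rat (e * (z * z))\<bar> = place_abs Infinite e * real_of_rat z ^ 2"
      by (simp only: of_rat_mult abs_mult place_abs.simps power2_eq_square abs_mult_self_eq)
    ultimately have "\<bar>real_of_rat (e * (z * z))\<bar> / (real_of_rat (z * of_int c) ^ 2 + real_of_rat (z * of_int d) ^ 2) = place_abs Infinite e * (1 / Q (c, d))"
      using z by (simp del: place_abs.simps)
    then show ?thesis unfolding iwasawa_infinite[OF det] D by simp
  qed
  have 2: "(THE r. iwasawa_abs (Finite p) ?A r) = place_abs (Finite p) e" if p: "prime p" for p
  proof -
    have "max (padic_abs p (z * of_int c)) (padic_abs p (z * of_int d)) = padic_abs p z"
      using padic_abs_nonneg[OF p, of z] max_mult_distrib_left[of "padic_abs p z" "padic_abs p (of_int c)" "padic_abs p (of_int d)"]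
      by (simp add: padic_abs_mult[OF p] padic_max_coprime[OF p cd])
    then show ?thesis
      unfolding iwasawa_finite[OF p det] D using padic_abs_pos[OF p z] by (simp add: padic_abs_mult[OF p] power2_eq_square)
  qed
  have "chi_P ?A = prod_places (\<lambda>v. place_abs v e * (if v = Infinite then 1 / Q (c, d) else 1))"
    unfolding chi_P_def prod_places_def
  proof (rule prod.cong)
    have eq: "(THE r. iwasawa_abs v ?A r) = place_abs v e * (if v = Infinite then 1 / Q (c, d) else 1)" if v: "v \<in> places" for v
    proof (cases "v = Infinite")
      case True
      then show ?thesis unfolding True 1 by (simp only: if_True simp_thms)
    next
      case False
      then obtain p where p: "v = Finite p" "prime p" using v by (auto simp: places_def)
      show ?thesis unfolding p(1) 2[OF p(2)] by (simp only: place.distinct if_False mult_1_right)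
    qed
    then show "{v \<in> places. (THE r. iwasawa_abs v ?A r) \<noteq> 1} = {v \<in> places. place_abs v e * (if v = Infinite then 1 / Q (c, d) else 1) \<noteq> 1}"
      by (intro Collect_cong conj_cong refl) (simp only: eq)
    show "(THE r. iwasawa_abs v ?A r) = place_abs v e * (if v = Infinite then 1 / Q (c, d) else 1)"
      if "v \<in> {v \<in> places. place_abs v e * (if v = Infinite then 1 / Q (c, d) else 1) \<noteq> 1}" for v
      using that by (intro eq) simp
  qed
  then show ?thesis using product_formula[OF e] by simp
qed

section \<open>Cosets of the Borel subgroup\<close>

definition P_rel :: "((rat^2^2) \<times> (rat^2^2)) set" where
  "P_rel = {(A, B). \<exists>x y z. x \<noteq> 0 \<and> z \<noteq> 0 \<and> B = mat2 x y 0 z ** A}"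

lemma P_rel_mat2: "(mat2 a b c d, B) \<in> P_rel \<longleftrightarrow>
   (\<exists>x y z. x \<noteq> 0 \<and> z \<noteq> 0 \<and> B = mat2 (x * a + y * c) (x * b + y * d) (z * c) (z * d))"
  by (simp add: P_rel_def mat2_mult)

lemma P_rel_trans:
  assumes "(A, B) \<in> P_rel" "(B, C) \<in> P_rel"
  shows "(A, C) \<in> P_rel"
proof -
  obtain x y z x' y' z' where "x \<noteq> 0" "z \<noteq> 0" "B = mat2 x y 0 z ** A" "x' \<noteq> 0" "z' \<noteq> 0" "C = mat2 x' y' 0 z' ** B"
    using assms by (auto simp: P_rel_def)
  then show ?thesis
    unfolding P_rel_def mem_Collect_eq prod.case
    by (intro exI[of _ "x' * x"] exI[of _ "x' * y + y' * z"] exI[of _ "z' * z"]) (simp add: matrix_mul_assoc mat2_mult)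
qed

lemma P_rel_sym:
  assumes "(A, B) \<in> P_rel"
  shows "(B, A) \<in> P_rel"
proof -
  obtain x y z where xyz: "x \<noteq> 0" "z \<noteq> 0" "B = mat2 x y 0 z ** A" using assms by (auto simp: P_rel_def)
  have "mat2 (1 / x) (- y / (x * z)) 0 (1 / z) ** mat2 x y 0 z = mat 1"
    using xyz by (simp add: mat2_mult mat_mat2 mat2_eq_iff field_simps)
  then have "A = mat2 (1 / x) (- y / (x * z)) 0 (1 / z) ** B"
    unfolding xyz(3) by (simp add: matrix_mul_assoc)
  then show ?thesis
    using xyz unfolding P_rel_def mem_Collect_eq prod.case
    by (intro exI[of _ "1 / x"] exI[of _ "- y / (x * z)"] exI[of _ "1 / z"]) simp
qed

lemma P_rel_Image_eq: "(A, B) \<in> P_rel \<Longrightarrow> P_rel `` {B} = P_rel `` {A}"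
  using P_rel_trans P_rel_sym by blast

text \<open>A coset only remembers the bottom row up to scalars, so any invertible completion will
  serve; these two have determinant d and - c.\<close>

definition P_rep :: "int \<times> int \<Rightarrow> rat^2^2" where
  "P_rep p = (if fst p = 0 then mat2 1 0 (of_int (fst p)) (of_int (snd p)) else mat2 0 1 (of_int (fst p)) (of_int (snd p)))"

lemma rat_pair_prim:
  fixes c d :: rat
  assumes "c \<noteq> 0 \<or> d \<noteq> 0"
  obtains z c0 d0 where "z \<noteq> 0" "(c0, d0) \<in> prim" "c = z * of_int c0" "d = z * of_int d0"
proof -
  obtain m n where c: "c = of_int m / of_int n" "n > 0" by (rule rat_quotient_cases)
  obtain m' n' where d: "d = of_int m' / of_int n'" "n' > 0" by (rule rat_quotient_cases)
  define x y where "x = m * n'" and "y = m' * n"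
  have xy: "x \<noteq> 0 \<or> y \<noteq> 0" using assms c d by (auto simp: x_def y_def)
  define e where "e = (if (x, y) \<in> lexpos then 1 else - 1 :: int)"
  have e: "e * e = 1" "e \<noteq> 0" by (auto simp: e_def)
  have "(e * x, e * y) \<in> lexpos" using xy by (auto simp: e_def lexpos_def)
  then have "(e * x, e * y) \<in> (\<lambda>(g :: nat, c, d). (int g * c, int g * d)) ` ({0<..} \<times> prim)"
    using bij_prim by (simp add: bij_betw_def)
  then obtain g c0 d0 where g: "g > (0 :: nat)" "(c0, d0) \<in> prim" "e * x = int g * c0" "e * y = int g * d0"
    by auto
  have ex: "x = e * (int g * c0)" "y = e * (int g * d0)"
    using g(3,4) e(1) by (metis mult.assoc mult_1)+
  show ?thesis
  proof (rule that[of "of_int (e * int g) / of_int (n * n')" c0 d0])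
    show "(of_int (e * int g) / of_int (n * n') :: rat) \<noteq> 0" using e g c d by simp
    have "c = of_int x / of_int (n * n')" "d = of_int y / of_int (n * n')"
      using c d by (simp_all add: x_def y_def)
    then show "c = of_int (e * int g) / of_int (n * n') * of_int c0" "d = of_int (e * int g) / of_int (n * n') * of_int d0"
      unfolding ex by simp_all
  qed (rule g)
qed

lemma lexpos_proportional:
  fixes z :: rat
  assumes "of_int c' = z * of_int c" "of_int d' = z * of_int d" "(c, d) \<in> lexpos" "(c', d') \<in> lexpos"
  shows "z > 0"
proof (cases "c = 0")
  case True
  then have "c' = 0" using assms(1) by simp
  then have "d > 0" "d' > 0" using True assms(3,4) by (auto simp: lexpos_def)
  then have "(of_int d' :: rat) > 0" "(of_int d :: rat) > 0" by simp_all
  then show ?thesis unfolding assms(2) by (simp add: zero_less_mult_iff)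
next
  case False
  then have c: "c > 0" using assms(3) by (auto simp: lexpos_def)
  show ?thesis
  proof (cases "c' = 0")
    case True
    then have "z = 0" using assms(1) False by simp
    then show ?thesis using assms(2,4) True by (auto simp: lexpos_def)
  next
    case False
    then have "c' > 0" using assms(4) by (auto simp: lexpos_def)
    then have "(of_int c' :: rat) > 0" "(of_int c :: rat) > 0" using c by simp_all
    then show ?thesis unfolding assms(1) by (simp add: zero_less_mult_iff)
  qed
qed

text \<open>Writing z = m / n gives n c' = m c and n d' = m d. Comparing gcds of primitive vectors
  yields n = m, since membership in \<open>lexpos\<close> makes z positive.\<close>

lemma prim_proportional:
  fixes z :: rat
  assumes "of_int c' = z * of_int c" "of_int d' = z * of_int d" "(c, d) \<in> prim" "(c', d') \<in> prim"
  shows "z = 1"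
proof -
  have z: "z > 0" using lexpos_proportional[OF assms(1,2)] assms(3,4) prim_lexpos by blast
  obtain m n where mn: "z = of_int m / of_int n" "n > 0" by (rule rat_quotient_cases)
  have m: "m > 0" using z mn by (simp add: zero_less_divide_iff)
  have "(of_int (n * c') :: rat) = of_int (m * c)" "(of_int (n * d') :: rat) = of_int (m * d)"
    using mn assms(1,2) by (simp_all add: field_simps)
  then have "n * c' = m * c" "n * d' = m * d" by (simp_all only: of_int_eq_iff)
  then have "gcd (n * c') (n * d') = gcd (m * c) (m * d)" by simp
  then have "n = m" using mn m assms(3,4) by (simp add: gcd_mult_left prim_def)
  then show ?thesis using mn by simp
qed

lemma P_rep_det: "p \<in> prim \<Longrightarrow> det (P_rep p) \<noteq> 0"
  by (auto simp: P_rep_def det_mat2 prim_def lexpos_def)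

lemma bij_P_cosets: "bij_betw (\<lambda>p. P_rel `` {P_rep p}) prim P_cosets"
proof (rule bij_betw_imageI)
  show "inj_on (\<lambda>p. P_rel `` {P_rep p}) prim"
  proof (rule inj_onI)
    fix p q assume pq: "p \<in> prim" "q \<in> prim" "P_rel `` {P_rep p} = P_rel `` {P_rep q}"
    obtain c d c' d' where e: "p = (c, d)" "q = (c', d')" by (cases p, cases q)
    have "(P_rep q, P_rep q) \<in> P_rel"
      unfolding P_rel_def mem_Collect_eq prod.case by (intro exI[of _ 1] exI[of _ 0]) (simp add: mat_mat2[symmetric])
    then have "(P_rep p, P_rep q) \<in> P_rel" using pq(3) by blast
    then obtain z where "of_int c' = z * (of_int c :: rat)" "of_int d' = z * (of_int d :: rat)"
      by (auto simp: P_rep_def e P_rel_mat2 mat2_eq_iff split: if_splits)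
    moreover from this have "z = 1" using prim_proportional pq(1,2) unfolding e by blast
    ultimately show "p = q" by (simp add: e)
  qed
  show "(\<lambda>p. P_rel `` {P_rep p}) ` prim = P_cosets"
  proof (intro equalityI subsetI)
    fix X assume "X \<in> (\<lambda>p. P_rel `` {P_rep p}) ` prim"
    then show "X \<in> P_cosets"
      unfolding P_cosets_def P_rel_def[symmetric] by (auto simp: GL2_Q_def intro!: quotientI P_rep_det)
  next
    fix X assume "X \<in> P_cosets"
    then obtain A where A: "A \<in> GL2_Q" "X = P_rel `` {A}"
      unfolding P_cosets_def P_rel_def[symmetric] by (auto elim: quotientE)
    obtain a b c d where Ae: "A = mat2 a b c d" by (rule mat2_cases)
    have det: "a * d - b * c \<noteq> 0" using A(1) by (simp add: Ae GL2_Q_def det_mat2)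
    then have "c \<noteq> 0 \<or> d \<noteq> 0" by auto
    then obtain z c0 d0 where z: "z \<noteq> 0" "(c0, d0) \<in> prim" "c = z * of_int c0" "d = z * of_int d0"
      by (rule rat_pair_prim)
    have "(P_rep (c0, d0), A) \<in> P_rel"
    proof (cases "c0 = 0")
      case True
      then have d0: "d0 = 1" using z(2) by (auto simp: prim_def lexpos_def)
      have "a \<noteq> 0" using det z True by auto
      then show ?thesis unfolding P_rep_def Ae using True d0 z
        by (auto simp: P_rel_mat2 mat2_eq_iff intro!: exI[of _ a] exI[of _ b] exI[of _ z])
    next
      case False
      \<comment> \<open>Left multiplication by an upper triangular matrix with top row (x, y) turns
        the representative's top row into (y c0, x + y d0); solving for (a, b) gives y = a / c0 and
        this x.\<close>
      define x where "x = b - a / of_int c0 * of_int d0"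
      have "x * (z * of_int c0) = - (a * d - b * c)" using False by (simp add: x_def z algebra_simps)
      then have "x \<noteq> 0" using det by auto
      then show ?thesis unfolding P_rep_def Ae using False z
        by (simp add: P_rel_mat2 mat2_eq_iff, intro exI[of _ x] conjI exI[of _ "a / of_int c0"]) (auto simp: x_def)
    qed
    then have "X = P_rel `` {P_rep (c0, d0)}" using A(2) P_rel_Image_eq by blast
    then show "X \<in> (\<lambda>p. P_rel `` {P_rep p}) ` prim" using z(2) by blast
  qed
qed

lemma chi_P_coset:
  assumes "p \<in> prim"
  shows "the_elem (chi_P ` (P_rel `` {P_rep p})) = 1 / Q p"
proof -
  obtain c d where p: "p = (c, d)" by (cases p)
  have cd: "coprime c d" using assms by (simp add: p prim_def)
  have "chi_P B = 1 / Q p" if B: "(P_rep p, B) \<in> P_rel" for B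
  proof -
    obtain x y z where xyz: "x \<noteq> 0" "z \<noteq> 0" "B = mat2 x y 0 z ** P_rep p" using B by (auto simp: P_rel_def)
    have "det B = det (mat2 x y 0 z) * det (P_rep p)" unfolding xyz(3) by (rule det_mul)
    then have detB: "det B \<noteq> 0" using P_rep_det[OF assms] xyz by (simp add: det_mat2)
    have "\<exists>a b. B = mat2 a b (z * of_int c) (z * of_int d)"
      unfolding xyz(3) P_rep_def p by (cases "c = 0") (auto simp: mat2_mult mat2_eq_iff)
    then obtain a b where Be: "B = mat2 a b (z * of_int c) (z * of_int d)" by blast
    show ?thesis unfolding Be p by (rule chi_P_eq[OF cd xyz(2)]) (use detB in \<open>simp add: Be det_mat2\<close>)
  qed
  moreover have "(P_rep p, P_rep p) \<in> P_rel"
    unfolding P_rel_def mem_Collect_eq prod.case by (intro exI[of _ 1] exI[of _ 0]) (simp add: mat_mat2[symmetric])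
  ultimately have "chi_P ` (P_rel `` {P_rep p}) = {1 / Q p}" by (auto simp: image_iff)
  then show ?thesis by simp
qed

lemma eisenstein_props:
  shows "eisenstein_e nicely_meromorphic_on UNIV"
    "\<And>s. Re s > 1 / 2 \<Longrightarrow> eisenstein_e s = eis (s + 1 / 2)"
proof -
  have "(\<Sum>\<^sub>\<infinity>X\<in>P_cosets. of_real (the_elem (chi_P ` X)) powr (s + 1 / 2)) = eis (s + 1 / 2)" for s :: complex
  proof -
    have "(\<Sum>\<^sub>\<infinity>X\<in>P_cosets. of_real (the_elem (chi_P ` X)) powr (s + 1 / 2))
        = (\<Sum>\<^sub>\<infinity>p\<in>prim. of_real (the_elem (chi_P ` (P_rel `` {P_rep p}))) powr (s + 1 / 2) :: complex)"
      by (rule infsum_reindex_bij_betw[OF bij_P_cosets, symmetric])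
    also have "\<dots> = eis (s + 1 / 2)"
      unfolding eis_def
    proof (rule infsum_cong)
      fix p assume p: "p \<in> prim"
      then have q: "Q p > 0" using Q_pos[OF prim_lexpos[OF p]] by linarith
      show "of_real (the_elem (chi_P ` (P_rel `` {P_rep p}))) powr (s + 1 / 2) = (of_real (Q p) powr (- (s + 1 / 2)) :: complex)"
      proof -
        have "Ln (of_real (1 / Q p)) = - Ln (of_real (Q p))"
          using q by (subst (1 2) Ln_of_real) (simp_all add: ln_div)
        moreover have "(of_real (1 / Q p) :: complex) \<noteq> 0" "(of_real (Q p) :: complex) \<noteq> 0" using q by simp_all
        ultimately show ?thesis
          unfolding chi_P_coset[OF p] powr_def by (simp only: if_False mult_minus_left mult_minus_right)
      qed
    qed
    finally show ?thesis .
  qed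
  then show "eisenstein_e nicely_meromorphic_on UNIV" "\<And>s. Re s > 1 / 2 \<Longrightarrow> eisenstein_e s = eis (s + 1 / 2)"
    unfolding eisenstein_e_def using mero_cont_eis by simp_all
qed

section \<open>Heights on PGL(2)\<close>

lemma powr_of_real_exp: "x > 0 \<Longrightarrow> of_real x powr s = exp (s * of_real (ln x))" for x :: real and s :: complex
  by (simp add: powr_def Ln_of_real)

lemma powr_of_real_mult:
  "x > 0 \<Longrightarrow> y > 0 \<Longrightarrow> of_real (x * y) powr s = (of_real x powr s * of_real y powr s :: complex)" for x y :: real
  by (simp add: powr_of_real_exp ln_mult distrib_left exp_add del: of_real_mult)

lemma prod_powr_of_real:
  assumes "finite S" "\<And>p. p \<in> S \<Longrightarrow> f p > 0"
  shows "(\<Prod>p\<in>S. of_real (f p) powr s) = (of_real (\<Prod>p\<in>S. f p) powr s :: complex)"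
  using assms
proof (induction S rule: finite_induct)
  case (insert p S)
  have "(\<Prod>p\<in>S. f p) > 0" using insert.prems by (intro prod_pos) auto
  then show ?case using insert powr_of_real_mult[of "f p" "\<Prod>p\<in>S. f p" s] by simp
qed auto

text \<open>Quadruples are the entries of an integer matrix read row by row. The condition on the
  bottom row selects one of the two signs; the top row is free off a line.\<close>

definition quad :: "(int \<times> int \<times> int \<times> int) set" where
  "quad = {(a, b, c, d). a * d - b * c \<noteq> 0 \<and> (c, d) \<in> lexpos}"

definition quad_gcd :: "int \<times> int \<times> int \<times> int \<Rightarrow> int" where
  "quad_gcd = (\<lambda>(a, b, c, d). gcd a (gcd b (gcd c d)))"

definition quad_prim :: "(int \<times> int \<times> int \<times> int) set" where
  "quad_prim = {x \<in> quad. quad_gcd x = 1}"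

definition imat :: "int \<times> int \<times> int \<times> int \<Rightarrow> rat^2^2" where
  "imat = (\<lambda>(a, b, c, d). mat2 (of_int a) (of_int b) (of_int c) (of_int d))"

text \<open>The variable u stands for s + w. Imprimitive quadruples are allowed: multiplying all
  entries by e multiplies the first factor by e powr (- u) and leaves the second unchanged, so
  summing over e produces \<zeta>(u).\<close>

definition tau :: "complex \<Rightarrow> complex \<Rightarrow> int \<times> int \<times> int \<times> int \<Rightarrow> complex" where
  "tau s u = (\<lambda>(a, b, c, d). of_real (Q (a, b) + Q (c, d)) powr (- (u / 2)) *
      of_real (Q (c, d) / of_int (gcd c d) ^ 2) powr (u / 2 - s))"

lemma local_norm_finite:
  "local_norm (Finite p) [c, d] = max (padic_abs p c) (padic_abs p d)"
  "local_norm (Finite p) [a, b, c, d] = max (padic_abs p a) (max (padic_abs p b) (max (padic_abs p c) (padic_abs p d)))"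
  by simp_all

lemma padic_abs_inverse_power:
  "prime p \<Longrightarrow> m \<noteq> 0 \<Longrightarrow> padic_abs p (of_int m) = 1 / real p ^ multiplicity (int p) m"
  by (simp add: padic_abs_of_int power_int_minus field_simps)

lemma prod_padic_abs:
  assumes "m \<noteq> 0" "k \<noteq> 0" "m dvd k"
  shows "(\<Prod>p\<in>prime_divs k. padic_abs p (of_int m)) = 1 / real_of_int \<bar>m\<bar>"
proof -
  have "(\<Prod>p\<in>prime_divs k. padic_abs p (of_int m)) = (\<Prod>p\<in>prime_divs k. 1 / real p ^ multiplicity (int p) m)"
    by (rule prod.cong) (use assms in \<open>auto simp: prime_divs_def padic_abs_inverse_power\<close>)
  then show ?thesis using prod_prime_divs[OF assms] by (simp add: prod_dividef)
qed

text \<open>The scalar t cancels at each place. For a primitive matrix the full norm is 1 at finite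
  places, where only the gcd g of the bottom row and the determinant D are visible. D cancels
  between infinity and the finite places, so that N, q and g remain.\<close>

lemma height_imat:
  assumes x: "(a, b, c, d) \<in> quad_prim" and t: "t \<noteq> 0"
  shows "inverse (height (mat t ** imat (a, b, c, d)) s w) = tau s (s + w) (a, b, c, d)"
proof -
  define g where "g = gcd c d"
  define D where "D = a * d - b * c"
  define N where "N = Q (a, b) + Q (c, d)"
  define q where "q = Q (c, d)"
  have D: "D \<noteq> 0" and cd: "(c, d) \<in> lexpos" and prim4: "gcd a (gcd b (gcd c d)) = 1"
    using x by (auto simp: quad_prim_def quad_def quad_gcd_def D_def)
  have g: "g > 0" using cd by (auto simp: g_def lexpos_def)
  have q: "q \<ge> 1" using Q_pos[OF cd] by (simp add: q_def)
  have N: "N \<ge> 1" using q Q_nonneg[of "(a, b)"] by (simp add: N_def q_def)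
  define B where "B = mat2 (t * of_int a) (t * of_int b) (t * of_int c) (t * of_int d)"
  have B: "mat t ** imat (a, b, c, d) = B" by (simp add: B_def imat_def mat_mat2 mat2_mult)
  have detB: "det B = t * (t * of_int D)" by (simp add: B_def det_mat2 D_def algebra_simps)
  let ?T = "\<bar>real_of_rat t\<bar>"
  have T: "?T > 0" using t by simp
  have normN: "local_norm Infinite [t * of_int a, t * of_int b, t * of_int c, t * of_int d] = ?T * sqrt N"
  proof -
    have "(\<Sum>x\<leftarrow>[t * of_int a, t * of_int b, t * of_int c, t * of_int d]. (real_of_rat x)\<^sup>2) = real_of_rat t ^ 2 * N"
      by (simp add: N_def Q_def of_rat_mult power_mult_distrib distrib_left)
    then show ?thesis by (simp only: local_norm.simps real_sqrt_mult real_sqrt_abs)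
  qed
  have normq: "local_norm Infinite [t * of_int c, t * of_int d] = ?T * sqrt q"
  proof -
    have "(\<Sum>x\<leftarrow>[t * of_int c, t * of_int d]. (real_of_rat x)\<^sup>2) = real_of_rat t ^ 2 * q"
      by (simp add: q_def Q_def of_rat_mult power_mult_distrib distrib_left)
    then show ?thesis by (simp only: local_norm.simps real_sqrt_mult real_sqrt_abs)
  qed
  have EI: "height_E Infinite B = sqrt N / sqrt q"
    unfolding height_E_def B_def mat2_nth normN normq using T by simp
  have DI: "height_D Infinite B = sqrt N * sqrt q / \<bar>of_int D\<bar>"
    unfolding height_D_def detB unfolding B_def mat2_nth normN normq place_abs.simps of_rat_mult abs_mult
    using T by simp
  have normF2: "local_norm (Finite p) [t * of_int c, t * of_int d] = padic_abs p t * padic_abs p (of_int g)" if p: "prime p" for p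
  proof -
    obtain c' d' where c'd': "c = c' * g" "d = d' * g" "coprime c' d'"
      using gcd_coprime_exists[of c d] g unfolding g_def by auto
    have "max (padic_abs p (t * of_int c)) (padic_abs p (t * of_int d))
      = (padic_abs p t * padic_abs p (of_int g)) * max (padic_abs p (of_int c')) (padic_abs p (of_int d'))"
      unfolding c'd'(1,2) using padic_abs_nonneg[OF p]
      by (subst max_mult_distrib_left) (auto simp: padic_abs_mult[OF p] mult_ac)
    then show ?thesis unfolding local_norm_finite padic_max_coprime[OF p c'd'(3)] by simp
  qed
  have normF4: "local_norm (Finite p) [t * of_int a, t * of_int b, t * of_int c, t * of_int d] = padic_abs p t" if p: "prime p" for p
  proof -
    have "\<not> (int p dvd a \<and> int p dvd b \<and> int p dvd c \<and> int p dvd d)"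
    proof
      assume "int p dvd a \<and> int p dvd b \<and> int p dvd c \<and> int p dvd d"
      then have "int p dvd gcd a (gcd b (gcd c d))" by simp
      then show False using prim4 p by (metis not_prime_unit prime_nat_int_transfer)
    qed
    then have "padic_abs p (of_int a) = 1 \<or> padic_abs p (of_int b) = 1 \<or> padic_abs p (of_int c) = 1 \<or> padic_abs p (of_int d) = 1"
      by (metis not_int_prime_dvd_gcd[OF p] dvd_0_right)
    then have "max (padic_abs p (of_int a)) (max (padic_abs p (of_int b)) (max (padic_abs p (of_int c)) (padic_abs p (of_int d)))) = 1"
      using padic_abs_of_int_le_1[OF p] by (intro antisym) (auto simp: le_max_iff_disj)
    moreover have "max (padic_abs p t * padic_abs p (of_int a)) (max (padic_abs p t * padic_abs p (of_int b)) (max (padic_abs p t * padic_abs p (of_int c)) (padic_abs p t * padic_abs p (of_int d))))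
        = padic_abs p t * max (padic_abs p (of_int a)) (max (padic_abs p (of_int b)) (max (padic_abs p (of_int c)) (padic_abs p (of_int d))))"
      using padic_abs_nonneg[OF p, of t] by (simp add: max_mult_distrib_left)
    ultimately show ?thesis unfolding local_norm_finite padic_abs_mult[OF p] by simp
  qed
  have EF: "height_E (Finite p) B = 1 / padic_abs p (of_int g)" if p: "prime p" for p
    unfolding height_E_def B_def mat2_nth normF4[OF p] normF2[OF p] using padic_abs_pos[OF p t] by simp
  have DF: "height_D (Finite p) B = padic_abs p (of_int g) / padic_abs p (of_int D)" if p: "prime p" for p
    unfolding height_D_def detB unfolding B_def mat2_nth normF4[OF p] normF2[OF p] place_abs.simps padic_abs_mult[OF p]
    using padic_abs_pos[OF p t] by simp
  \<comment> \<open>Outside this finite set both g and D are units, so both local heights are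
    1.\<close>
  let ?S = "prime_divs (g * D)"
  have gD: "g * D \<noteq> 0" using g D by simp
  have ab: "padic_abs p (of_int g) > 0" "padic_abs p (of_int D) > 0" if "p \<in> ?S" for p
    using that g D by (auto intro!: padic_abs_pos simp: prime_divs_def)
  have fS: "finite ?S" by (rule finite_prime_divs[OF gD])
  have "height B s w = of_real (sqrt N * sqrt q / \<bar>of_int D\<bar>) powr s * of_real (sqrt N / sqrt q) powr w *
     (\<Prod>p\<in>?S. of_real (padic_abs p (of_int g) / padic_abs p (of_int D)) powr s * of_real (1 / padic_abs p (of_int g)) powr w)"
    unfolding height_def
  proof (subst prod_places_split[OF fS])
    show "prime p" if "p \<in> ?S" for p using that by (simp add: prime_divs_def)
    show "of_real (height_D (Finite p) B) powr s * of_real (height_E (Finite p) B) powr w = 1" if p: "prime p" "p \<notin> ?S" for p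
    proof -
      have "padic_abs p (of_int g) = 1" "padic_abs p (of_int D) = 1"
        using p g D multiplicity_prime_divs[OF p] by (simp_all add: padic_abs_inverse_power)
      then show ?thesis unfolding EF[OF p(1)] DF[OF p(1)] by simp
    qed
    show "of_real (height_D Infinite B) powr s * of_real (height_E Infinite B) powr w *
      (\<Prod>p\<in>?S. of_real (height_D (Finite p) B) powr s * of_real (height_E (Finite p) B) powr w)
      = of_real (sqrt N * sqrt q / \<bar>of_int D\<bar>) powr s * of_real (sqrt N / sqrt q) powr w *
     (\<Prod>p\<in>?S. of_real (padic_abs p (of_int g) / padic_abs p (of_int D)) powr s * of_real (1 / padic_abs p (of_int g)) powr w)"
      unfolding EI DI by (intro arg_cong2[of _ _ _ _ "(*)"] refl prod.cong) (auto simp: EF DF prime_divs_def)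
  qed
  also have "(\<Prod>p\<in>?S. of_real (padic_abs p (of_int g) / padic_abs p (of_int D)) powr s * of_real (1 / padic_abs p (of_int g)) powr w)
     = of_real (\<Prod>p\<in>?S. padic_abs p (of_int g) / padic_abs p (of_int D)) powr s * of_real (\<Prod>p\<in>?S. 1 / padic_abs p (of_int g)) powr w"
    unfolding prod.distrib by (intro arg_cong2[of _ _ _ _ "(*)"] prod_powr_of_real fS) (auto intro!: divide_pos_pos ab)
  also have "(\<Prod>p\<in>?S. padic_abs p (of_int g) / padic_abs p (of_int D)) = \<bar>of_int D\<bar> / of_int g"
    unfolding prod_dividef using prod_padic_abs[of g "g * D"] prod_padic_abs[of D "g * D"] g D by simp
  also have "(\<Prod>p\<in>?S. 1 / padic_abs p (of_int g)) = of_int g"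
    unfolding prod_dividef using prod_padic_abs[of g "g * D"] g D by simp
  finally have H: "height B s w = of_real (sqrt N * sqrt q / \<bar>of_int D\<bar>) powr s * of_real (sqrt N / sqrt q) powr w *
      (of_real (\<bar>of_int D\<bar> / of_int g) powr s * of_real (of_int g) powr w)" .
  \<comment> \<open>All bases are positive reals, so in logarithms the product of complex powers
    becomes a linear identity among exponents, in which \<open>lD\<close> cancels.\<close>
  define lN lq lD lg where "lN = complex_of_real (ln N)" and "lq = complex_of_real (ln q)"
    and "lD = complex_of_real (ln \<bar>of_int D\<bar>)" and "lg = complex_of_real (ln (of_int g))"
  have pos: "N > 0" "q > 0" "\<bar>real_of_int D\<bar> > 0" "real_of_int g > 0" using N q D g by auto
  have "height B s w = exp (s * (lN / 2 + lq / 2 - lD) + w * (lN / 2 - lq / 2) + (s * (lD - lg) + w * lg))"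
    unfolding H using pos
    by (subst (1 2 3 4) powr_of_real_exp) (simp_all add: exp_add ln_div ln_mult ln_sqrt lN_def lq_def lD_def lg_def)
  then have "inverse (height B s w) = exp (- (s * (lN / 2 + lq / 2 - lD) + w * (lN / 2 - lq / 2) + (s * (lD - lg) + w * lg)))"
    by (simp only: exp_minus)
  also have "- (s * (lN / 2 + lq / 2 - lD) + w * (lN / 2 - lq / 2) + (s * (lD - lg) + w * lg))
      = - ((s + w) / 2) * lN + ((s + w) / 2 - s) * (lq - 2 * lg)"
    by (simp add: field_simps)
  also have "exp \<dots> = tau s (s + w) (a, b, c, d)"
  proof -
    have "of_real (ln (q / of_int g ^ 2)) = lq - 2 * lg"
      using pos by (simp add: ln_div ln_realpow lq_def lg_def)
    then show ?thesis
      using pos unfolding tau_def prod.case N_def[symmetric] unfolding q_def[symmetric] g_def[symmetric]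
      by (subst (1 2) powr_of_real_exp) (simp_all add: exp_add[symmetric] lN_def)
  qed
  finally show ?thesis by (simp only: B)
qed

section \<open>Primitive quadruples as representatives of the classes of PGL(2)\<close>

definition S_rel :: "((rat^2^2) \<times> (rat^2^2)) set" where
  "S_rel = {(A, B). \<exists>t. t \<noteq> 0 \<and> B = mat t ** A}"

lemma S_rel_mat2: "(mat2 a b c d, B) \<in> S_rel \<longleftrightarrow> (\<exists>t. t \<noteq> 0 \<and> B = mat2 (t * a) (t * b) (t * c) (t * d))"
  by (simp add: S_rel_def mat_mat2 mat2_mult)

lemma S_rel_Image_eq:
  assumes "(A, B) \<in> S_rel"
  shows "S_rel `` {B} = S_rel `` {A}"
proof -
  obtain a b c d where A: "A = mat2 a b c d" by (rule mat2_cases)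
  obtain t where t: "t \<noteq> 0" "B = mat2 (t * a) (t * b) (t * c) (t * d)" using assms by (auto simp: A S_rel_mat2)
  have "(B, C) \<in> S_rel \<longleftrightarrow> (A, C) \<in> S_rel" for C
  proof
    assume "(B, C) \<in> S_rel"
    then obtain r where "r \<noteq> 0" "C = mat2 (r * (t * a)) (r * (t * b)) (r * (t * c)) (r * (t * d))"
      by (auto simp: t S_rel_mat2)
    then show "(A, C) \<in> S_rel" using t unfolding A S_rel_mat2 by (intro exI[of _ "r * t"]) (simp add: mult.assoc)
  next
    assume "(A, C) \<in> S_rel"
    then obtain r where "r \<noteq> 0" "C = mat2 (r * a) (r * b) (r * c) (r * d)"
      by (auto simp: A S_rel_mat2)
    then show "(B, C) \<in> S_rel" using t unfolding t(2) S_rel_mat2 by (intro exI[of _ "r / t"]) simp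
  qed
  then show ?thesis by blast
qed

lemma bij_quad_prim: "bij_betw (\<lambda>(e :: nat, a, b, c, d). (int e * a, int e * b, int e * c, int e * d)) ({0<..} \<times> quad_prim) quad"
proof (rule bij_betwI[of _ _ _ "\<lambda>x. case x of (a, b, c, d) \<Rightarrow> (nat (quad_gcd x), a div quad_gcd x, b div quad_gcd x, c div quad_gcd x, d div quad_gcd x)"])
  let ?f = "\<lambda>(e :: nat, a, b, c, d). (int e * a, int e * b, int e * c, int e * d)"
  let ?h = "\<lambda>x. case x of (a, b, c, d) \<Rightarrow> (nat (quad_gcd x), a div quad_gcd x, b div quad_gcd x, c div quad_gcd x, d div quad_gcd x)"
  have gm: "quad_gcd (e * a, e * b, e * c, e * d) = e * quad_gcd (a, b, c, d)" if "e > 0" for e a b c d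
    using that by (simp add: quad_gcd_def gcd_mult_left)
  have fq: "(e * a, e * b, e * c, e * d) \<in> quad \<longleftrightarrow> (a, b, c, d) \<in> quad" if "e > 0" for e a b c d
  proof -
    have "e * a * (e * d) - e * b * (e * c) = e * (e * (a * d - b * c))" by (simp add: algebra_simps)
    then show ?thesis using that by (auto simp: quad_def lexpos_def zero_less_mult_iff)
  qed
  show "?f \<in> {0<..} \<times> quad_prim \<rightarrow> quad"
    using fq by (auto simp: quad_prim_def)
  have H: "?h x \<in> {0<..} \<times> quad_prim \<and> ?f (?h x) = x" if x: "x \<in> quad" for x
  proof -
    obtain a b c d where xe: "x = (a, b, c, d)" by (cases x)
    define e where "e = quad_gcd x"
    have "e \<noteq> 0" using x by (auto simp: e_def xe quad_gcd_def quad_def)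
    then have e: "e > 0" by (simp add: e_def xe quad_gcd_def order_le_neq_trans)
    have "e dvd a" "e dvd b" "e dvd c" "e dvd d" unfolding e_def xe quad_gcd_def by (auto intro: dvd_trans)
    then obtain a' b' c' d' where ed: "a = e * a'" "b = e * b'" "c = e * c'" "d = e * d'" by (auto elim!: dvdE)
    have hx: "?h x = (nat e, a', b', c', d')"
      using e unfolding e_def[symmetric] xe[symmetric] by (simp add: xe e_def[symmetric, unfolded xe]) (simp add: ed)
    have "e = e * quad_gcd (a', b', c', d')" using gm[OF e, of a' b' c' d'] unfolding ed[symmetric] xe[symmetric] e_def[symmetric] by simp
    then have "quad_gcd (a', b', c', d') = 1" using e by simp
    moreover have "(a', b', c', d') \<in> quad" using fq[OF e, of a' b' c' d'] x unfolding xe ed by simp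
    ultimately show ?thesis unfolding hx using e by (simp add: quad_prim_def xe ed)
  qed
  show "?h \<in> quad \<rightarrow> {0<..} \<times> quad_prim" using H by blast
  show "?f (?h x) = x" if "x \<in> quad" for x using H[OF that] by blast
  show "?h (?f y) = y" if y: "y \<in> {0<..} \<times> quad_prim" for y
  proof -
    obtain e a b c d where ye: "y = (e, a, b, c, d)" by (cases y)
    have e: "e > 0" "quad_gcd (a, b, c, d) = 1" using y by (auto simp: ye quad_prim_def)
    have "quad_gcd (int e * a, int e * b, int e * c, int e * d) = int e"
      using gm[of "int e" a b c d] e by simp
    then show ?thesis using e by (simp add: ye)
  qed
qed

text \<open>Two proportional primitive quadruples have a positive ratio, because of their bottom
  rows, and equal contents force the ratio to be 1. Conversely, a rational matrix is scaled until
  its bottom row is primitive, then cleared of denominators and divided by its content.\<close>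

lemma bij_PGL2: "bij_betw (\<lambda>x. S_rel `` {imat x}) quad_prim PGL2_Q"
proof (rule bij_betw_imageI)
  have det: "det (imat x) \<noteq> 0" if "x \<in> quad" for x
  proof -
    obtain a b c d where x: "x = (a, b, c, d)" by (cases x)
    have "a * d - b * c \<noteq> 0" using that by (simp add: x quad_def)
    then have "(of_int (a * d - b * c) :: rat) \<noteq> 0" by (simp only: of_int_eq_0_iff not_False_eq_True)
    then show ?thesis unfolding x imat_def prod.case det_mat2 by (simp only: of_int_diff of_int_mult not_False_eq_True)
  qed
  show "inj_on (\<lambda>x. S_rel `` {imat x}) quad_prim"
  proof (rule inj_onI)
    fix x y assume xy: "x \<in> quad_prim" "y \<in> quad_prim" "S_rel `` {imat x} = S_rel `` {imat y}"
    obtain a b c d where x: "x = (a, b, c, d)" by (cases x)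
    obtain a' b' c' d' where y: "y = (a', b', c', d')" by (cases y)
    have "(imat y, imat y) \<in> S_rel" unfolding S_rel_def by (auto intro!: exI[of _ 1])
    then have "(imat x, imat y) \<in> S_rel" using xy(3) by blast
    then obtain t where t: "of_int a' = t * of_int a" "of_int b' = t * of_int b" "of_int c' = t * of_int c" "of_int d' = (t :: rat) * of_int d"
      by (auto simp: x y imat_def S_rel_mat2 mat2_eq_iff)
    have "t > 0" using lexpos_proportional[OF t(3,4)] xy(1,2) by (auto simp: x y quad_prim_def quad_def)
    moreover obtain m n where mn: "t = of_int m / of_int n" "n > 0" by (rule rat_quotient_cases)
    ultimately have m: "m > 0" by (simp add: zero_less_divide_iff)
    have "(of_int (n * a') :: rat) = of_int (m * a)" "(of_int (n * b') :: rat) = of_int (m * b)"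
      "(of_int (n * c') :: rat) = of_int (m * c)" "(of_int (n * d') :: rat) = of_int (m * d)"
      using mn t by (simp_all add: field_simps)
    then have "n * a' = m * a" "n * b' = m * b" "n * c' = m * c" "n * d' = m * d" by (simp_all only: of_int_eq_iff)
    then have "quad_gcd (n * a', n * b', n * c', n * d') = quad_gcd (m * a, m * b, m * c, m * d)" by simp
    then have "n * quad_gcd y = m * quad_gcd x" using mn m by (simp add: x y quad_gcd_def gcd_mult_left)
    then have "t = 1" using mn xy(1,2) by (simp add: quad_prim_def)
    then show "x = y" using t by (simp add: x y)
  qed
  show "(\<lambda>x. S_rel `` {imat x}) ` quad_prim = PGL2_Q"
  proof (intro equalityI subsetI)
    fix X assume "X \<in> (\<lambda>x. S_rel `` {imat x}) ` quad_prim"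
    then show "X \<in> PGL2_Q"
      unfolding PGL2_Q_def S_rel_def[symmetric] by (auto simp: GL2_Q_def quad_prim_def intro!: quotientI det)
  next
    fix X assume "X \<in> PGL2_Q"
    then obtain A where A: "A \<in> GL2_Q" "X = S_rel `` {A}"
      unfolding PGL2_Q_def S_rel_def[symmetric] by (auto elim: quotientE)
    obtain a b c d where Ae: "A = mat2 a b c d" by (rule mat2_cases)
    have det: "a * d - b * c \<noteq> 0" using A(1) by (simp add: Ae GL2_Q_def det_mat2)
    then have "c \<noteq> 0 \<or> d \<noteq> 0" by auto
    then obtain z c0 d0 where z: "z \<noteq> 0" "(c0, d0) \<in> prim" "c = z * of_int c0" "d = z * of_int d0"
      by (rule rat_pair_prim)
    obtain m n where a: "a / z = of_int m / of_int n" "n > 0" by (rule rat_quotient_cases)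
    obtain m' n' where b: "b / z = of_int m' / of_int n'" "n' > 0" by (rule rat_quotient_cases)
    \<comment> \<open>A common denominator of the rescaled top row. It is positive, so the bottom
      row stays in \<open>lexpos\<close>.\<close>
    define r where "r = n * n'"
    have r: "r > 0" using a b by (simp add: r_def)
    define y where "y = (m * n', m' * n, r * c0, r * d0)"
    have ya: "a = z / of_int r * of_int (m * n')" "b = z / of_int r * of_int (m' * n)"
      "c = z / of_int r * of_int (r * c0)" "d = z / of_int r * of_int (r * d0)"
      using a b z r by (simp_all add: r_def field_simps)
    have zr: "z / of_int r \<noteq> 0" using z r by simp
    have yq: "y \<in> quad"
    proof -
      have "(a * d - b * c) = (z / of_int r) * ((z / of_int r) * of_int (m * n' * (r * d0) - m' * n * (r * c0)))"
        unfolding ya by (simp only: of_int_diff of_int_mult) (simp add: algebra_simps)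
      then have "m * n' * (r * d0) - m' * n * (r * c0) \<noteq> 0"
        using det by (metis mult_zero_right of_int_0)
      then show ?thesis using prim_lexpos[OF z(2)] r by (auto simp: y_def quad_def lexpos_def zero_less_mult_iff)
    qed
    then have "y \<in> (\<lambda>(e :: nat, a, b, c, d). (int e * a, int e * b, int e * c, int e * d)) ` ({0<..} \<times> quad_prim)"
      using bij_quad_prim by (simp add: bij_betw_def)
    then obtain e a1 b1 c1 d1 where e: "e > (0 :: nat)" "(a1, b1, c1, d1) \<in> quad_prim"
      "y = (int e * a1, int e * b1, int e * c1, int e * d1)" by auto
    have "(imat (a1, b1, c1, d1), A) \<in> S_rel"
    proof -
      have y1: "m * n' = int e * a1" "m' * n = int e * b1" "r * c0 = int e * c1" "r * d0 = int e * d1"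
        using e(3) by (simp_all add: y_def)
      show ?thesis
        unfolding imat_def prod.case S_rel_mat2 Ae mat2_eq_iff ya y1
        using e(1) zr by (intro exI[of _ "z / of_int r * of_nat e"]) (simp add: mult.assoc)
    qed
    then have "X = S_rel `` {imat (a1, b1, c1, d1)}" using A(2) S_rel_Image_eq by blast
    then show "X \<in> (\<lambda>x. S_rel `` {imat x}) ` quad_prim" using e(2) by blast
  qed
qed

lemma height_zeta_term_eq:
  assumes "x \<in> quad_prim"
  shows "height_zeta_term s w (S_rel `` {imat x}) = tau s (s + w) x"
proof -
  obtain a b c d where x: "x = (a, b, c, d)" by (cases x)
  have H: "height B s w = inverse (tau s (s + w) x)" if B: "(imat x, B) \<in> S_rel" for B
  proof -
    obtain t where "t \<noteq> 0" "B = mat t ** imat x" using B by (auto simp: S_rel_def)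
    then show ?thesis using height_imat[of a b c d t s w] assms unfolding x by (metis inverse_inverse_eq)
  qed
  moreover have "(imat x, imat x) \<in> S_rel" unfolding S_rel_def by (auto intro!: exI[of _ 1])
  ultimately have "(\<lambda>A. height A s w) ` (S_rel `` {imat x}) = {inverse (tau s (s + w) x)}" by (auto simp: image_iff)
  then show ?thesis by (simp add: height_zeta_term_def)
qed

section \<open>The height zeta function\<close>

lemma has_sum_product_complex:
  fixes f :: "'a \<Rightarrow> complex" and g :: "'b \<Rightarrow> complex"
  assumes f: "(f has_sum a) A" and g: "(g has_sum b) B"
  shows "((\<lambda>(x, y). f x * g y) has_sum (a * b)) (A \<times> B)"
proof (rule has_sum_SigmaI)
  show "((\<lambda>y. case (x, y) of (x, y) \<Rightarrow> f x * g y) has_sum f x * b) B" for x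
    unfolding prod.case by (rule has_sum_cmult_right[OF g])
  show "((\<lambda>x. f x * b) has_sum a * b) A" by (rule has_sum_cmult_left[OF f])
  have "(\<lambda>x. norm (f x)) summable_on A" "(\<lambda>y. norm (g y)) summable_on B"
    using has_sum_imp_summable[OF f] has_sum_imp_summable[OF g] by (simp_all add: summable_on_iff_abs_summable_on_complex)
  then have "(\<lambda>(x, y). norm (f x) * norm (g y)) summable_on A \<times> B" by (rule summable_on_product) auto
  then have "(\<lambda>p. norm (case p of (x, y) \<Rightarrow> f x * g y)) summable_on A \<times> B"
    by (simp add: norm_mult case_prod_unfold)
  then show "(\<lambda>(x, y). f x * g y) summable_on A \<times> B" by (rule abs_summable_summable)
qed

text \<open>On the line through a primitive p, the point k p satisfies Q (k p) + g^2 Q p = Q p (k^2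
  + g^2). The excluded line thus contributes a power of Q p times this sum over k, which depends on
  g only; \<open>halfplane\<close> collects it over all g > 0.\<close>

definition row :: "complex \<Rightarrow> nat \<Rightarrow> complex" where
  "row s g = (\<Sum>\<^sub>\<infinity>k. of_real (Q (k, int g)) powr (- s))"

definition halfplane :: "complex \<Rightarrow> complex" where
  "halfplane s = (\<Sum>\<^sub>\<infinity>(g, k)\<in>{0<..} \<times> UNIV. of_real (Q (k, int g)) powr (- s))"

lemma Q_half_summable:
  assumes "\<sigma> > (1 :: real)"
  shows "(\<lambda>(g, k). Q (k, int g) powr (- \<sigma>)) summable_on {0<..} \<times> UNIV"
proof -
  have "inj_on (\<lambda>(g, k). (k, int g)) ({0<..} \<times> UNIV)" by (auto simp: inj_on_def)
  from summable_on_reindex[OF this, of "\<lambda>p. Q p powr (- \<sigma>)"]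
  have "(\<lambda>p. Q p powr (- \<sigma>)) \<circ> (\<lambda>(g, k). (k, int g)) summable_on {0<..} \<times> UNIV"
    using Q_summable[OF assms] by simp
  then show ?thesis by (simp add: o_def case_prod_unfold)
qed

lemma Q_ge_1: "(a, b) \<noteq> (0, 0) \<Longrightarrow> Q (a, b) \<ge> 1"
proof -
  assume "(a, b) \<noteq> (0, 0)"
  then have "a ^ 2 + b ^ 2 > 0" by (auto simp: sum_power2_gt_zero_iff)
  then show ?thesis unfolding Q_def fst_conv snd_conv by linarith
qed

lemma halfplane_holomorphic: "halfplane holomorphic_on {s. Re s > 1}"
proof -
  have "(\<lambda>s. \<Sum>\<^sub>\<infinity>x\<in>{0<..} \<times> UNIV. of_real (case x of (g, k) \<Rightarrow> Q (k, int g)) powr (- s) :: complex) holomorphic_on {s. Re s > 1}"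
  proof (rule dirichlet_holomorphic)
    show "1 \<le> (case x of (g :: nat, k) \<Rightarrow> Q (k, int g))" if "x \<in> {0<..} \<times> UNIV" for x
      using that by (auto intro: Q_ge_1)
    show "(\<lambda>x. (case x of (g, k) \<Rightarrow> Q (k, int g)) powr - \<sigma>) summable_on {0<..} \<times> UNIV" if "1 < \<sigma>" for \<sigma>
      using Q_half_summable[OF that] by (simp add: case_prod_unfold)
  qed
  then show ?thesis by (simp add: halfplane_def[abs_def] case_prod_unfold)
qed

lemma row_has_sum:
  assumes s: "Re s > 1"
  shows "g > 0 \<Longrightarrow> ((\<lambda>k. of_real (Q (k, int g)) powr (- s)) has_sum row s g) UNIV"
    and "(row s has_sum halfplane s) {0<..}"
proof -
  let ?f = "\<lambda>x :: nat \<times> int. of_real (case x of (g, k) \<Rightarrow> Q (k, int g)) powr (- s) :: complex"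
  have "(\<lambda>x. norm (?f x)) summable_on {0<..} \<times> UNIV"
  proof (rule dirichlet_summable)
    show "0 < (case x of (g :: nat, k) \<Rightarrow> Q (k, int g))" if "x \<in> {0<..} \<times> UNIV" for x
      using that Q_ge_1 by (auto intro!: order_less_le_trans[OF zero_less_one])
    show "(\<lambda>x. (case x of (g, k) \<Rightarrow> Q (k, int g)) powr - Re s) summable_on {0<..} \<times> UNIV"
      using Q_half_summable[OF s] by (simp add: case_prod_unfold)
  qed
  then have sm: "?f summable_on {0<..} \<times> UNIV" by (rule abs_summable_summable)
  then have sm': "(\<lambda>(g :: nat, k). of_real (Q (k, int g)) powr (- s) :: complex) summable_on {0<..} \<times> UNIV"
    by (simp add: case_prod_unfold)
  have 1: "((\<lambda>k. of_real (Q (k, int g)) powr (- s)) has_sum row s g) UNIV" if "g > 0" for g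
    unfolding row_def by (rule has_sum_infsum, rule summable_on_SigmaD1[OF sm']) (use that in simp)
  then show "g > 0 \<Longrightarrow> ((\<lambda>k. of_real (Q (k, int g)) powr (- s)) has_sum row s g) UNIV" .
  have "((\<lambda>(g :: nat, k). of_real (Q (k, int g)) powr (- s)) has_sum halfplane s) ({0<..} \<times> UNIV)"
    unfolding halfplane_def by (rule has_sum_infsum[OF sm'])
  then show "(row s has_sum halfplane s) {0<..}"
    by (rule has_sum_Sigma') (use 1 in auto)
qed

section \<open>The sum of the error terms\<close>

definition lat_err :: "complex \<Rightarrow> real \<Rightarrow> complex" where
  "lat_err s R = lat s R - of_real pi / (s - 1) * of_real R powr (1 - s)"

definition phi_term :: "nat \<times> int \<times> int \<Rightarrow> complex \<times> complex \<Rightarrow> complex" where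
  "phi_term = (\<lambda>(g, p) (s, w). of_real (Q p) powr ((s + w) / 2 - s) * lat_err ((s + w) / 2) (real g ^ 2 * Q p))"

definition phi :: "complex \<times> complex \<Rightarrow> complex" where
  "phi z = (\<Sum>\<^sub>\<infinity>x\<in>{0<..} \<times> prim. phi_term x z)"

text \<open>This is \<open>region\<close> for \<epsilon> = 1/4. The bound 7/4 makes 1/2 - Re s at
  most - 5/4, within the range of convergence of the sum over primitive vectors.\<close>

definition strip :: "(complex \<times> complex) set" where
  "strip = {(s, w). Re s > 7 / 4 \<and> Re (s + w) > 2}"

lemma open_strip: "open strip"
proof -
  have "strip = {z. Re (fst z) > 7 / 4} \<inter> {z. Re (fst z + snd z) > 2}" by (auto simp: strip_def)
  also have "open \<dots>"
    by (intro open_Int open_Collect_less continuous_intros)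
  finally show ?thesis .
qed

lemma phi_term_holomorphic:
  assumes "x \<in> {0<..} \<times> prim"
  shows "holomorphic2_on (phi_term x) strip"
proof -
  obtain g p where x: "x = (g, p)" "g > 0" "p \<in> prim" using assms by auto
  have q: "Q p \<ge> 1" by (rule Q_pos[OF prim_lexpos[OF x(3)]])
  have R: "real g ^ 2 * Q p \<ge> 1"
  proof -
    have "1 * 1 \<le> real g ^ 2 * Q p" using x(2) q by (intro mult_mono) auto
    then show ?thesis by simp
  qed
  have 1: "holomorphic2_on (\<lambda>(s, w). (\<lambda>z. of_real (Q p) powr z) ((- 1 / 2) * s + (1 / 2) * w + 0)) strip"
    by (rule holomorphic2_on_compose_affine[of _ UNIV]) (auto intro!: holomorphic_intros)
  have "(\<lambda>s. lat_err s (real g ^ 2 * Q p)) holomorphic_on {s. Re s > 1}"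
    unfolding lat_err_def by (intro holomorphic_intros lat_holomorphic[OF R]) auto
  then have 2: "holomorphic2_on (\<lambda>(s, w). (\<lambda>z. lat_err z (real g ^ 2 * Q p)) ((1 / 2) * s + (1 / 2) * w + 0)) strip"
    by (rule holomorphic2_on_compose_affine) (auto simp: open_halfspace_Re_gt strip_def)
  have "phi_term x = (\<lambda>z. (case z of (s, w) \<Rightarrow> (\<lambda>z. of_real (Q p) powr z) ((- 1 / 2) * s + (1 / 2) * w + 0))
      * (case z of (s, w) \<Rightarrow> (\<lambda>z. lat_err z (real g ^ 2 * Q p)) ((1 / 2) * s + (1 / 2) * w + 0)))"
    by (auto simp: phi_term_def x fun_eq_iff field_simps)
  then show ?thesis using holomorphic2_on_mult[OF 1 2] by simp
qed

text \<open>With v = (s + w) / 2, the prefactor and the estimate of \<open>lat_asymp\<close> combine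
  to g powr (1 - 2 Re v) times Q p powr (1/2 - Re s): v drops out of the exponent of Q p, and the
  double sum is dominated by a product of convergent sums.\<close>

lemma phi_bound:
  assumes z0: "z0 \<in> strip"
  shows "\<exists>V M. open V \<and> z0 \<in> V \<and> M summable_on {0<..} \<times> prim \<and> (\<forall>x\<in>{0<..} \<times> prim. \<forall>z\<in>V. norm (phi_term x z) \<le> M x)"
proof -
  obtain s0 w0 where z0e: "z0 = (s0, w0)" by (cases z0)
  have re: "Re s0 > 7 / 4" "Re (s0 + w0) > 2" using z0 by (auto simp: z0e strip_def)
  \<comment> \<open>Half of the distance of Re (s0 + w0) from 2, so that the exponent of g stays
    below - (1 + \<delta>) near z0.\<close>
  define \<delta> where "\<delta> = (Re (s0 + w0) - 2) / 2"
  have \<delta>: "\<delta> > 0" "Re (s0 + w0) > 2 + \<delta>" using re by (auto simp: \<delta>_def field_simps)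
  define B where "B = norm (s0 + w0) + 1"
  define V where "V = {z. Re (fst z) > 7 / 4} \<inter> {z. Re (fst z + snd z) > 2 + \<delta>} \<inter> {z. norm (fst z + snd z) < B}"
  \<comment> \<open>The constant of \<open>lat_asymp\<close>, made uniform by norm v \<le> B and Re
    v - 1/2 \<ge> 1/2.\<close>
  define C where "C = B * 8 * 9 powr (B + 1) * (pi / (1 / 2))"
  define M where "M = (\<lambda>x :: nat \<times> int \<times> int. C * (case x of (g, p) \<Rightarrow> real g powr (- (1 + \<delta>)) * Q p powr (- (5 / 4))))"
  have B: "B > 0" by (simp add: B_def add_nonneg_pos)
  have C: "C \<ge> 0" using B by (simp add: C_def)
  have "(\<lambda>(g, p). real g powr (- (1 + \<delta>)) * Q p powr (- (5 / 4))) summable_on {0<..} \<times> prim"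
    by (rule summable_on_product[OF summable_powr_pos Q_summable]) (use \<delta> in auto)
  then have M: "M summable_on {0<..} \<times> prim"
    unfolding M_def by (rule summable_on_cmult_right)
  have "open V" unfolding V_def by (intro open_Int open_Collect_less continuous_intros)
  moreover have "z0 \<in> V" using re \<delta> by (simp add: V_def z0e B_def)
  moreover have "norm (phi_term x z) \<le> M x" if x: "x \<in> {0<..} \<times> prim" and z: "z \<in> V" for x z
  proof -
    obtain g p where xe: "x = (g, p)" "g > 0" "p \<in> prim" using x by auto
    obtain s w where ze: "z = (s, w)" by (cases z)
    define v where "v = (s + w) / 2"
    have sw: "Re s > 7 / 4" "Re v > 1 + \<delta> / 2" "norm v \<le> B" "Re v \<le> B"
    proof -
      show "Re s > 7 / 4" "Re v > 1 + \<delta> / 2" using z by (auto simp: V_def ze v_def)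
      have "norm v = norm (s + w) / 2" by (simp add: v_def norm_divide)
      then show "norm v \<le> B" using z B by (auto simp: V_def ze)
      then show "Re v \<le> B" using complex_Re_le_cmod[of v] by linarith
    qed
    have q: "Q p \<ge> 1" by (rule Q_pos[OF prim_lexpos[OF xe(3)]])
    have g: "real g \<ge> 1" using xe(2) by simp
    have R: "real g ^ 2 * Q p \<ge> 1"
    proof -
      have "1 * 1 \<le> real g ^ 2 * Q p" using g q by (intro mult_mono) auto
      then show ?thesis by simp
    qed
    have "norm (lat_err v (real g ^ 2 * Q p)) \<le> norm v * 8 * 9 powr (Re v + 1) * (pi / (Re v - 1 / 2)) * (real g ^ 2 * Q p) powr (1 / 2 - Re v)"
      unfolding lat_err_def by (rule lat_asymp[OF _ R]) (use sw \<delta> in linarith)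
    also have "\<dots> \<le> C * (real g ^ 2 * Q p) powr (1 / 2 - Re v)"
      unfolding C_def using sw \<delta> B
      by (intro mult_right_mono mult_mono powr_mono divide_left_mono) auto
    also have "(real g ^ 2 * Q p) powr (1 / 2 - Re v) = real g powr (1 - 2 * Re v) * Q p powr (1 / 2 - Re v)"
      using g q powr_powr[of "real g" 2 "1 / 2 - Re v"] by (simp add: powr_mult)
    finally have L: "norm (lat_err v (real g ^ 2 * Q p)) \<le> C * (real g powr (1 - 2 * Re v) * Q p powr (1 / 2 - Re v))" .
    have "norm (phi_term x z) = Q p powr (Re v - Re s) * norm (lat_err v (real g ^ 2 * Q p))"
      using q by (simp add: phi_term_def xe ze norm_mult norm_powr_real_powr v_def)
    also have "\<dots> \<le> Q p powr (Re v - Re s) * (C * (real g powr (1 - 2 * Re v) * Q p powr (1 / 2 - Re v)))"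
      by (intro mult_left_mono L) auto
    also have "\<dots> = C * (real g powr (1 - 2 * Re v) * (Q p powr (Re v - Re s) * Q p powr (1 / 2 - Re v)))" by simp
    also have "Q p powr (Re v - Re s) * Q p powr (1 / 2 - Re v) = Q p powr (1 / 2 - Re s)"
      by (simp add: powr_add[symmetric])
    also have "C * (real g powr (1 - 2 * Re v) * Q p powr (1 / 2 - Re s)) \<le> C * (real g powr (- (1 + \<delta>)) * Q p powr (- (5 / 4)))"
      using C sw g q by (intro mult_left_mono mult_mono powr_mono) auto
    finally show ?thesis by (simp add: M_def xe)
  qed
  ultimately show ?thesis using M by (intro exI[of _ V] exI[of _ M]) auto
qed

lemma phi_holomorphic: "holomorphic2_on phi strip"
  unfolding phi_def[abs_def] by (rule holomorphic2_on_infsum[OF open_strip phi_term_holomorphic phi_bound])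

lemma phi_has_sum:
  assumes "z \<in> strip"
  shows "((\<lambda>x. phi_term x z) has_sum phi z) ({0<..} \<times> prim)"
proof -
  obtain V M where V: "z \<in> V" "M summable_on {0<..} \<times> prim" "\<forall>x\<in>{0<..} \<times> prim. \<forall>z\<in>V. norm (phi_term x z) \<le> M x"
    using phi_bound[OF assms] by blast
  have "(\<lambda>x. norm (phi_term x z)) summable_on {0<..} \<times> prim"
    by (rule Infinite_Sum.abs_summable_on_comparison_test'[OF V(2)]) (use V in auto)
  then show ?thesis unfolding phi_def by (rule has_sum_infsum[OF abs_summable_summable])
qed

section \<open>Summation over integer matrices\<close>

lemma tau_summable:
  assumes s: "Re s > 4" and w: "Re w > 4"
  shows "tau s (s + w) summable_on quad"
proof -
  let ?M = "\<lambda>((a, b), (c, d)). (Q (a, b) + 1) powr (- 2) * Q (c, d) powr (- 2)"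
  have "(\<lambda>(x, y). (Q x + 1) powr (- 2) * Q y powr (- 2)) summable_on UNIV \<times> UNIV"
    by (rule summable_on_product[OF lat_summable Q_summable]) auto
  then have "(\<lambda>(x, y). (Q x + 1) powr (- 2) * Q y powr (- 2)) summable_on (\<lambda>(a, b, c, d). ((a, b), (c, d))) ` quad"
    by (rule summable_on_subset_banach) auto
  moreover have "inj_on (\<lambda>(a, b, c, d). ((a, b), (c, d))) quad" by (auto simp: inj_on_def)
  ultimately have sm: "(\<lambda>(a, b, c, d). (Q (a, b) + 1) powr (- 2) * Q (c, d) powr (- 2)) summable_on quad"
    by (subst (asm) summable_on_reindex) (auto simp: o_def case_prod_unfold)
  show ?thesis
  proof (rule abs_summable_summable, rule Infinite_Sum.abs_summable_on_comparison_test'[OF sm])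
    fix x assume x: "x \<in> quad"
    obtain a b c d where xe: "x = (a, b, c, d)" by (cases x)
    have cd: "(c, d) \<in> lexpos" using x by (simp add: xe quad_def)
    define g where "g = gcd c d"
    define q where "q = Q (c, d)"
    define n where "n = q / of_int g ^ 2"
    define N where "N = Q (a, b) + q"
    have g0: "g > 0" using cd by (auto simp: g_def lexpos_def)
    then have g: "real_of_int g \<ge> 1" by simp
    have q: "q \<ge> 1" using Q_pos[OF cd] by (simp add: q_def)
    have n1: "n \<ge> 1"
    proof -
      obtain c' d' where c'd': "c = c' * g" "d = d' * g" "coprime c' d'"
        using gcd_coprime_exists[of c d] g0 unfolding g_def by auto
      have "q = of_int g ^ 2 * Q (c', d')" unfolding q_def c'd'(1,2) using Q_mult[of g c' d'] by (simp add: mult.commute)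
      then have "n = Q (c', d')" using g by (simp add: n_def)
      moreover have "(c', d') \<noteq> (0, 0)" using c'd' cd by (auto simp: lexpos_def)
      ultimately show ?thesis using Q_ge_1 by simp
    qed
    have nq: "n \<le> q" unfolding n_def using g q by (simp add: divide_le_eq mult_le_cancel_left1)
    have N: "N \<ge> q" using Q_nonneg[of "(a, b)"] by (simp add: N_def)
    have pos: "N > 0" "n > 0" using N q n1 by linarith+
    have "norm (tau s (s + w) x) = N powr (- ((Re s + Re w) / 2)) * n powr ((Re s + Re w) / 2 - Re s)"
      using pos unfolding xe tau_def prod.case norm_mult N_def[symmetric, unfolded q_def] q_def[symmetric] g_def[symmetric] n_def[symmetric]
      by (subst (1 2) norm_powr_real_powr) (auto simp: N_def q_def)
    \<comment> \<open>In this form the real parts of s and w are separated. Since 1 \<le> n \<le> q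
      \<le> N both bases are at least 1, and real parts above 4 permit replacing both exponents by
      -2, which leaves N powr (-4).\<close>
    also have "\<dots> = (N * n) powr (- Re s / 2) * (N / n) powr (- Re w / 2)"
      using pos by (simp add: powr_def ln_mult ln_div exp_add[symmetric] algebra_simps add_divide_distrib diff_divide_distrib)
    also have "\<dots> \<le> (N * n) powr (- 2) * (N / n) powr (- 2)"
    proof -
      have "1 * 1 \<le> N * n" using N q n1 by (intro mult_mono) auto
      moreover have "1 \<le> N / n" using N nq pos by (simp add: le_divide_eq)
      ultimately show ?thesis using s w by (intro mult_mono powr_mono) auto
    qed
    also have "\<dots> = N powr (- 2) * N powr (- 2)"
      using pos by (simp add: powr_def ln_mult ln_div exp_add[symmetric] algebra_simps)
    also have "\<dots> \<le> (Q (a, b) + 1) powr (- 2) * q powr (- 2)"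
      using N q Q_nonneg[of "(a, b)"] by (intro mult_mono powr_mono2') (auto simp: N_def)
    finally show "norm (tau s (s + w) x) \<le> (case x of (a, b, c, d) \<Rightarrow> (Q (a, b) + 1) powr (- 2) * Q (c, d) powr (- 2))"
      by (simp add: xe q_def)
  qed
qed

lemma tau_quad_prim:
  assumes s: "Re s > 4" and w: "Re w > 4"
  obtains Z where "(tau s (s + w) has_sum Z) quad_prim" "(tau s (s + w) has_sum (zeta_ser (s + w) * Z)) quad"
proof -
  define Z where "Z = infsum (tau s (s + w)) quad_prim"
  have sm: "tau s (s + w) summable_on quad" by (rule tau_summable[OF s w])
  then have "tau s (s + w) summable_on quad_prim"
    by (rule summable_on_subset_banach) (auto simp: quad_prim_def)
  then have Z: "(tau s (s + w) has_sum Z) quad_prim" unfolding Z_def by (rule has_sum_infsum)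
  have u: "Re (s + w) > 1" using s w by simp
  have eq: "tau s (s + w) (case x of (e, a, b, c, d) \<Rightarrow> (int e * a, int e * b, int e * c, int e * d))
      = (case x of (e, y) \<Rightarrow> of_real (real e) powr (- (s + w)) * tau s (s + w) y)" if x: "x \<in> {0<..} \<times> quad_prim" for x
  proof -
    obtain e a b c d where xe: "x = (e, a, b, c, d)" "e > 0" using x by (cases x) auto
    have e: "real e > 0" using xe by simp
    have cd: "(c, d) \<in> lexpos" using x by (auto simp: xe quad_prim_def quad_def)
    have N: "Q (int e * a, int e * b) + Q (int e * c, int e * d) = real e ^ 2 * (Q (a, b) + Q (c, d))"
      by (simp add: Q_mult distrib_left)
    have gg: "gcd (int e * c) (int e * d) = int e * gcd c d" by (simp add: gcd_mult_left)
    have n: "Q (int e * c, int e * d) / of_int (gcd (int e * c) (int e * d)) ^ 2 = Q (c, d) / of_int (gcd c d) ^ 2"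
      unfolding gg using e by (simp add: Q_mult power_mult_distrib)
    have "of_real (real e ^ 2 * (Q (a, b) + Q (c, d))) powr (- ((s + w) / 2))
       = of_real (real e) powr (- (s + w)) * (of_real (Q (a, b) + Q (c, d)) powr (- ((s + w) / 2)) :: complex)"
    proof -
      have "2 * (- (t / 2)) = - t" for t :: complex by simp
      from this[of "s + w"] have "2 * (- ((s + w) / 2)) = - (s + w)" .
      then show ?thesis
        using powr_of_square_mult[OF e, of "Q (a, b) + Q (c, d)" "- ((s + w) / 2)"] Q_nonneg[of "(a, b)"] Q_nonneg[of "(c, d)"]
        by (metis add_nonneg_nonneg)
    qed
    then show ?thesis unfolding xe tau_def prod.case N n by simp
  qed
  have "((\<lambda>(e, y). of_real (real e) powr (- (s + w)) * tau s (s + w) y) has_sum (zeta_ser (s + w) * Z)) ({0<..} \<times> quad_prim)"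
    by (rule has_sum_product_complex[OF zeta_ser_has_sum[OF u] Z])
  then have "((\<lambda>x. tau s (s + w) (case x of (e, a, b, c, d) \<Rightarrow> (int e * a, int e * b, int e * c, int e * d))) has_sum (zeta_ser (s + w) * Z)) ({0<..} \<times> quad_prim)"
    by (rule has_sum_cong[THEN iffD1, rotated]) (rule eq[symmetric])
  then have "(tau s (s + w) has_sum (zeta_ser (s + w) * Z)) quad"
    using has_sum_reindex_bij_betw[OF bij_quad_prim, of "tau s (s + w)"] by simp
  then show ?thesis using that Z by blast
qed

text \<open>The matrices are sliced by their bottom row g p with p primitive. In a slice the second
  factor of \<open>tau\<close> is constant, and the first gives a full lattice sum minus the sum
  over the line of top rows proportional to p.\<close>

lemma tau_quad:
  assumes s: "Re s > 4" and w: "Re w > 4"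
  defines "u \<equiv> s + w"
  shows "(tau s u has_sum (of_real pi / (u / 2 - 1) * zeta_ser (u - 2) * eis (s - 1) + phi (s, w) - halfplane (u / 2) * eis s)) quad"
proof -
  define C where "C = of_real pi / (u / 2 - 1)"
  let ?\<phi> = "\<lambda>((g, c, d), (a, b)). (a, b, int g * c, int g * d)"
  let ?B = "\<lambda>(g :: nat, c, d). {(a, b). a * d - b * c \<noteq> (0 :: int)}"
  have bij: "bij_betw ?\<phi> (Sigma ({0<..} \<times> prim) ?B) quad"
  proof (rule bij_betwI[of _ _ _ "\<lambda>(a, b, c, d). ((nat (gcd c d), c div gcd c d, d div gcd c d), (a, b))"])
    let ?h = "\<lambda>(a, b, c, d). ((nat (gcd c d), c div gcd c d, d div gcd c d), (a, b))"
    have detg: "a * (int g * d) - b * (int g * c) = int g * (a * d - b * c)" for a b c d g by (simp add: algebra_simps)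
    show "?\<phi> \<in> Sigma ({0<..} \<times> prim) ?B \<rightarrow> quad"
      by (auto simp: quad_def detg prim_def lexpos_def simp del: mult_eq_0_iff) (auto simp: detg)
    have H: "?h x \<in> Sigma ({0<..} \<times> prim) ?B \<and> ?\<phi> (?h x) = x" if x: "x \<in> quad" for x
    proof -
      obtain a b c d where xe: "x = (a, b, c, d)" by (cases x)
      have cd: "(c, d) \<in> lexpos" "a * d - b * c \<noteq> 0" using x by (auto simp: xe quad_def)
      then have "(c, d) \<in> (\<lambda>(g :: nat, c, d). (int g * c, int g * d)) ` ({0<..} \<times> prim)"
        using bij_prim by (simp add: bij_betw_def)
      then obtain g c' d' where g: "g > (0 :: nat)" "(c', d') \<in> prim" "c = int g * c'" "d = int g * d'" by auto
      have gcd: "gcd c d = int g" using g by (simp add: gcd_mult_left prim_def)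
      have "?h x = ((g, c', d'), (a, b))" using g(1) unfolding xe prod.case gcd unfolding g(3,4) by simp
      moreover have "a * d' - b * c' \<noteq> 0" using cd(2) unfolding g(3,4) detg by simp
      ultimately show ?thesis using g by (simp add: xe)
    qed
    show "?h \<in> quad \<rightarrow> Sigma ({0<..} \<times> prim) ?B" using H by blast
    show "?\<phi> (?h x) = x" if "x \<in> quad" for x using H[OF that] by blast
    show "?h (?\<phi> y) = y" if y: "y \<in> Sigma ({0<..} \<times> prim) ?B" for y
    proof -
      obtain g c d a b where ye: "y = ((g, c, d), (a, b))" by (metis surj_pair)
      have g: "g > 0" "(c, d) \<in> prim" using y by (auto simp: ye)
      have "gcd (int g * c) (int g * d) = int g" using g by (simp add: gcd_mult_left prim_def)
      then show ?thesis using g by (simp add: ye)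
    qed
  qed
  have v: "Re (u / 2) > 1" using s w by (simp add: u_def)
  define f where "f = (\<lambda>x. tau s u (?\<phi> x))"
  \<comment> \<open>The value of a slice: main term of the lattice sum, its error, and the line that
    is taken away. The first and the last are products of a function of g and one of p, so their
    double sums factor.\<close>
  define b where "b = (\<lambda>(g, p). C * (of_real (real g) powr (- (u - 2)) * of_real (Q p) powr (- (s - 1)))
      + phi_term (g, p) (s, w) - row (u / 2) g * of_real (Q p) powr (- s))"
  have fsum: "((\<lambda>y. f ((g, p), y)) has_sum b (g, p)) (?B (g, p))" if gp: "(g, p) \<in> {0<..} \<times> prim" for g p
  proof -
    obtain c d where p: "p = (c, d)" by (cases p)
    have g: "g > 0" "(c, d) \<in> prim" using gp by (auto simp: p)
    have cop: "coprime c d" using g by (simp add: prim_def)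
    define q where "q = Q (c, d)"
    have q: "q \<ge> 1" unfolding q_def by (rule Q_pos[OF prim_lexpos[OF g(2)]])
    have gr: "real g > 0" using g by simp
    define R where "R = real g ^ 2 * q"
    have R: "R \<ge> 1"
    proof -
      have "1 * 1 \<le> real g ^ 2 * q" using g q by (intro mult_mono) auto
      then show ?thesis by (simp add: R_def)
    qed
    have gcd: "gcd (int g * c) (int g * d) = int g" using g by (simp add: gcd_mult_left prim_def)
    have ft: "f ((g, p), y) = of_real (Q y + R) powr (- (u / 2)) * of_real q powr (u / 2 - s)" for y
    proof -
      obtain a b where y: "y = (a, b)" by (cases y)
      have "Q (int g * c, int g * d) / real_of_int (int g) ^ 2 = q" using g by (simp add: Q_mult q_def)
      then show ?thesis
        unfolding f_def p y prod.case tau_def gcd by (simp add: Q_mult q_def R_def)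
    qed
    have tot: "((\<lambda>y. f ((g, p), y)) has_sum (lat (u / 2) R * of_real q powr (u / 2 - s))) UNIV"
      unfolding ft by (rule has_sum_cmult_left[OF lat_has_sum[OF v R]])
    let ?L = "range (\<lambda>k :: int. (k * c, k * d))"
    have inj: "inj (\<lambda>k :: int. (k * c, k * d))"
      using prim_lexpos[OF g(2)] by (auto simp: inj_on_def lexpos_def)
    have line: "((\<lambda>y. f ((g, p), y)) has_sum (row (u / 2) g * of_real q powr (- s))) ?L"
    proof (subst has_sum_reindex[OF inj])
      have "f ((g, p), (k * c, k * d)) = of_real (Q (k, int g)) powr (- (u / 2)) * of_real q powr (- s)" for k
      proof -
        have e: "Q (k * c, k * d) + R = Q (k, int g) * q"
          by (simp add: Q_mult R_def q_def) (simp add: Q_def algebra_simps)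
        have kg: "Q (k, int g) > 0" using Q_ge_1[of k "int g"] g by simp
        have "f ((g, p), (k * c, k * d)) = of_real (Q (k, int g)) powr (- (u / 2)) * (of_real q powr (- (u / 2)) * of_real q powr (u / 2 - s))"
          unfolding ft e using powr_of_real_mult[OF kg, of q] q by simp
        also have "of_real q powr (- (u / 2)) * of_real q powr (u / 2 - s) = (of_real q powr (- s) :: complex)"
          by (simp add: powr_add[symmetric])
        finally show ?thesis .
      qed
      then show "((\<lambda>y. f ((g, p), y)) \<circ> (\<lambda>k. (k * c, k * d)) has_sum (row (u / 2) g * of_real q powr (- s))) UNIV"
        using has_sum_cmult_left[OF row_has_sum(1)[OF v g(1)], of "of_real q powr (- s)"] by (simp add: o_def)
    qed
    \<comment> \<open>If a d = b c with c, d coprime, then c divides a and d divides b, so (a, b) is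
      an integral multiple of (c, d).\<close>
    have Lc: "UNIV - ?L = ?B (g, p)"
    proof -
      have "a * d - b * c = 0 \<longleftrightarrow> (a, b) \<in> ?L" for a b
      proof
        assume h: "a * d - b * c = 0"
        then have h': "a * d = b * c" by simp
        then have "c dvd a * d" "d dvd b * c" by (metis dvd_triv_right, metis dvd_triv_right)
        then have "c dvd a" "d dvd b" using cop by (simp_all add: coprime_dvd_mult_left_iff coprime_commute)
        then obtain k l where kl: "a = c * k" "b = d * l" by (auto elim!: dvdE)
        have cdne: "c \<noteq> 0 \<or> d \<noteq> 0" using prim_lexpos[OF g(2)] by (auto simp: lexpos_def)
        show "(a, b) \<in> ?L"
        proof (cases "c = 0")
          case True
          then show ?thesis using kl by (auto simp: mult.commute intro!: image_eqI[of _ _ l])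
        next
          case c: False
          show ?thesis
          proof (cases "d = 0")
            case True
            then show ?thesis using kl by (auto simp: mult.commute intro!: image_eqI[of _ _ k])
          next
            case False
            then have "k = l" using c h' kl by simp
            then show ?thesis using kl by (auto simp: mult.commute intro!: image_eqI[of _ _ k])
          qed
        qed
      qed auto
      then show ?thesis by (auto simp: p)
    qed
    have "((\<lambda>y. f ((g, p), y)) has_sum (lat (u / 2) R * of_real q powr (u / 2 - s) - row (u / 2) g * of_real q powr (- s))) (UNIV - ?L)"
      by (rule has_sum_Diff[OF tot line]) auto
    also have "lat (u / 2) R * of_real q powr (u / 2 - s) - row (u / 2) g * of_real q powr (- s) = b (g, p)"
    proof -
      have "of_real R powr (1 - u / 2) = of_real (real g) powr (- (u - 2)) * (of_real q powr (1 - u / 2) :: complex)"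
        using powr_of_square_mult[OF gr, of q "1 - u / 2"] q by (simp add: R_def algebra_simps)
      moreover have "of_real q powr (1 - u / 2) * of_real q powr (u / 2 - s) = (of_real q powr (- (s - 1)) :: complex)"
        by (simp add: powr_add[symmetric])
      ultimately have m: "of_real R powr (1 - u / 2) * of_real q powr (u / 2 - s)
          = of_real (real g) powr (- (u - 2)) * (of_real q powr (- (s - 1)) :: complex)" by (simp only: mult.assoc)
      have "lat (u / 2) R = lat_err (u / 2) R + C * of_real R powr (1 - u / 2)" by (simp add: lat_err_def C_def)
      then have "lat (u / 2) R * of_real q powr (u / 2 - s) = C * (of_real R powr (1 - u / 2) * of_real q powr (u / 2 - s))
          + of_real q powr (u / 2 - s) * lat_err (u / 2) R" by (simp add: algebra_simps)
      then show ?thesis unfolding m by (simp add: b_def p q_def phi_term_def u_def R_def)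
    qed
    finally show ?thesis unfolding Lc .
  qed
  have fS: "(f has_sum infsum (tau s u) quad) (Sigma ({0<..} \<times> prim) ?B)"
    using has_sum_reindex_bij_betw[OF bij, of "tau s u"] tau_summable[OF s w] unfolding f_def u_def by simp
  have "(b has_sum infsum (tau s u) quad) ({0<..} \<times> prim)"
    by (rule has_sum_Sigma'[OF fS]) (use fsum in auto)
  moreover have "(b has_sum (C * (zeta_ser (u - 2) * eis (s - 1)) + phi (s, w) - halfplane (u / 2) * eis s)) ({0<..} \<times> prim)"
  proof -
    have 1: "((\<lambda>(g, p). of_real (real g) powr (- (u - 2)) * of_real (Q p) powr (- (s - 1))) has_sum (zeta_ser (u - 2) * eis (s - 1))) ({0<..} \<times> prim)"
      by (intro has_sum_product_complex zeta_ser_has_sum eis_has_sum) (use s w in \<open>auto simp: u_def\<close>)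
    have 2: "((\<lambda>x. phi_term x (s, w)) has_sum phi (s, w)) ({0<..} \<times> prim)"
      by (rule phi_has_sum) (use s w in \<open>auto simp: strip_def\<close>)
    have 3: "((\<lambda>(g, p). row (u / 2) g * of_real (Q p) powr (- s)) has_sum (halfplane (u / 2) * eis s)) ({0<..} \<times> prim)"
      by (intro has_sum_product_complex row_has_sum(2) v eis_has_sum) (use s in auto)
    have "((\<lambda>x. C * (case x of (g, p) \<Rightarrow> of_real (real g) powr (- (u - 2)) * of_real (Q p) powr (- (s - 1))) + phi_term x (s, w)
        + - (case x of (g, p) \<Rightarrow> row (u / 2) g * of_real (Q p) powr (- s)))
        has_sum (C * (zeta_ser (u - 2) * eis (s - 1)) + phi (s, w) + - (halfplane (u / 2) * eis s))) ({0<..} \<times> prim)"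
      by (intro has_sum_add has_sum_cmult_right has_sum_uminusI 1 2 3)
    moreover have "(\<lambda>x. C * (case x of (g, p) \<Rightarrow> of_real (real g) powr (- (u - 2)) * of_real (Q p) powr (- (s - 1))) + phi_term x (s, w)
        + - (case x of (g, p) \<Rightarrow> row (u / 2) g * of_real (Q p) powr (- s))) = b"
      by (auto simp: b_def fun_eq_iff)
    ultimately show ?thesis by simp
  qed
  ultimately have "infsum (tau s u) quad = C * (zeta_ser (u - 2) * eis (s - 1)) + phi (s, w) - halfplane (u / 2) * eis s"
    by (rule has_sum_unique)
  moreover have "(tau s u has_sum infsum (tau s u) quad) quad"
    using tau_summable[OF s w] unfolding u_def by (rule has_sum_infsum)
  ultimately show ?thesis by (simp add: C_def mult.assoc)
qed

section \<open>The remainder and the continued height zeta function\<close>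

definition Phi :: "complex \<times> complex \<Rightarrow> complex" where
  "Phi = (\<lambda>(s, w). phi (s, w) * inverse (zeta_ser (s + w)) +
     (Lambda (s + w - 1) / Lambda (s + w) - halfplane ((s + w) / 2) * inverse (zeta_ser (s + w))) * eis s)"

text \<open>\<open>Phi\<close> contains the second summand with the opposite sign and, in its place,
  the contribution of the lines. Where the series converges the two copies cancel, which leaves the
  slice sums of \<open>tau_quad\<close> divided by \<zeta>(u).\<close>

definition Zfun :: "complex \<times> complex \<Rightarrow> complex" where
  "Zfun = (\<lambda>(s, w). Lambda (s + w - 2) / Lambda (s + w) * eisenstein_e (s - 3/2)
         - Lambda (s + w - 1) / Lambda (s + w) * eisenstein_e (s - 1/2) + Phi (s, w))"

lemma Lambda_nonzero: "Re s \<ge> 2 \<Longrightarrow> Lambda s \<noteq> 0"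
proof -
  assume s: "Re s \<ge> 2"
  have "Gamma (s / 2) \<noteq> 0"
  proof -
    have "Re (s / 2) > 0" using s by simp
    then have "s / 2 \<notin> \<int>\<^sub>\<le>\<^sub>0" by (auto elim!: nonpos_Ints_cases)
    then show ?thesis by (simp add: Gamma_eq_zero_iff)
  qed
  then show ?thesis using s zeta_ser_nonzero[OF s] by (simp add: Lambda_eq)
qed

text \<open>With u = s + w, on \<open>strip\<close> one has Re (u - 1) > 1, Re (u / 2) > 1 and Re s
  > 1, so each factor is given by a convergent series, and the denominators do not vanish because Re
  u > 2.\<close>

lemma Phi_holomorphic: "holomorphic2_on Phi strip"
proof -
  have L: "(\<lambda>u. Lambda (u - 1) / Lambda u - halfplane (u / 2) * inverse (zeta_ser u)) holomorphic_on {u. Re u > 2}"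
  proof (intro holomorphic_intros)
    have "(Lambda \<circ> (\<lambda>u. u - 1)) holomorphic_on {u. Re u > 2}"
      by (rule holomorphic_on_compose_gen[OF _ Lambda_holomorphic]) (auto intro!: holomorphic_intros)
    then show "(\<lambda>u. Lambda (u - 1)) holomorphic_on {u. Re u > 2}" by (simp add: o_def)
    show "Lambda holomorphic_on {u. Re u > 2}" by (rule holomorphic_on_subset[OF Lambda_holomorphic]) auto
    have "(halfplane \<circ> (\<lambda>u. u / 2)) holomorphic_on {u. Re u > 2}"
      by (rule holomorphic_on_compose_gen[OF _ halfplane_holomorphic]) (auto intro!: holomorphic_intros)
    then show "(\<lambda>u. halfplane (u / 2)) holomorphic_on {u. Re u > 2}" by (simp add: o_def)
    show "zeta_ser holomorphic_on {u. Re u > 2}" by (rule holomorphic_on_subset[OF zeta_ser_holomorphic]) auto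
  qed (auto simp: Lambda_nonzero zeta_ser_nonzero)
  have I: "(\<lambda>u. inverse (zeta_ser u)) holomorphic_on {u. Re u > 2}"
    by (intro holomorphic_intros holomorphic_on_subset[OF zeta_ser_holomorphic]) (auto simp: zeta_ser_nonzero)
  have "holomorphic2_on (\<lambda>(s, w). (\<lambda>u. Lambda (u - 1) / Lambda u - halfplane (u / 2) * inverse (zeta_ser u)) (1 * s + 1 * w + 0)) strip"
    by (rule holomorphic2_on_compose_affine[OF L]) (auto simp: open_halfspace_Re_gt strip_def)
  moreover have "holomorphic2_on (\<lambda>(s, w). (\<lambda>u. inverse (zeta_ser u)) (1 * s + 1 * w + 0)) strip"
    by (rule holomorphic2_on_compose_affine[OF I]) (auto simp: open_halfspace_Re_gt strip_def)
  moreover have "holomorphic2_on (\<lambda>(s, w). eis (1 * s + 0 * w + 0)) strip"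
    by (rule holomorphic2_on_compose_affine[OF eis_holomorphic]) (auto simp: open_halfspace_Re_gt strip_def)
  ultimately have "holomorphic2_on (\<lambda>z. phi z * (case z of (s, w) \<Rightarrow> (\<lambda>u. inverse (zeta_ser u)) (1 * s + 1 * w + 0))
      + (case z of (s, w) \<Rightarrow> (\<lambda>u. Lambda (u - 1) / Lambda u - halfplane (u / 2) * inverse (zeta_ser u)) (1 * s + 1 * w + 0))
      * (case z of (s, w) \<Rightarrow> eis (1 * s + 0 * w + 0))) strip"
    by (intro holomorphic2_on_add holomorphic2_on_mult phi_holomorphic)
  moreover have "(\<lambda>z. phi z * (case z of (s, w) \<Rightarrow> (\<lambda>u. inverse (zeta_ser u)) (1 * s + 1 * w + 0))
      + (case z of (s, w) \<Rightarrow> (\<lambda>u. Lambda (u - 1) / Lambda u - halfplane (u / 2) * inverse (zeta_ser u)) (1 * s + 1 * w + 0))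
      * (case z of (s, w) \<Rightarrow> eis (1 * s + 0 * w + 0))) = Phi"
    by (auto simp: Phi_def fun_eq_iff)
  ultimately show ?thesis by simp
qed

lemma Zfun_meromorphic: "meromorphic2_on Zfun strip"
proof -
  have E: "eisenstein_e meromorphic_on UNIV" using eisenstein_props(1) by (simp add: nicely_meromorphic_on_def)
  have shift: "(\<lambda>u. F (u - c)) meromorphic_on UNIV" if "F meromorphic_on UNIV" for F c
    by (rule meromorphic_on_compose[OF that]) (auto intro!: analytic_intros)
  have 1: "meromorphic2_on (\<lambda>(s, w). (\<lambda>u. Lambda (u - 2) / Lambda u) (1 * s + 1 * w + 0)) strip"
    by (rule meromorphic2_on_compose_affine) (intro meromorphic_intros shift Lambda_meromorphic, simp)
  have 2: "meromorphic2_on (\<lambda>(s, w). (\<lambda>u. - (Lambda (u - 1) / Lambda u)) (1 * s + 1 * w + 0)) strip"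
    by (rule meromorphic2_on_compose_affine) (intro meromorphic_intros shift Lambda_meromorphic, simp)
  have 3: "meromorphic2_on (\<lambda>(s, w). eisenstein_e (1 * s + 0 * w + (- 3 / 2))) strip"
    by (rule meromorphic2_on_compose_affine[OF E]) simp
  have 4: "meromorphic2_on (\<lambda>(s, w). eisenstein_e (1 * s + 0 * w + (- 1 / 2))) strip"
    by (rule meromorphic2_on_compose_affine[OF E]) simp
  have "meromorphic2_on (\<lambda>z. (case z of (s, w) \<Rightarrow> (\<lambda>u. Lambda (u - 2) / Lambda u) (1 * s + 1 * w + 0)) * (case z of (s, w) \<Rightarrow> eisenstein_e (1 * s + 0 * w + (- 3 / 2)))
    + (case z of (s, w) \<Rightarrow> (\<lambda>u. - (Lambda (u - 1) / Lambda u)) (1 * s + 1 * w + 0)) * (case z of (s, w) \<Rightarrow> eisenstein_e (1 * s + 0 * w + (- 1 / 2))) + Phi z) strip"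
    by (intro meromorphic2_on_add meromorphic2_on_mult 1 2 3 4 holomorphic2_on_imp_meromorphic2_on Phi_holomorphic open_strip)
  moreover have "(\<lambda>z. (case z of (s, w) \<Rightarrow> (\<lambda>u. Lambda (u - 2) / Lambda u) (1 * s + 1 * w + 0)) * (case z of (s, w) \<Rightarrow> eisenstein_e (1 * s + 0 * w + (- 3 / 2)))
    + (case z of (s, w) \<Rightarrow> (\<lambda>u. - (Lambda (u - 1) / Lambda u)) (1 * s + 1 * w + 0)) * (case z of (s, w) \<Rightarrow> eisenstein_e (1 * s + 0 * w + (- 1 / 2))) + Phi z) = Zfun"
    by (auto simp: Zfun_def fun_eq_iff)
  ultimately show ?thesis by simp
qed

text \<open>The factor pi / (u/2 - 1) of the plane integral is exactly the quotient of the
  archimedean factors: Gamma (u/2) = (u/2 - 1) Gamma (u/2 - 1), and the powers of pi differ by one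
  factor pi.\<close>

lemma Lambda_quotient:
  assumes u: "Re u > 3"
  shows "Lambda (u - 2) / Lambda u = of_real pi / (u / 2 - 1) * zeta_ser (u - 2) / zeta_ser u"
proof -
  have nz: "u / 2 - 1 \<notin> \<int>\<^sub>\<le>\<^sub>0" "u / 2 - 1 \<noteq> 0"
  proof -
    have R: "Re (u / 2 - 1) > 0" using u by simp
    show "u / 2 - 1 \<notin> \<int>\<^sub>\<le>\<^sub>0"
    proof
      assume "u / 2 - 1 \<in> \<int>\<^sub>\<le>\<^sub>0"
      then obtain n where "u / 2 - 1 = of_int n" "n \<le> 0" by (elim nonpos_Ints_cases)
      then have "Re (u / 2 - 1) \<le> 0" by (simp only:) simp
      then show False using R by linarith
    qed
    show "u / 2 - 1 \<noteq> 0" using R by (metis less_irrefl zero_complex.simps(1))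
  qed
  have G: "Gamma (u / 2) = (u / 2 - 1) * Gamma (u / 2 - 1)" using Gamma_plus1[OF nz(1)] by simp
  have G0: "Gamma (u / 2 - 1) \<noteq> 0" using nz by (simp add: Gamma_eq_zero_iff)
  have P: "(of_real pi :: complex) powr (- (u - 2) / 2) = of_real pi * of_real pi powr (- u / 2)"
  proof -
    have "(of_real pi :: complex) powr (- (u - 2) / 2) = of_real pi powr (1 + - u / 2)" by (simp add: field_simps)
    also have "\<dots> = of_real pi powr 1 * of_real pi powr (- u / 2)" by (rule powr_add)
    finally show ?thesis by simp
  qed
  have "Lambda (u - 2) = of_real pi powr (- (u - 2) / 2) * Gamma ((u - 2) / 2) * zeta_ser (u - 2)"
    by (rule Lambda_eq) (use u in simp)
  then have "Lambda (u - 2) = of_real pi * of_real pi powr (- u / 2) * Gamma (u / 2 - 1) * zeta_ser (u - 2)"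
    unfolding P by (simp add: diff_divide_distrib)
  moreover have "Lambda u = of_real pi powr (- u / 2) * ((u / 2 - 1) * Gamma (u / 2 - 1)) * zeta_ser u"
    using u by (subst Lambda_eq) (simp_all add: G)
  moreover have "zeta_ser u \<noteq> 0" using u by (intro zeta_ser_nonzero) auto
  moreover have "(c * p * G * z') / (p * (A * G) * z) = c / A * z' / z" if "p \<noteq> 0" "G \<noteq> 0" "A \<noteq> 0" "z \<noteq> 0"
    for c p G z' A z :: complex
    using that by (simp add: field_simps)
  ultimately show ?thesis using G0 nz(2) by simp
qed

lemma height_zeta_has_sum:
  assumes s: "Re s > 4" and w: "Re w > 4"
  shows "(height_zeta_term s w has_sum Zfun (s, w)) PGL2_Q"
proof -
  define u where "u = s + w"
  obtain Z where Z: "(tau s u has_sum Z) quad_prim" "(tau s u has_sum (zeta_ser u * Z)) quad"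
    using tau_quad_prim[OF s w] unfolding u_def by blast
  \<comment> \<open>The same sum over all quadruples is evaluated twice, by content and by bottom
    row; this determines Z after division by \<zeta>(u).\<close>
  have h: "zeta_ser u * Z = of_real pi / (u / 2 - 1) * zeta_ser (u - 2) * eis (s - 1) + phi (s, w) - halfplane (u / 2) * eis s"
    using has_sum_unique[OF Z(2)] tau_quad[OF s w] unfolding u_def by blast
  have z: "zeta_ser u \<noteq> 0" using s w by (intro zeta_ser_nonzero) (simp add: u_def)
  have div: "Z = K / \<zeta> * e + f * inverse \<zeta> - H * inverse \<zeta> * e'"
    if "\<zeta> * Z = K * e + f - H * e'" "\<zeta> \<noteq> 0" for \<zeta> K e f H e' :: complex
  proof -
    have "Z = inverse \<zeta> * (\<zeta> * Z)" using that(2) by simp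
    then show ?thesis unfolding that(1) by (simp add: divide_inverse algebra_simps)
  qed
  note Zeq = div[OF h z]
  have e1: "eisenstein_e (s - 3 / 2) = eis (s - 1)" using eisenstein_props(2)[of "s - 3 / 2"] s by simp
  have e2: "eisenstein_e (s - 1 / 2) = eis s" using eisenstein_props(2)[of "s - 1 / 2"] s by simp
  have u: "Re u > 3" using s w by (simp add: u_def)
  have "Zfun (s, w) = Z"
    unfolding Zfun_def Phi_def prod.case u_def[symmetric] e1 e2 Lambda_quotient[OF u] by (subst Zeq) (simp add: algebra_simps)
  moreover have "(height_zeta_term s w has_sum Z) PGL2_Q"
  proof -
    have "((\<lambda>x. height_zeta_term s w (S_rel `` {imat x})) has_sum Z) quad_prim"
      using Z(1) by (rule has_sum_cong[THEN iffD1, rotated]) (simp add: height_zeta_term_eq u_def)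
    then show ?thesis using has_sum_reindex_bij_betw[OF bij_PGL2, of "height_zeta_term s w"] by simp
  qed
  ultimately show ?thesis by simp
qed

theorem theorem1p3:
  shows "\<exists>\<epsilon>>0. \<exists>\<Phi> Z.
    holomorphic2_on \<Phi> (region \<epsilon>) \<and>
    height_zeta_on Z (region \<epsilon>) \<and>
    (\<forall>s w. (s, w) \<in> region \<epsilon> \<and>
       \<not> is_pole Lambda (s + w - 2) \<and> \<not> is_pole eisenstein_e (s - 3/2) \<and>
       \<not> is_pole Lambda (s + w - 1) \<and> \<not> is_pole eisenstein_e (s - 1/2) \<longrightarrow>
       Z (s, w) = Lambda (s + w - 2) / Lambda (s + w) * eisenstein_e (s - 3/2)
         - Lambda (s + w - 1) / Lambda (s + w) * eisenstein_e (s - 1/2) + \<Phi> (s, w))"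
proof -
  have reg: "region (1 / 4) = strip" by (auto simp: region_def strip_def)
  have hz: "height_zeta_on Zfun strip"
    unfolding height_zeta_on_def using Zfun_meromorphic height_zeta_has_sum by blast
  have "holomorphic2_on Phi (region (1 / 4)) \<and> height_zeta_on Zfun (region (1 / 4)) \<and>
    (\<forall>s w. (s, w) \<in> region (1 / 4) \<and>
       \<not> is_pole Lambda (s + w - 2) \<and> \<not> is_pole eisenstein_e (s - 3/2) \<and>
       \<not> is_pole Lambda (s + w - 1) \<and> \<not> is_pole eisenstein_e (s - 1/2) \<longrightarrow>
       Zfun (s, w) = Lambda (s + w - 2) / Lambda (s + w) * eisenstein_e (s - 3/2)
         - Lambda (s + w - 1) / Lambda (s + w) * eisenstein_e (s - 1/2) + Phi (s, w))"
  proof (intro conjI allI impI)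
    show "holomorphic2_on Phi (region (1 / 4))" unfolding reg by (rule Phi_holomorphic)
    show "height_zeta_on Zfun (region (1 / 4))" unfolding reg by (rule hz)
  qed (simp add: Zfun_def)
  then show ?thesis
    by (intro exI[of _ "1 / 4 :: real"] conjI exI[of _ Phi] exI[of _ Zfun]) (simp, blast+)
qed

end
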